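(* Let $\gamma>2$ and $f_0\in\mathcal{P}_1(\mathbb{R}^4)\cap L^\infty_\gamma(\mathbb{R}^4)$. Then there exists a global weak solution $f$ of $$\partial_t f_t+\mathcal{V}[f_t]\cdot\nabla_x f_t+\mathcal{A}[f_t]\cdot\nabla_v f_t=0,\qquad t>0,\ (x,v)\in\mathbb{R}^2\times\mathbb{R}^2,$$ with initial condition $f_0$, that satisfies: (i) for every $p\in[1,\infty]$ and every $t\ge0$, $\|f_t\|_p=\|f_0\|_p$; (ii) for every $t\ge0$, $\|f_t\|_\gamma\le\bigl(1+c\,\|f_0\|_\infty^{1/4}\,t\bigr)^{2\gamma}\|f_0\|_\gamma$, where $c=\dfrac{2^{5/4}}{3\sqrt{\pi}}$.
   Context: For $u=(u_1,u_2)\in\mathbb{R}^2$, ${}^\perp u=(u_2,-u_1)$. For $x,v\in\mathbb{R}^2$, $(x,v)\neq(0,0)$, $J(x,v)=\frac{{}^\perp x}{2\pi|x|^2}\mathbf{1}_{|x|\ge|v|}$ (so $J(0,v)=0$ for $v\ne0$). The fields are $$\mathcal{V}[f](x,v)=\int_{\mathbb{R}^4}J(x-y,v-w)f(y,w)\,dy\,dw,\qquad \mathcal{A}[f](x,v)=\int_{\mathbb{R}^4}J(v-w,x-y)f(y,w)\,dy\,dw.$$ Norm: for $\gamma>0$, $\|f\|_\gamma=\operatorname{ess\,sup}_{(x,v)\in\mathbb{R}^2\times\mathbb{R}^2}(1+|x|)^\gamma(1+|v|)^\gamma|f(x,v)|$ and $L^\infty_\gamma(\mathbb{R}^4)=\{f\in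 L^\infty(\mathbb{R}^4):\|f\|_\gamma<\infty\}$. $\|\cdot\|_p$ is the $L^p(\mathbb{R}^4)$ norm. $\mathcal{P}_1(\mathbb{R}^4)$ is the set of probability measures on $\mathbb{R}^4$ with finite first moment $\int(|x|+|v|)\,\mu(dx,dv)<\infty$; measures are identified with their densities. Weak solution: $f\in L^1_{\mathrm{loc}}(\mathbb{R}_+;(L^1\cap L^\infty)(\mathbb{R}^4))$, $\mathbb{R}_+=[0,\infty)$, is a weak solution with initial datum $f_0$ (a probability measure on $\mathbb{R}^4$) if for all $\psi\in C^1_c(\mathbb{R}_+\times\mathbb{R}^4)$ $$\int_{\mathbb{R}_+\times\mathbb{R}^4}f(t,x,v)\bigl(\partial_t+\mathcal{V}[f_t](x,v)\cdot\nabla_x+\mathcal{A}[f_t](x,v)\cdot\nabla_v\bigr)\psi(t,x,v)\,dt\,dx\,dv=-\int_{\mathbb{R}^4}f_0(x,v)\psi(0,x,v)\,dx\,dv,$$ where $f_t=f(t,\cdot,\cdot)$. *)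

theory Defs
  imports "HOL-Probability.Probability"
begin

type_synonym R2 = "real^2"

text \<open>Phase space \<open>\<real>\<^sup>2 \<times> \<real>\<^sup>2\<close>; its Lebesgue measure is \<open>lborel\<close> on the product type.\<close>
type_synonym R4 = "R2 \<times> R2"

definition perp :: "R2 \<Rightarrow> R2" where
  "perp u = vector [u $ 2, - (u $ 1)]"

text \<open>Since \<open>1 / 0 = 0\<close>, this also gives \<open>J 0 v = 0\<close> for every \<open>v\<close>; the value at the
  origin \<open>(0, 0)\<close>, where the kernel is not defined, is thereby set to \<open>0\<close>.\<close>
definition J :: "R2 \<Rightarrow> R2 \<Rightarrow> R2" where
  "J x v = (if norm x \<ge> norm v then (1 / (2 * pi * (norm x)\<^sup>2)) *\<^sub>R perp x else 0)"

definition V_field :: "(R4 \<Rightarrow> real) \<Rightarrow> R2 \<Rightarrow> R2 \<Rightarrow> R2" where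
  "V_field f x v = (LINT (y, w)|lborel. f (y, w) *\<^sub>R J (x - y) (v - w))"

definition A_field :: "(R4 \<Rightarrow> real) \<Rightarrow> R2 \<Rightarrow> R2 \<Rightarrow> R2" where
  "A_field f x v = (LINT (y, w)|lborel. f (y, w) *\<^sub>R J (v - w) (x - y))"

text \<open>Norms take values in \<open>[0, \<infinity>]\<close>, so that a function of infinite norm is not assigned a
  junk real value. There are no real powers on \<open>ennreal\<close>, hence the case split on the
  finiteness of the integral.\<close>
definition Lp_norm :: "ennreal \<Rightarrow> (R4 \<Rightarrow> real) \<Rightarrow> ennreal" where
  "Lp_norm p f =
     (if p = \<infinity> then esssup lborel (\<lambda>z. ennreal \<bar>f z\<bar>)
      else (let I = \<integral>\<^sup>+ z. ennreal (\<bar>f z\<bar> powr enn2real p) \<partial>lborel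
            in if I = \<infinity> then \<infinity> else ennreal (enn2real I powr (1 / enn2real p))))"

definition weighted_norm :: "real \<Rightarrow> (R4 \<Rightarrow> real) \<Rightarrow> ennreal" where
  "weighted_norm \<gamma> f =
     esssup lborel (\<lambda>(x, v). ennreal ((1 + norm x) powr \<gamma> * (1 + norm v) powr \<gamma> * \<bar>f (x, v)\<bar>))"

definition Linf_weighted :: "real \<Rightarrow> (R4 \<Rightarrow> real) set" where
  "Linf_weighted \<gamma> =
     {f \<in> borel_measurable lborel. Lp_norm \<infinity> f < \<infinity> \<and> weighted_norm \<gamma> f < \<infinity>}"

definition P1 :: "R4 measure set" where
  "P1 = {\<mu>. sets \<mu> = sets borel \<and> prob_space \<mu> \<and> integrable \<mu> (\<lambda>(x, v). norm x + norm v)}"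

definition is_P1_density :: "(R4 \<Rightarrow> real) \<Rightarrow> bool" where
  "is_P1_density f \<longleftrightarrow> f \<in> borel_measurable lborel \<and> (AE z in lborel. 0 \<le> f z) \<and>
     density lborel (\<lambda>z. ennreal (f z)) \<in> P1"

definition spacetime :: "(real \<times> R2 \<times> R2) set" where
  "spacetime = {0..} \<times> UNIV"

text \<open>\<open>L\<^sup>1\<^sub>l\<^sub>o\<^sub>c(\<real>\<^sub>+; L\<^sup>1 \<inter> L\<^sup>\<infinity>)\<close>, read as joint measurability in time and phase space together
  with local integrability in time of \<open>\<parallel>f\<^sub>t\<parallel>\<^sub>1 + \<parallel>f\<^sub>t\<parallel>\<^sub>\<infinity>\<close>. Bochner measurability into the
  non-separable space \<open>L\<^sup>\<infinity>\<close> is not demanded.\<close>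
definition L1loc_L1_Linf :: "(real \<Rightarrow> R4 \<Rightarrow> real) \<Rightarrow> bool" where
  "L1loc_L1_Linf f \<longleftrightarrow>
     set_borel_measurable lborel spacetime (\<lambda>(t, z). f t z) \<and>
     (\<forall>T\<ge>0. (\<integral>\<^sup>+ t\<in>{0..T}. (Lp_norm 1 (f t) + Lp_norm \<infinity> (f t)) \<partial>lborel) < \<infinity>)"

text \<open>\<open>\<psi> \<in> C\<^sup>1\<^sub>c(\<real>\<^sub>+ \<times> \<real>\<^sup>4)\<close> with \<open>\<psi>t\<close>, \<open>\<psi>x\<close>, \<open>\<psi>v\<close> its derivative in time and its gradients in
  \<open>x\<close> and \<open>v\<close>. Differentiability is relative to the closed half space, hence one-sided at
  \<open>t = 0\<close>; the support may meet \<open>t = 0\<close>. The derivatives are determined by \<open>\<psi>\<close> there.\<close>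
definition C1c_test ::
  "(real \<times> R2 \<times> R2 \<Rightarrow> real) \<Rightarrow> (real \<times> R2 \<times> R2 \<Rightarrow> real) \<Rightarrow>
   (real \<times> R2 \<times> R2 \<Rightarrow> R2) \<Rightarrow> (real \<times> R2 \<times> R2 \<Rightarrow> R2) \<Rightarrow> bool" where
  "C1c_test \<psi> \<psi>t \<psi>x \<psi>v \<longleftrightarrow>
     (\<forall>q\<in>spacetime. (\<psi> has_derivative (\<lambda>(s, \<xi>, \<eta>). \<psi>t q * s + \<psi>x q \<bullet> \<xi> + \<psi>v q \<bullet> \<eta>))
        (at q within spacetime)) \<and>
     continuous_on spacetime \<psi>t \<and> continuous_on spacetime \<psi>x \<and> continuous_on spacetime \<psi>v \<and>
     compact (closure {q \<in> spacetime. \<psi> q \<noteq> 0})"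

text \<open>Convergence of the space-time integral is part of the definition: it is not a consequence
  of \<open>L1loc_L1_Linf f\<close>, as the integrand is quadratic in \<open>f\<close>.\<close>
definition weak_solution :: "(R4 \<Rightarrow> real) \<Rightarrow> (real \<Rightarrow> R4 \<Rightarrow> real) \<Rightarrow> bool" where
  "weak_solution f0 f \<longleftrightarrow>
     L1loc_L1_Linf f \<and>
     (\<forall>\<psi> \<psi>t \<psi>x \<psi>v. C1c_test \<psi> \<psi>t \<psi>x \<psi>v \<longrightarrow>
        (let I = (\<lambda>(t, x, v). f t (x, v) *
                    (\<psi>t (t, x, v) + V_field (f t) x v \<bullet> \<psi>x (t, x, v)
                                  + A_field (f t) x v \<bullet> \<psi>v (t, x, v)))
         in set_integrable lborel spacetime I \<and>
            (LINT q:spacetime|lborel. I q) =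
              - (LINT (x, v)|lborel. f0 (x, v) * \<psi> (0, x, v))))"

end

theory Submission
  imports Defs
begin

text \<open>The drift generated by a density is divergence free, and although the kernel jumps across the cone
  \<open>\<bar>x\<bar> = \<bar>v\<bar>\<close> it is Lipschitz as soon as the density is bounded by a multiple of
  \<open>(1 + \<bar>x\<bar>)\<^sup>-\<^sup>\<gamma> (1 + \<bar>v\<bar>)\<^sup>-\<^sup>\<gamma>\<close>: the layer of width \<open>\<delta>\<close> around the cone has, for every \<open>x\<close>, an area of
  order \<open>\<delta> \<bar>x\<bar>\<close> in \<open>v\<close>, which the factor \<open>1 / \<bar>x\<bar>\<close> of the kernel compensates, and \<open>\<gamma> > 2\<close> makes the weight
  integrable in the plane. The same estimate controls the change of the drift when the density is
  transported by two uniformly close maps, so the characteristics solve a Lipschitz equation for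
  maps of phase space into itself.

  Existence and Liouville's theorem come together from an explicit scheme with a regularised kernel,
  alternating position and velocity kicks. Each kick is a planar map whose derivative is the
  identity plus a trace-free matrix of size \<open>h\<close>, so its Jacobian is \<open>1 + O(h\<^sup>2)\<close> and the errors of
  \<open>O(1 / h)\<close> kicks disappear in the limit. The limit flow preserves Lebesgue measure, and the
  solution is \<open>f\<^sub>0\<close> composed with its inverse: all \<open>L\<^sup>p\<close> norms are conserved. Splitting the
  integral of the kernel at the optimal radius bounds position and velocity drift by
  \<open>c \<parallel>f\<^sub>0\<parallel>\<^sub>\<infinity>\<^sup>1\<^sup>/\<^sup>4\<close>, whence the weighted estimate.\<close>

section \<open>Geometry of the kernel\<close>

text \<open>The drift is only shown to be Lipschitz, so Jacobians come from the regularised kernel,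
  whose derivative has size 1 / \<epsilon>. Hence two parameters: a kick of length h has a Jacobian
  error of order (h / \<epsilon>)^2, so T / h kicks accumulate T h / \<epsilon>^2, while
  regularising costs sqrt \<epsilon>. The choice \<epsilon> = 1 / (m + 2), h = 1 / (m + 2)^4 sends
  both to 0.

  The bounds must not be circular. Volume distortion at most 2 bounds the density of the image by 2
  M; this alone bounds the drift, hence the displacement; and bounded displacement turns the decay
  of the datum into decay of the image, which gives the Lipschitz constant.

  Maps are kept in Lagrangian form: the drift is an integral over labels w against the initial
  measure, with sources at \<Phi> w. The inverse of the flow appears only when the density is
  written down.

  The minimum over R of 1 / (2 pi R) + M pi R^3 / 3, far field plus near field, is c M^(1/4) with
  the constant c of the theorem.\<close>

lemma borel_measurable_fst [measurable]:
  "fst \<in> borel_measurable (borel :: ('a::second_countable_topology \<times> 'b::second_countable_topology) measure)"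
  by (subst borel_prod[symmetric]) (rule measurable_fst)

lemma borel_measurable_snd [measurable]:
  "snd \<in> borel_measurable (borel :: ('a::second_countable_topology \<times> 'b::second_countable_topology) measure)"
  by (subst borel_prod[symmetric]) (rule measurable_snd)

lemma perp_nth [simp]: "perp x $ 1 = x $ 2" "perp x $ 2 = - x $ 1"
  by (simp_all add: perp_def)

lemma linear_perp: "linear perp"
  by (rule linearI) (simp_all add: vec_eq_iff forall_2)

lemma inner_R2: "x \<bullet> y = x $ 1 * y $ 1 + x $ 2 * y $ 2" for x y :: R2
  by (simp add: inner_vec_def sum_2)

lemma inner_perp [simp]: "perp x \<bullet> perp y = x \<bullet> y" "perp x \<bullet> x = 0" "x \<bullet> perp x = 0"
  by (simp_all add: inner_R2)

lemma norm_perp [simp]: "norm (perp x) = norm x"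
  by (simp add: norm_eq_sqrt_inner)

lemma bounded_linear_perp: "bounded_linear perp"
  using linear_perp by (simp add: linear_conv_bounded_linear)

lemma borel_measurable_perp [measurable]: "perp \<in> borel_measurable borel"
  by (intro borel_measurable_continuous_onI linear_continuous_on bounded_linear_perp)

lemma borel_measurable_J [measurable (raw)]:
  assumes [measurable]: "f \<in> borel_measurable M" "g \<in> borel_measurable M"
  shows "(\<lambda>z. J (f z) (g z)) \<in> borel_measurable M"
  unfolding J_def by measurable

lemma norm_J: "norm (J x v) = (if norm v \<le> norm x then 1 / (2 * pi * norm x) else 0)"
  by (simp add: J_def power2_eq_square)

lemma nn_integral_lborel_reflect:
  fixes g :: "'a::euclidean_space \<Rightarrow> ennreal" and c :: 'a
  assumes [measurable]: "g \<in> borel_measurable borel"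
  shows "(\<integral>\<^sup>+ y. g (c - y) \<partial>lborel) = (\<integral>\<^sup>+ y. g y \<partial>lborel)"
  by (subst (2) lborel_affine[of "-1" c]) (auto simp: nn_integral_density nn_integral_distr)

text \<open>Planar area is linear in the squared radius, so an annulus described by the drop
  \<open>d\<close> of the squared radius has area \<open>pi * d\<close>, capped by the full disc.
  The slices at fixed x of the kernels estimated below are supported in such annuli.\<close>

lemma emeasure_annulus_le:
  fixes r d :: real
  assumes r: "0 \<le> r" and d: "0 \<le> d"
  shows "emeasure lborel {w::R2. norm w \<le> r \<and> r\<^sup>2 - d \<le> (norm w)\<^sup>2} \<le> ennreal (pi * min d (r\<^sup>2))"
proof (cases "r\<^sup>2 \<le> d")
  case True
  have "emeasure lborel {w::R2. norm w \<le> r \<and> r\<^sup>2 - d \<le> (norm w)\<^sup>2} \<le> emeasure lborel (cball (0::R2) r)"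
    by (intro emeasure_mono) auto
  also have "\<dots> = ennreal (pi * min d (r\<^sup>2))"
    using r True by (simp add: emeasure_cball unit_ball_vol_2)
  finally show ?thesis .
next
  case False
  define a where "a = sqrt (r\<^sup>2 - d)"
  have a: "0 \<le> a" "a \<le> r" "a\<^sup>2 = r\<^sup>2 - d"
    using False d r by (auto simp: a_def real_le_lsqrt)
  have eq: "{w::R2. norm w \<le> r \<and> r\<^sup>2 - d \<le> (norm w)\<^sup>2} = cball 0 r - ball 0 a"
    using a by (auto simp flip: a(3) simp: power_mono power2_le_iff_abs_le)
  have "emeasure lborel (cball (0::R2) r - ball 0 a)
    = emeasure lborel (cball (0::R2) r) - emeasure lborel (ball (0::R2) a)"
    using a by (intro emeasure_Diff) (auto simp: emeasure_ball)
  also have "\<dots> = ennreal (pi * r\<^sup>2 - pi * a\<^sup>2)"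
    using a(1,2) r by (simp add: emeasure_ball emeasure_cball unit_ball_vol_2 ennreal_minus)
  also have "pi * r\<^sup>2 - pi * a\<^sup>2 = pi * d"
    by (simp add: a(3) algebra_simps)
  finally show ?thesis using False by (simp add: eq)
qed

text \<open>The second variable is integrated first: translation and reflection invariance make the
  slice bound C available at every base point, and what remains is the mass of \<rho>. A kernel with
  bounded slices is thus paired with a density that decays in one planar variable.\<close>

lemma nn_integral_convolution_le:
  fixes H :: "'a::euclidean_space \<times> 'b::euclidean_space \<Rightarrow> ennreal" and \<rho> :: "'a \<Rightarrow> ennreal"
  assumes [measurable]: "H \<in> borel_measurable borel" "\<rho> \<in> borel_measurable borel"
    and C: "\<And>x. (\<integral>\<^sup>+ w. H (x, w) \<partial>lborel) \<le> C"
  shows "(\<integral>\<^sup>+ \<zeta>. H (z - \<zeta>) * \<rho> (fst \<zeta>) \<partial>lborel) \<le> C * (\<integral>\<^sup>+ y. \<rho> y \<partial>lborel)"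
proof -
  have "(\<integral>\<^sup>+ \<zeta>. H (z - \<zeta>) * \<rho> (fst \<zeta>) \<partial>lborel)
    = (\<integral>\<^sup>+ \<zeta>. H (z - \<zeta>) * \<rho> (fst \<zeta>) \<partial>(lborel \<Otimes>\<^sub>M lborel))"
    by (simp only: lborel_prod)
  also have "\<dots> = (\<integral>\<^sup>+ y. \<integral>\<^sup>+ w. H (z - (y, w)) * \<rho> y \<partial>lborel \<partial>lborel)"
    by (subst lborel.nn_integral_fst[symmetric]) (auto simp: lborel_prod)
  also have "\<dots> = (\<integral>\<^sup>+ y. (\<integral>\<^sup>+ w. H (fst z - y, snd z - w) \<partial>lborel) * \<rho> y \<partial>lborel)"
    by (intro nn_integral_cong, subst nn_integral_multc[symmetric]) (auto simp: minus_prod_def)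
  also have "\<dots> = (\<integral>\<^sup>+ y. (\<integral>\<^sup>+ w. H (fst z - y, w) \<partial>lborel) * \<rho> y \<partial>lborel)"
    by (intro nn_integral_cong, subst nn_integral_lborel_reflect) auto
  also have "\<dots> \<le> (\<integral>\<^sup>+ y. C * \<rho> y \<partial>lborel)"
    by (intro nn_integral_mono mult_right_mono C) auto
  also have "\<dots> = C * (\<integral>\<^sup>+ y. \<rho> y \<partial>lborel)"
    by (rule nn_integral_cmult) auto
  finally show ?thesis .
qed

section \<open>Integrals of the weight and of the norm\<close>

lemma nn_integral_weight_1d:
  fixes \<beta> :: real
  assumes "\<beta> > 1"
  shows "(\<integral>\<^sup>+ (s::real). ennreal ((1 + \<bar>s\<bar>) powr - \<beta>) \<partial>lborel) < \<infinity>"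
proof -
  let ?f = "\<lambda>s::real. ennreal ((1 + \<bar>s\<bar>) powr - \<beta>)"
  have fin: "(\<integral>\<^sup>+ s. ?f s * indicator {0..} s \<partial>lborel) < \<infinity>"
  proof -
    have "(\<integral>\<^sup>+ s. ennreal ((1 + s) powr - \<beta>) * indicator {0..} s \<partial>lborel)
        = ennreal (0 - (1 + 0) powr (1 - \<beta>) / (1 - \<beta>))"
    proof (rule nn_integral_FTC_atLeast)
      show "((\<lambda>s. (1 + s) powr (1 - \<beta>) / (1 - \<beta>)) \<longlongrightarrow> 0) at_top"
        using assms by real_asymp
      show "((\<lambda>s. (1 + s) powr (1 - \<beta>) / (1 - \<beta>)) has_real_derivative (1 + s) powr - \<beta>) (at s)"
        if "0 \<le> s" for s
        using that assms by (auto intro!: derivative_eq_intros)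
    qed auto
    moreover have "(\<integral>\<^sup>+ s. ?f s * indicator {0..} s \<partial>lborel)
        = (\<integral>\<^sup>+ s. ennreal ((1 + s) powr - \<beta>) * indicator {0..} s \<partial>lborel)"
      by (intro nn_integral_cong) (auto split: split_indicator)
    ultimately show ?thesis by simp
  qed
  have "(\<integral>\<^sup>+ s. ?f s \<partial>lborel) \<le> (\<integral>\<^sup>+ s. ?f s * indicator {0..} s + ?f (0 - s) * indicator {0..} (0 - s) \<partial>lborel)"
    by (intro nn_integral_mono) (auto split: split_indicator)
  also have "\<dots> = (\<integral>\<^sup>+ s. ?f s * indicator {0..} s \<partial>lborel) + (\<integral>\<^sup>+ s. ?f (0 - s) * indicator {0..} (0 - s) \<partial>lborel)"
    by (rule nn_integral_add) auto
  also have "\<dots> = (\<integral>\<^sup>+ s. ?f s * indicator {0..} s \<partial>lborel) + (\<integral>\<^sup>+ s. ?f s * indicator {0..} s \<partial>lborel)"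
    by (subst nn_integral_lborel_reflect[of "\<lambda>s. ?f s * indicator {0..} s"]) auto
  also have "\<dots> < \<infinity>" using fin by simp
  finally show ?thesis .
qed

text \<open>The exponent is shared equally between the two coordinates, each of which is at most
  \<open>norm x\<close> in absolute value. Both factors then have exponent \<gamma> / 2 > 1, and the
  plane integral is dominated by a product of two convergent line integrals.\<close>

lemma nn_integral_weight_finite:
  fixes \<gamma> :: real
  assumes "\<gamma> > 2"
  shows "(\<integral>\<^sup>+ (x::R2). ennreal ((1 + norm x) powr - \<gamma>) \<partial>lborel) < \<infinity>"
proof -
  let ?f = "\<lambda>s::real. ennreal ((1 + \<bar>s\<bar>) powr - (\<gamma> / 2))"
  have "(\<integral>\<^sup>+ (x::R2). ennreal ((1 + norm x) powr - \<gamma>) \<partial>lborel) \<le> (\<integral>\<^sup>+ (x::R2). (\<Prod>b\<in>Basis. ?f (x \<bullet> b)) \<partial>lborel)"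
  proof (intro nn_integral_mono)
    fix x :: R2
    have "(1 + norm x) powr - \<gamma> = (\<Prod>b\<in>(Basis::R2 set). (1 + norm x) powr - (\<gamma> / 2))"
      by (simp add: powr_add[symmetric] power2_eq_square)
    also have "\<dots> \<le> (\<Prod>b\<in>Basis. (1 + \<bar>x \<bullet> b\<bar>) powr - (\<gamma> / 2))"
      using assms by (intro prod_mono) (auto intro!: powr_mono2' simp: Basis_le_norm)
    finally have "ennreal ((1 + norm x) powr - \<gamma>) \<le> ennreal (\<Prod>b\<in>Basis. (1 + \<bar>x \<bullet> b\<bar>) powr - (\<gamma> / 2))"
      by (rule ennreal_leI)
    then show "ennreal ((1 + norm x) powr - \<gamma>) \<le> (\<Prod>b\<in>Basis. ?f (x \<bullet> b))"
      by (simp add: prod_ennreal)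
  qed
  also have "\<dots> = (\<Prod>b\<in>(Basis::R2 set). (\<integral>\<^sup>+ s. ?f s \<partial>lborel))"
    by (rule nn_integral_lborel_prod) auto
  also have "\<dots> < \<infinity>"
    using nn_integral_weight_1d[of "\<gamma> / 2"] assms
    by (simp add: power2_eq_square ennreal_mult_less_top)
  finally show ?thesis .
qed

text \<open>Layer cake: \<open>norm x\<close> is the length of the interval from 0 to
  \<open>norm x\<close>. After exchanging the integrals, the slice at height s is the annulus
  between the radii s and R, of area pi (R^2 - s^2).\<close>

lemma nn_integral_norm_disc_le:
  fixes R :: real
  assumes R: "0 \<le> R"
  shows "(\<integral>\<^sup>+ (x::R2). ennreal (norm x) * indicator (cball 0 R) x \<partial>lborel) \<le> ennreal (2 * pi * R ^ 3 / 3)"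
proof -
  let ?g = "\<lambda>(x::R2, s::real). (if norm x \<le> R \<and> 0 \<le> s \<and> s \<le> norm x then 1 else 0 :: ennreal)"
  have "?g \<in> borel_measurable (borel \<Otimes>\<^sub>M borel)" by measurable
  then have [measurable]: "?g \<in> borel_measurable (lborel \<Otimes>\<^sub>M lborel)"
    by (simp add: lborel_prod borel_prod)
  have "(\<integral>\<^sup>+ (x::R2). ennreal (norm x) * indicator (cball 0 R) x \<partial>lborel)
     = (\<integral>\<^sup>+ x. \<integral>\<^sup>+ s. ?g (x, s) \<partial>lborel \<partial>lborel)"
  proof (intro nn_integral_cong)
    fix x :: R2
    have "(\<integral>\<^sup>+ s. ?g (x, s) \<partial>lborel) = (\<integral>\<^sup>+ s. indicator (cball 0 R) x * indicator {0..norm x} s \<partial>lborel)"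
      by (intro nn_integral_cong) (auto split: split_indicator)
    also have "\<dots> = indicator (cball 0 R) x * ennreal (norm x)"
      by (subst nn_integral_cmult) auto
    finally show "ennreal (norm x) * indicator (cball 0 R) x = (\<integral>\<^sup>+ s. ?g (x, s) \<partial>lborel)"
      by (simp add: mult.commute)
  qed
  also have "\<dots> = (\<integral>\<^sup>+ s. \<integral>\<^sup>+ x. ?g (x, s) \<partial>lborel \<partial>lborel)"
    by (subst lborel_pair.Fubini) (auto simp: lborel_prod)
  also have "\<dots> \<le> (\<integral>\<^sup>+ s. ennreal (pi * (R\<^sup>2 - s\<^sup>2)) * indicator {0..R} s \<partial>lborel)"
  proof (intro nn_integral_mono)
    fix s :: real
    show "(\<integral>\<^sup>+ x. ?g (x, s) \<partial>lborel) \<le> ennreal (pi * (R\<^sup>2 - s\<^sup>2)) * indicator {0..R} s"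
    proof (cases "0 \<le> s \<and> s \<le> R")
      case True
      have "(\<integral>\<^sup>+ x. ?g (x, s) \<partial>lborel) = (\<integral>\<^sup>+ x. indicator {w::R2. norm w \<le> R \<and> R\<^sup>2 - (R\<^sup>2 - s\<^sup>2) \<le> (norm w)\<^sup>2} x \<partial>lborel)"
        using True by (intro nn_integral_cong) (auto split: split_indicator simp: power2_le_iff_abs_le)
      also have "\<dots> = emeasure lborel {w::R2. norm w \<le> R \<and> R\<^sup>2 - (R\<^sup>2 - s\<^sup>2) \<le> (norm w)\<^sup>2}"
        by (rule nn_integral_indicator) simp
      also have "\<dots> \<le> ennreal (pi * min (R\<^sup>2 - s\<^sup>2) (R\<^sup>2))"
        using True R by (intro emeasure_annulus_le) (auto intro!: power_mono)
      moreover have "min (R\<^sup>2 - s\<^sup>2) (R\<^sup>2) = R\<^sup>2 - s\<^sup>2" "indicator {0..R} s = (1::ennreal)"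
        using True by auto
      ultimately show ?thesis by (simp only: mult_1_right)
    next
      case False
      then have "(\<integral>\<^sup>+ x. ?g (x, s) \<partial>lborel) = (\<integral>\<^sup>+ (x::R2). 0 \<partial>lborel)"
        by (intro nn_integral_cong) (auto split: split_indicator)
      then show ?thesis by simp
    qed
  qed
  also have "\<dots> = ennreal ((pi * (R\<^sup>2 * R - R ^ 3 / 3)) - (pi * (R\<^sup>2 * 0 - 0 ^ 3 / 3)))"
    using R by (intro nn_integral_FTC_Icc) (auto intro!: derivative_eq_intros power_mono simp: has_real_derivative_iff_has_vector_derivative[symmetric])
  also have "\<dots> = ennreal (2 * pi * R ^ 3 / 3)"
    by (simp add: power3_eq_cube power2_eq_square algebra_simps)
  finally show ?thesis .
qed

section \<open>Modulus of continuity of the kernel\<close>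

definition near_kernel :: "R4 \<Rightarrow> real" where
  "near_kernel = (\<lambda>(x, v). if norm v \<le> norm x then 1 / (4 * pi * (norm x)\<^sup>2) else 0)"

text \<open>The modulus of \<open>J\<close> on the strip inside the cone where the jump can be felt:
  if both components move by at most \<delta> and the cone is crossed, the point inside satisfies
  \<open>norm x \<le> norm v + 2 * \<delta>\<close>, with one \<delta> from each component.\<close>

definition layer_kernel :: "real \<Rightarrow> R4 \<Rightarrow> real" where
  "layer_kernel \<delta> = (\<lambda>(x, v). if norm v \<le> norm x \<and> norm x \<le> norm v + 2 * \<delta> then 1 / (2 * pi * norm x) else 0)"

lemma borel_measurable_near_kernel [measurable]: "near_kernel \<in> borel_measurable borel"
  unfolding near_kernel_def case_prod_beta by measurable

lemma borel_measurable_layer_kernel [measurable]: "layer_kernel \<delta> \<in> borel_measurable borel"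
  unfolding layer_kernel_def case_prod_beta by measurable

text \<open>The map x / |x|^2 is inversion in the unit sphere, and this is its classical distance
  formula. Up to the rotation \<open>perp\<close> and the factor 1 / (2 pi), it is the kernel inside
  the cone.\<close>

lemma norm_inversion_diff:
  fixes x y :: "'a::real_inner"
  assumes "x \<noteq> 0" "y \<noteq> 0"
  shows "norm ((1 / (norm x)\<^sup>2) *\<^sub>R x - (1 / (norm y)\<^sup>2) *\<^sub>R y) = norm (x - y) / (norm x * norm y)"
proof (rule power2_eq_imp_eq)
  let ?a = "x \<bullet> x" and ?b = "y \<bullet> y"
  have ab: "?a > 0" "?b > 0" using assms by auto
  have "(norm ((1 / (norm x)\<^sup>2) *\<^sub>R x - (1 / (norm y)\<^sup>2) *\<^sub>R y))\<^sup>2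
      = 1 / ?a - 2 * (x \<bullet> y) / (?a * ?b) + 1 / ?b"
    unfolding power2_norm_eq_inner using ab
    by (simp add: inner_diff_left inner_diff_right inner_commute field_simps)
  also have "\<dots> = (?b - 2 * (x \<bullet> y) + ?a) / (?a * ?b)"
    using ab by (simp add: field_simps)
  also have "\<dots> = (norm (x - y) / (norm x * norm y))\<^sup>2"
    by (simp add: power_divide power_mult_distrib power2_norm_eq_inner inner_diff_left inner_diff_right inner_commute algebra_simps)
  finally show "(norm ((1 / (norm x)\<^sup>2) *\<^sub>R x - (1 / (norm y)\<^sup>2) *\<^sub>R y))\<^sup>2
      = (norm (x - y) / (norm x * norm y))\<^sup>2" .
qed auto

text \<open>The first two terms come from the smooth part of the kernel, the last two from its jump
  across the cone \<open>norm x = norm v\<close>.\<close>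
lemma norm_J_diff_le:
  assumes x: "norm (x - x') \<le> \<delta>" and v: "norm (v - v') \<le> \<delta>"
  shows "norm (J x v - J x' v') \<le> \<delta> * (near_kernel (x, v) + near_kernel (x', v'))
    + (layer_kernel \<delta> (x, v) + layer_kernel \<delta> (x', v'))"
proof -
  have \<delta>: "0 \<le> \<delta>" using x norm_ge_zero order_trans by blast
  have nx: "\<bar>norm x - norm x'\<bar> \<le> \<delta>" "\<bar>norm v - norm v'\<bar> \<le> \<delta>"
    using x v norm_triangle_ineq3 order_trans by blast+
  have nn: "0 \<le> near_kernel q" "0 \<le> layer_kernel \<delta> q" for q
    by (auto simp: near_kernel_def layer_kernel_def case_prod_beta)
  have nd: "0 \<le> \<delta> * near_kernel q" for q using \<delta> nn by simp
  have zero: "J 0 w = 0" for w by (simp add: J_def)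
  have single: "norm (J y w) \<le> \<delta> * near_kernel (y, w) + layer_kernel \<delta> (y, w)" if "norm y \<le> \<delta>" for y w
  proof -
    have "norm y \<le> norm w + 2 * \<delta>" using that \<delta> norm_ge_zero[of w] by linarith
    then show ?thesis using \<delta> by (auto simp: norm_J layer_kernel_def near_kernel_def)
  qed
  consider (on) "norm v \<le> norm x" "norm v' \<le> norm x'" | (left) "norm v \<le> norm x" "norm v' > norm x'"
    | (right) "norm v > norm x" "norm v' \<le> norm x'" | (off) "norm v > norm x" "norm v' > norm x'"
    by linarith
  then show ?thesis
  proof cases
    case on
    show ?thesis
    proof (cases "x = 0 \<or> x' = 0")
      case True
      then show ?thesis
      proof
        assume "x = 0"
        then have "norm x' \<le> \<delta>" using x by (simp add: norm_minus_commute)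
        moreover have "norm (J x v - J x' v') = norm (J x' v')" using \<open>x = 0\<close> by (simp add: zero)
        ultimately show ?thesis unfolding distrib_left
          using single[of x' v'] nd[of "(x, v)"] nn(2)[of "(x, v)"] by linarith
      next
        assume "x' = 0"
        then have "norm x \<le> \<delta>" using x by simp
        moreover have "norm (J x v - J x' v') = norm (J x v)" using \<open>x' = 0\<close> by (simp add: zero)
        ultimately show ?thesis unfolding distrib_left
          using single[of x v] nd[of "(x', v')"] nn(2)[of "(x', v')"] by linarith
      qed
    next
      case False
      let ?a = "norm x" and ?b = "norm x'"
      have ab: "?a > 0" "?b > 0" using False by auto
      have "J x v - J x' v' = (1 / (2 * pi)) *\<^sub>R ((1 / ?a\<^sup>2) *\<^sub>R perp x - (1 / ?b\<^sup>2) *\<^sub>R perp x')"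
        using on by (simp add: J_def scaleR_diff_right)
      moreover have "perp x \<noteq> 0" "perp x' \<noteq> 0"
        using ab norm_perp[of x] norm_perp[of x'] by (force simp del: norm_perp)+
      ultimately have "norm (J x v - J x' v') = (1 / (2 * pi)) * (norm (perp x - perp x') / (?a * ?b))"
        using norm_inversion_diff[of "perp x" "perp x'"] by simp
      also have "norm (perp x - perp x') = norm (x - x')"
        unfolding linear_diff[OF linear_perp, symmetric] by simp
      also have "(1 / (2 * pi)) * (norm (x - x') / (?a * ?b)) \<le> (1 / (2 * pi)) * (\<delta> / (?a * ?b))"
        using x ab by (intro mult_left_mono divide_right_mono) auto
      also have "\<dots> = \<delta> / (2 * pi) * ((1 / ?a) * (1 / ?b))" by simp
      \<comment> \<open>The inequality of the means separates the two points, so that each term can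
        be integrated on its own. This is where the factor 4 pi in \<open>near_kernel\<close> comes
        from.\<close>
      also have "\<dots> \<le> \<delta> / (2 * pi) * (((1 / ?a)\<^sup>2 + (1 / ?b)\<^sup>2) / 2)"
        using \<delta> sum_squares_bound[of "1 / ?a" "1 / ?b"] by (intro mult_left_mono) auto
      also have "\<dots> = \<delta> * (near_kernel (x, v) + near_kernel (x', v'))"
        using on by (simp add: near_kernel_def field_simps)
      finally show ?thesis using nn[of "(x, v)"] nn[of "(x', v')"] by linarith
    qed
  next
    case left
    then have "norm x \<le> norm v + 2 * \<delta>" using nx by linarith
    with left have "norm (J x v - J x' v') = layer_kernel \<delta> (x, v)"
      by (simp add: layer_kernel_def J_def power2_eq_square)
    then show ?thesis unfolding distrib_left
      using nd[of "(x, v)"] nd[of "(x', v')"] nn(2)[of "(x', v')"] by linarith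
  next
    case right
    then have "norm x' \<le> norm v' + 2 * \<delta>" using nx by linarith
    with right have "norm (J x v - J x' v') = layer_kernel \<delta> (x', v')"
      by (simp add: layer_kernel_def J_def power2_eq_square)
    then show ?thesis unfolding distrib_left
      using nd[of "(x, v)"] nd[of "(x', v')"] nn(2)[of "(x, v)"] by linarith
  next
    case off
    then have "norm (J x v - J x' v') = 0" by (simp add: J_def)
    then show ?thesis unfolding distrib_left
      using nd[of "(x, v)"] nd[of "(x', v')"] nn(2)[of "(x, v)"] nn(2)[of "(x', v')"] by linarith
  qed
qed

lemma nn_integral_slice_le:
  fixes g :: "R2 \<Rightarrow> real" and r d c :: real
  assumes r: "0 \<le> r" and d: "0 \<le> d" and c: "0 \<le> c"
    and g: "\<And>v. g v \<le> (if norm v \<le> r \<and> r\<^sup>2 - d \<le> (norm v)\<^sup>2 then c else 0)"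
  shows "(\<integral>\<^sup>+ v. ennreal (g v) \<partial>lborel) \<le> ennreal (c * (pi * min d (r\<^sup>2)))"
proof -
  have "(\<integral>\<^sup>+ v. ennreal (g v) \<partial>lborel)
     \<le> (\<integral>\<^sup>+ v. ennreal c * indicator {w::R2. norm w \<le> r \<and> r\<^sup>2 - d \<le> (norm w)\<^sup>2} v \<partial>lborel)"
  proof (intro nn_integral_mono)
    fix v :: R2
    have "ennreal (g v) \<le> ennreal (if norm v \<le> r \<and> r\<^sup>2 - d \<le> (norm v)\<^sup>2 then c else 0)"
      by (intro ennreal_leI g)
    then show "ennreal (g v) \<le> ennreal c * indicator {w. norm w \<le> r \<and> r\<^sup>2 - d \<le> (norm w)\<^sup>2} v"
      by (auto split: split_indicator if_splits)
  qed
  also have "\<dots> = ennreal c * emeasure lborel {w::R2. norm w \<le> r \<and> r\<^sup>2 - d \<le> (norm w)\<^sup>2}"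
    by (subst nn_integral_cmult_indicator) auto
  also have "\<dots> \<le> ennreal c * ennreal (pi * min d (r\<^sup>2))"
    by (intro mult_left_mono emeasure_annulus_le r d) auto
  also have "\<dots> = ennreal (c * (pi * min d (r\<^sup>2)))"
    using c d by (subst ennreal_mult[symmetric]) auto
  finally show ?thesis .
qed

lemma nn_integral_near_kernel: "(\<integral>\<^sup>+ v. ennreal (near_kernel (x, v)) \<partial>lborel) \<le> ennreal (1 / 4)"
proof -
  have "(\<integral>\<^sup>+ v. ennreal (near_kernel (x, v)) \<partial>lborel)
      \<le> ennreal (1 / (4 * pi * (norm x)\<^sup>2) * (pi * min ((norm x)\<^sup>2) ((norm x)\<^sup>2)))"
    by (rule nn_integral_slice_le) (auto simp: near_kernel_def)
  also have "\<dots> \<le> ennreal (1 / 4)"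
    by (intro ennreal_leI) (auto simp: field_simps)
  finally show ?thesis .
qed

lemma nn_integral_layer_kernel:
  assumes "0 \<le> \<delta>"
  shows "(\<integral>\<^sup>+ v. ennreal (layer_kernel \<delta> (x, v)) \<partial>lborel) \<le> ennreal (2 * \<delta>)"
proof -
  let ?r = "norm x"
  have "(\<integral>\<^sup>+ v. ennreal (layer_kernel \<delta> (x, v)) \<partial>lborel)
      \<le> ennreal (1 / (2 * pi * ?r) * (pi * min (4 * \<delta> * ?r) (?r\<^sup>2)))"
  proof (rule nn_integral_slice_le)
    fix v :: R2
    \<comment> \<open>Expanding (r - 2 \<delta>)^2 gives a drop 4 \<delta> r of the squared radius.
      If r < 2 \<delta>, the lower bound r - 2 \<delta> for \<open>norm v\<close> is negative and
      cannot be squared, but then the left-hand side is at most 0.\<close>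
    have "?r\<^sup>2 - 4 * \<delta> * ?r \<le> (norm v)\<^sup>2" if "norm v \<le> ?r" "?r \<le> norm v + 2 * \<delta>"
    proof (cases "2 * \<delta> \<le> ?r")
      case True
      have "?r\<^sup>2 - 4 * \<delta> * ?r \<le> (?r - 2 * \<delta>)\<^sup>2" by (simp add: power2_eq_square algebra_simps)
      also have "\<dots> \<le> (norm v)\<^sup>2" using True that by (intro power_mono) auto
      finally show ?thesis .
    next
      case False
      then have "?r * ?r \<le> 4 * \<delta> * ?r" using assms by (intro mult_right_mono) auto
      then show ?thesis by (simp add: power2_eq_square) (smt (verit) zero_le_square)
    qed
    then show "layer_kernel \<delta> (x, v) \<le> (if norm v \<le> ?r \<and> ?r\<^sup>2 - 4 * \<delta> * ?r \<le> (norm v)\<^sup>2 then 1 / (2 * pi * ?r) else 0)"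
      by (auto simp: layer_kernel_def)
  qed (use assms in auto)
  also have "\<dots> \<le> ennreal (2 * \<delta>)"
  proof (intro ennreal_leI)
    have "1 / (2 * pi * ?r) * (pi * min (4 * \<delta> * ?r) (?r\<^sup>2)) \<le> 1 / (2 * pi * ?r) * (pi * (4 * \<delta> * ?r))"
      by (intro mult_left_mono) auto
    also have "\<dots> \<le> 2 * \<delta>" using assms by (auto simp: field_simps)
    finally show "1 / (2 * pi * ?r) * (pi * min (4 * \<delta> * ?r) (?r\<^sup>2)) \<le> 2 * \<delta>" .
  qed
  finally show ?thesis .
qed

text \<open>At fixed x the integral over v is pi |x|^2 / (2 pi |x|) = |x| / 2, so the singularity
  has disappeared before x is integrated. The value is the near-field term of the final speed
  constant.\<close>

lemma nn_integral_J_disc_le: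
  assumes R: "0 \<le> R"
  shows "(\<integral>\<^sup>+ z. ennreal (norm (J (fst z) (snd z))) * indicator (cball 0 R) (fst z) \<partial>lborel)
    \<le> ennreal (pi * R ^ 3 / 3)"
proof -
  have [measurable]: "(\<lambda>z::R4. indicator (cball 0 R) (fst z) :: ennreal) \<in> borel_measurable borel"
    by (rule measurable_compose[OF borel_measurable_fst], rule borel_measurable_indicator) simp
  have [measurable]: "cball (0::R2) R \<in> sets borel" by simp
  have "(\<integral>\<^sup>+ z. ennreal (norm (J (fst z) (snd z))) * indicator (cball 0 R) (fst z) \<partial>lborel)
    = (\<integral>\<^sup>+ z. ennreal (norm (J (fst z) (snd z))) * indicator (cball 0 R) (fst z) \<partial>(lborel \<Otimes>\<^sub>M lborel))"
    by (simp only: lborel_prod)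
  also have "\<dots> = (\<integral>\<^sup>+ x. \<integral>\<^sup>+ v. ennreal (norm (J x v)) * indicator (cball 0 R) x \<partial>lborel \<partial>lborel)"
    by (subst lborel.nn_integral_fst[symmetric]) (auto simp: lborel_prod)
  also have "\<dots> = (\<integral>\<^sup>+ x. (\<integral>\<^sup>+ v. ennreal (norm (J x v)) \<partial>lborel) * indicator (cball 0 R) x \<partial>lborel)"
    by (intro nn_integral_cong nn_integral_multc) auto
  also have "\<dots> \<le> (\<integral>\<^sup>+ (x::R2). ennreal (1/2) * (ennreal (norm x) * indicator (cball 0 R) x) \<partial>lborel)"
  proof (intro nn_integral_mono)
    fix x :: R2
    have "(\<integral>\<^sup>+ v. ennreal (norm (J x v)) \<partial>lborel)
      \<le> ennreal (1 / (2 * pi * norm x) * (pi * min ((norm x)\<^sup>2) ((norm x)\<^sup>2)))"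
      by (rule nn_integral_slice_le) (auto simp: norm_J)
    also have "\<dots> = ennreal (1/2) * ennreal (norm x)"
      by (subst ennreal_mult[symmetric]) (auto simp: power2_eq_square)
    finally show "(\<integral>\<^sup>+ v. ennreal (norm (J x v)) \<partial>lborel) * indicator (cball 0 R) x
      \<le> ennreal (1/2) * (ennreal (norm x) * indicator (cball 0 R) x)"
      by (auto split: split_indicator)
  qed
  also have "\<dots> = ennreal (1/2) * (\<integral>\<^sup>+ (x::R2). ennreal (norm x) * indicator (cball 0 R) x \<partial>lborel)"
    by (rule nn_integral_cmult) measurable
  also have "\<dots> \<le> ennreal (1/2) * ennreal (2 * pi * R ^ 3 / 3)"
    by (intro mult_left_mono nn_integral_norm_disc_le R) auto
  also have "\<dots> = ennreal (pi * R ^ 3 / 3)"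
    using R by (subst ennreal_mult[symmetric]) auto
  finally show ?thesis .
qed

section \<open>A regularised kernel\<close>

definition relu_sq :: "real \<Rightarrow> real" where
  "relu_sq s = (max 0 s)\<^sup>2"

text \<open>In each of the four sign cases the remainder of the first-order expansion is at most (y
  - s)^2, which treats the point 0 together with all others.\<close>

lemma has_real_derivative_relu_sq: "(relu_sq has_real_derivative 2 * max 0 s) (at s)"
  unfolding has_field_derivative_def
proof (rule has_derivativeI_sandwich[where e = 1])
  show "bounded_linear (\<lambda>x. 2 * max 0 s * x)" by (rule bounded_linear_mult_right)
  show "((\<lambda>y. \<bar>y - s\<bar>) \<longlongrightarrow> 0) (at s)"
    by (auto intro!: tendsto_eq_intros)
  fix y :: real
  assume "y \<noteq> s"
  have "\<bar>relu_sq y - relu_sq s - 2 * max 0 s * (y - s)\<bar> \<le> (y - s)\<^sup>2"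
  proof (cases "0 \<le> y"; cases "0 \<le> s")
    assume "0 \<le> y" "0 \<le> s"
    then have "relu_sq y - relu_sq s - 2 * max 0 s * (y - s) = (y - s)\<^sup>2"
      by (simp add: relu_sq_def power2_eq_square algebra_simps)
    then show ?thesis by simp
  next
    assume "0 \<le> y" "\<not> 0 \<le> s"
    then have "y\<^sup>2 \<le> (y - s)\<^sup>2" by (intro power_mono) auto
    with \<open>0 \<le> y\<close> \<open>\<not> 0 \<le> s\<close> show ?thesis by (simp add: relu_sq_def)
  next
    assume "\<not> 0 \<le> y" "0 \<le> s"
    then have "s * y \<le> 0" by (simp add: mult_nonneg_nonpos)
    moreover have "relu_sq y - relu_sq s - 2 * max 0 s * (y - s) = s\<^sup>2 - 2 * (s * y)"
      using \<open>\<not> 0 \<le> y\<close> \<open>0 \<le> s\<close> by (simp add: relu_sq_def power2_eq_square algebra_simps)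
    moreover have "(y - s)\<^sup>2 = s\<^sup>2 - 2 * (s * y) + y\<^sup>2" by (simp add: power2_eq_square algebra_simps)
    ultimately show ?thesis using zero_le_power2[of s] zero_le_power2[of y] by linarith
  next
    assume "\<not> 0 \<le> y" "\<not> 0 \<le> s"
    then show ?thesis by (simp add: relu_sq_def)
  qed
  then have "\<bar>relu_sq y - relu_sq s - 2 * max 0 s * (y - s)\<bar> \<le> \<bar>y - s\<bar> * \<bar>y - s\<bar>"
    by (simp add: power2_eq_square)
  then show "norm (relu_sq y - relu_sq s - 2 * max 0 s * (y - s)) / norm (y - s) \<le> \<bar>y - s\<bar>"
    using \<open>y \<noteq> s\<close> by (simp only: real_norm_def) (simp add: pos_divide_le_eq)
qed auto

lemma relu_sq_bounds: "0 \<le> relu_sq s" "s \<le> 0 \<Longrightarrow> relu_sq s = 0" "1 \<le> s \<Longrightarrow> 1 \<le> relu_sq s"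
  "s \<le> 1 \<Longrightarrow> relu_sq s \<le> 1"
  by (auto simp: relu_sq_def max_def power_le_one)

text \<open>A continuously differentiable ramp from 0 on s \<le> 0 to 1 on s \<ge> \<epsilon>. It
  rises only to the right of 0, so the regularised kernel keeps its support in the cone and stays
  below \<open>J\<close> in norm.\<close>

definition cutoff :: "real \<Rightarrow> real \<Rightarrow> real" where
  "cutoff \<epsilon> s = 1 - relu_sq (1 - relu_sq (s / \<epsilon>))"

definition cutoff' :: "real \<Rightarrow> real \<Rightarrow> real" where
  "cutoff' \<epsilon> s = 4 * max 0 (1 - relu_sq (s / \<epsilon>)) * max 0 (s / \<epsilon>) / \<epsilon>"

lemma has_real_derivative_cutoff:
  assumes "\<epsilon> > 0"
  shows "(cutoff \<epsilon> has_real_derivative cutoff' \<epsilon> s) (at s)"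
  unfolding cutoff_def[abs_def] cutoff'_def using assms
  by (auto intro!: derivative_eq_intros DERIV_chain2[OF has_real_derivative_relu_sq])

lemma cutoff_bounds:
  assumes "\<epsilon> > 0"
  shows "0 \<le> cutoff \<epsilon> s" "cutoff \<epsilon> s \<le> 1" "s \<le> 0 \<Longrightarrow> cutoff \<epsilon> s = 0" "\<epsilon> \<le> s \<Longrightarrow> cutoff \<epsilon> s = 1"
proof -
  show "0 \<le> cutoff \<epsilon> s" using relu_sq_bounds(4)[of "1 - relu_sq (s / \<epsilon>)"] relu_sq_bounds(1)[of "s / \<epsilon>"]
    by (simp add: cutoff_def)
  show "cutoff \<epsilon> s \<le> 1" by (simp add: cutoff_def relu_sq_bounds)
  show "cutoff \<epsilon> s = 0" if "s \<le> 0"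
  proof -
    have "s / \<epsilon> \<le> 0" using that assms by (simp add: divide_nonpos_pos)
    then have "relu_sq (s / \<epsilon>) = 0" by (rule relu_sq_bounds)
    then show ?thesis by (simp add: cutoff_def relu_sq_def)
  qed
  show "cutoff \<epsilon> s = 1" if "\<epsilon> \<le> s"
  proof -
    have "1 \<le> s / \<epsilon>" using that assms by simp
    then have "1 - relu_sq (s / \<epsilon>) \<le> 0" using relu_sq_bounds(3) by simp
    then show ?thesis by (simp add: cutoff_def relu_sq_bounds)
  qed
qed

lemma cutoff'_bounds:
  assumes "\<epsilon> > 0"
  shows "0 \<le> cutoff' \<epsilon> s" "cutoff' \<epsilon> s \<le> 4 / \<epsilon>"
proof -
  show "0 \<le> cutoff' \<epsilon> s" using assms by (simp add: cutoff'_def)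
  have "max 0 (1 - relu_sq (s / \<epsilon>)) * max 0 (s / \<epsilon>) \<le> 1"
  proof (cases "1 \<le> s / \<epsilon>")
    case True
    then have "1 - relu_sq (s / \<epsilon>) \<le> 0" using relu_sq_bounds(3) by simp
    then show ?thesis by simp
  next
    case False
    then show ?thesis using relu_sq_bounds(1)[of "s / \<epsilon>"] by (intro mult_le_one) auto
  qed
  then show "cutoff' \<epsilon> s \<le> 4 / \<epsilon>" using assms by (simp add: cutoff'_def field_simps)
qed

text \<open>The cutoff acts on \<open>\<bar>x\<bar>\<^sup>2 - \<bar>v\<bar>\<^sup>2\<close>, so the regularised kernel is still a multiple of
  \<open>perp x\<close> by a function of \<open>\<bar>x\<bar>\<close> and therefore still divergence free in \<open>x\<close>.\<close>
definition smooth_J :: "real \<Rightarrow> R2 \<Rightarrow> R2 \<Rightarrow> R2" where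
  "smooth_J \<epsilon> x v = (cutoff \<epsilon> (x \<bullet> x - v \<bullet> v) / (2 * pi * (x \<bullet> x + \<epsilon>))) *\<^sub>R perp x"

text \<open>The differential in x, in direction \<xi>, of G(|x|^2) \<open>perp x\<close> with G(q) =
  \<open>cutoff \<epsilon> (q - v \<bullet> v)\<close> / (2 pi (q + \<epsilon>)). The bracket in the
  second summand is G'(|x|^2).\<close>

definition smooth_J' :: "real \<Rightarrow> R2 \<Rightarrow> R2 \<Rightarrow> R2 \<Rightarrow> R2" where
  "smooth_J' \<epsilon> x v \<xi> =
     (cutoff \<epsilon> (x \<bullet> x - v \<bullet> v) / (2 * pi * (x \<bullet> x + \<epsilon>))) *\<^sub>R perp \<xi> +
     (2 * (x \<bullet> \<xi>) * (cutoff' \<epsilon> (x \<bullet> x - v \<bullet> v) / (2 * pi * (x \<bullet> x + \<epsilon>))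
        - cutoff \<epsilon> (x \<bullet> x - v \<bullet> v) / (2 * pi * (x \<bullet> x + \<epsilon>)\<^sup>2))) *\<^sub>R perp x"

lemma has_derivative_smooth_J:
  assumes "\<epsilon> > 0"
  shows "((\<lambda>x. smooth_J \<epsilon> x v) has_derivative smooth_J' \<epsilon> x v) (at x)"
proof -
  have pos: "x \<bullet> x + \<epsilon> > 0" using assms by (simp add: add_nonneg_pos)
  define G where "G q = cutoff \<epsilon> (q - v \<bullet> v) / (2 * pi * (q + \<epsilon>))" for q
  define G' where "G' q = cutoff' \<epsilon> (q - v \<bullet> v) / (2 * pi * (q + \<epsilon>))
        - cutoff \<epsilon> (q - v \<bullet> v) / (2 * pi * (q + \<epsilon>)\<^sup>2)" for q
  have "(G has_real_derivative G' (x \<bullet> x)) (at (x \<bullet> x))"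
  proof -
    have c: "((\<lambda>q. cutoff \<epsilon> (q - v \<bullet> v)) has_real_derivative cutoff' \<epsilon> (x \<bullet> x - v \<bullet> v) * (1 - 0)) (at (x \<bullet> x))"
      by (rule DERIV_chain2[OF has_real_derivative_cutoff[OF assms]]) (intro derivative_intros)
    have d: "((\<lambda>q. 2 * pi * (q + \<epsilon>)) has_real_derivative 2 * pi) (at (x \<bullet> x))"
      by (auto intro!: derivative_eq_intros)
    have nz: "2 * pi * (x \<bullet> x + \<epsilon>) \<noteq> 0" using pos by simp
    have e: "G' (x \<bullet> x) = (cutoff' \<epsilon> (x \<bullet> x - v \<bullet> v) * (1 - 0) * (2 * pi * (x \<bullet> x + \<epsilon>))
      - cutoff \<epsilon> (x \<bullet> x - v \<bullet> v) * (2 * pi)) / (2 * pi * (x \<bullet> x + \<epsilon>) * (2 * pi * (x \<bullet> x + \<epsilon>)))"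
    proof -
      have gen: "a / (2 * pi * D) - b / (2 * pi * D\<^sup>2)
        = (a * (1 - 0) * (2 * pi * D) - b * (2 * pi)) / (2 * pi * D * (2 * pi * D))"
        if "D \<noteq> 0" for a b D :: real
      proof -
        have "a * (1 - 0) * (2 * pi * D) / (2 * pi * D * (2 * pi * D)) = a / (2 * pi * D)" using that by simp
        moreover have "b * (2 * pi) / (2 * pi * D * (2 * pi * D)) = b / (2 * pi * D\<^sup>2)"
          using that by (simp add: power2_eq_square)
        ultimately show ?thesis by (simp only: diff_divide_distrib)
      qed
      show ?thesis unfolding G'_def by (rule gen) (use pos in simp)
    qed
    show ?thesis unfolding e G_def[abs_def] by (rule DERIV_divide[OF c d nz])
  qed
  then have "((\<lambda>x. G (x \<bullet> x)) has_derivative (\<lambda>\<xi>. (x \<bullet> \<xi> + \<xi> \<bullet> x) * G' (x \<bullet> x))) (at x)"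
    by (rule DERIV_compose_FDERIV) (auto intro!: derivative_eq_intros)
  from has_derivative_scaleR[OF this bounded_linear.has_derivative[OF bounded_linear_perp has_derivative_ident]]
  have "((\<lambda>x. G (x \<bullet> x) *\<^sub>R perp x) has_derivative
    (\<lambda>\<xi>. G (x \<bullet> x) *\<^sub>R perp \<xi> + ((x \<bullet> \<xi> + \<xi> \<bullet> x) * G' (x \<bullet> x)) *\<^sub>R perp x)) (at x)" .
  moreover have "(\<lambda>x. G (x \<bullet> x) *\<^sub>R perp x) = (\<lambda>x. smooth_J \<epsilon> x v)"
    by (simp add: smooth_J_def G_def)
  moreover have "(\<lambda>\<xi>. G (x \<bullet> x) *\<^sub>R perp \<xi> + ((x \<bullet> \<xi> + \<xi> \<bullet> x) * G' (x \<bullet> x)) *\<^sub>R perp x) = smooth_J' \<epsilon> x v"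
    unfolding smooth_J'_def G_def G'_def by (rule ext) (simp add: inner_commute)
  ultimately show ?thesis by simp
qed

text \<open>The growing factor |x|^2, produced by \<open>x \<bullet> \<xi>\<close> and
  \<open>perp x\<close> together, always meets a denominator |x|^2 + \<epsilon>; this makes the
  bound uniform in x and v. The constants add up to 11 / (2 pi), which is below 2 because pi >
  3.\<close>

lemma norm_smooth_J'_le:
  assumes "\<epsilon> > 0"
  shows "norm (smooth_J' \<epsilon> x v \<xi>) \<le> 2 / \<epsilon> * norm \<xi>"
proof -
  define q where "q = x \<bullet> x"
  define c where "c = cutoff \<epsilon> (q - v \<bullet> v)"
  define d where "d = cutoff' \<epsilon> (q - v \<bullet> v)"
  have q: "0 \<le> q" "q + \<epsilon> > 0" using assms by (auto simp: q_def add_nonneg_pos)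
  have c: "0 \<le> c" "c \<le> 1" and d: "0 \<le> d" "d \<le> 4 / \<epsilon>"
    using cutoff_bounds cutoff'_bounds assms by (auto simp: c_def d_def)
  have g: "c / (2 * pi * (q + \<epsilon>)) \<le> 1 / (2 * pi * \<epsilon>)"
    using c q assms by (intro frac_le) auto
  have "\<bar>d / (2 * pi * (q + \<epsilon>)) - c / (2 * pi * (q + \<epsilon>)\<^sup>2)\<bar> \<le> d / (2 * pi * (q + \<epsilon>)) + c / (2 * pi * (q + \<epsilon>)\<^sup>2)"
    using c d q by (intro abs_leI) auto
  then have "q * \<bar>d / (2 * pi * (q + \<epsilon>)) - c / (2 * pi * (q + \<epsilon>)\<^sup>2)\<bar>
      \<le> q * (d / (2 * pi * (q + \<epsilon>)) + c / (2 * pi * (q + \<epsilon>)\<^sup>2))"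
    using q by (intro mult_left_mono)
  also have "\<dots> = q / (q + \<epsilon>) * (d / (2 * pi)) + q / (q + \<epsilon>) * (c / (2 * pi * (q + \<epsilon>)))"
    using q by (simp add: field_simps power2_eq_square)
  also have "\<dots> \<le> 1 * ((4 / \<epsilon>) / (2 * pi)) + 1 * (1 / (2 * pi * \<epsilon>))"
    using q c d assms g by (intro add_mono mult_mono divide_right_mono) auto
  finally have h: "q * \<bar>d / (2 * pi * (q + \<epsilon>)) - c / (2 * pi * (q + \<epsilon>)\<^sup>2)\<bar> \<le> 5 / (2 * pi * \<epsilon>)"
    by (simp add: field_simps)
  have "norm (smooth_J' \<epsilon> x v \<xi>) \<le> c / (2 * pi * (q + \<epsilon>)) * norm \<xi>
      + 2 * \<bar>x \<bullet> \<xi>\<bar> * \<bar>d / (2 * pi * (q + \<epsilon>)) - c / (2 * pi * (q + \<epsilon>)\<^sup>2)\<bar> * norm x"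
    unfolding smooth_J'_def q_def[symmetric] c_def[symmetric] d_def[symmetric]
    using c q by (intro order_trans[OF norm_triangle_ineq] add_mono) (auto simp: abs_mult)
  also have "\<dots> \<le> 1 / (2 * pi * \<epsilon>) * norm \<xi>
      + 2 * (norm x * norm \<xi>) * \<bar>d / (2 * pi * (q + \<epsilon>)) - c / (2 * pi * (q + \<epsilon>)\<^sup>2)\<bar> * norm x"
    using g by (intro add_mono mult_right_mono mult_left_mono Cauchy_Schwarz_ineq2) auto
  also have "\<dots> = 1 / (2 * pi * \<epsilon>) * norm \<xi>
      + 2 * (q * \<bar>d / (2 * pi * (q + \<epsilon>)) - c / (2 * pi * (q + \<epsilon>)\<^sup>2)\<bar>) * norm \<xi>"
    by (simp add: q_def power2_norm_eq_inner[symmetric] power2_eq_square)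
  also have "\<dots> \<le> 1 / (2 * pi * \<epsilon>) * norm \<xi> + 2 * (5 / (2 * pi * \<epsilon>)) * norm \<xi>"
    by (intro add_mono mult_right_mono mult_left_mono h) auto
  also have "\<dots> = 11 / (2 * pi * \<epsilon>) * norm \<xi>" by (simp add: field_simps)
  also have "\<dots> \<le> 2 / \<epsilon> * norm \<xi>"
  proof (intro mult_right_mono)
    have "11 / (2 * pi * \<epsilon>) = (11 / (2 * pi)) / \<epsilon>" by simp
    also have "\<dots> \<le> 2 / \<epsilon>"
      using pi_gt3 assms by (intro divide_right_mono) (auto simp: field_simps)
    finally show "11 / (2 * pi * \<epsilon>) \<le> 2 / \<epsilon>" .
  qed auto
  finally show ?thesis .
qed

text \<open>\<open>perp\<close> has zero diagonal, and the rank-one part sends \<xi> to a multiple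
  of (x \<bullet> \<xi>) \<open>perp x\<close>, whose trace is proportional to
  \<open>x \<bullet> perp x = 0\<close>. This is the divergence-free property on which the Jacobian
  estimate rests.\<close>

lemma trace_smooth_J': "smooth_J' \<epsilon> x v (axis 1 1) $ 1 + smooth_J' \<epsilon> x v (axis 2 1) $ 2 = 0"
proof -
  have "axis (1::2) (1::real) $ 2 = 0" "axis (2::2) (1::real) $ 1 = 0" by (simp_all add: axis_def)
  then show ?thesis by (simp add: smooth_J'_def inner_axis)
qed

section \<open>Size and error of the regularised kernel\<close>

lemma borel_measurable_relu_sq [measurable]: "relu_sq \<in> borel_measurable borel"
  unfolding relu_sq_def[abs_def] by measurable

lemma borel_measurable_smooth_J [measurable (raw)]:
  assumes [measurable]: "f \<in> borel_measurable M" "g \<in> borel_measurable M"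
  shows "(\<lambda>z. smooth_J \<epsilon> (f z) (g z)) \<in> borel_measurable M"
  unfolding smooth_J_def cutoff_def by measurable

lemma borel_measurable_smooth_J' [measurable (raw)]:
  assumes [measurable]: "f \<in> borel_measurable M" "g \<in> borel_measurable M"
  shows "(\<lambda>z. smooth_J' \<epsilon> (f z) (g z) \<xi>) \<in> borel_measurable M"
  unfolding smooth_J'_def cutoff_def cutoff'_def by measurable

text \<open>By the first bound every integral estimate for the norm of \<open>J\<close> passes to
  the regularised kernel with the same constants, for all \<epsilon>. The second comes from 2 |x|
  sqrt \<epsilon> \<le> |x|^2 + \<epsilon> and provides integrability against any finite
  measure.\<close>

lemma norm_smooth_J_le:
  assumes "\<epsilon> > 0"
  shows "norm (smooth_J \<epsilon> x v) \<le> norm (J x v)"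
    and "norm (smooth_J \<epsilon> x v) \<le> 1 / sqrt \<epsilon>"
proof -
  have q: "x \<bullet> x + \<epsilon> > 0" using assms by (simp add: add_nonneg_pos)
  let ?c = "cutoff \<epsilon> (x \<bullet> x - v \<bullet> v)"
  have n: "norm (smooth_J \<epsilon> x v) = ?c * (norm x / (2 * pi * (x \<bullet> x + \<epsilon>)))"
    using q cutoff_bounds(1)[OF assms] by (simp add: smooth_J_def)
  also have "\<dots> \<le> 1 * (norm x / (2 * pi * (x \<bullet> x + \<epsilon>)))"
    using q cutoff_bounds(2)[OF assms] by (intro mult_right_mono) auto
  finally have le: "norm (smooth_J \<epsilon> x v) \<le> norm x / (2 * pi * (x \<bullet> x + \<epsilon>))" by simp
  show "norm (smooth_J \<epsilon> x v) \<le> norm (J x v)"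
  proof (cases "norm v \<le> norm x \<and> x \<noteq> 0")
    case True
    then have "norm x / (2 * pi * (x \<bullet> x + \<epsilon>)) \<le> norm x / (2 * pi * (x \<bullet> x))"
      using assms by (intro divide_left_mono) (auto intro!: mult_pos_pos add_pos_pos)
    also have "\<dots> = norm (J x v)"
      using True by (simp add: norm_J power2_norm_eq_inner[symmetric] power2_eq_square)
    finally show ?thesis using le by simp
  next
    case False
    then have "x \<bullet> x - v \<bullet> v \<le> 0"
      by (auto simp: power2_norm_eq_inner[symmetric] intro!: power_mono)
    then show ?thesis using n cutoff_bounds(3)[OF assms] by simp
  qed
  have "0 \<le> sqrt \<epsilon> * norm x" using assms by simp
  then have "sqrt \<epsilon> * norm x \<le> 2 * norm x * sqrt \<epsilon>" by simp
  also have "\<dots> \<le> x \<bullet> x + \<epsilon>"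
    using sum_squares_bound[of "norm x" "sqrt \<epsilon>"] assms by (simp add: power2_norm_eq_inner[symmetric])
  also have "\<dots> \<le> 2 * pi * (x \<bullet> x + \<epsilon>)"
    using q pi_gt3 by (intro mult_le_cancel_right1[THEN iffD2]) auto
  finally have s: "sqrt \<epsilon> * norm x \<le> 2 * pi * (x \<bullet> x + \<epsilon>)" .
  have "norm x / (2 * pi * (x \<bullet> x + \<epsilon>)) \<le> 1 / sqrt \<epsilon>"
  proof -
    have "a / D \<le> 1 / b" if "b * a \<le> D" "D > 0" "b > 0" for a b D :: real
      using that by (simp add: field_simps)
    moreover have "2 * pi * (x \<bullet> x + \<epsilon>) > 0" "sqrt \<epsilon> > 0" using q assms by (auto intro: mult_pos_pos)
    ultimately show ?thesis using s by blast
  qed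
  with le show "norm (smooth_J \<epsilon> x v) \<le> 1 / sqrt \<epsilon>" by simp
qed

text \<open>Two errors are added: the first term covers the annulus on which the cutoff may not yet
  be 1, the second the relative error \<epsilon> / (|x|^2 + \<epsilon>) caused by the shifted
  denominator.\<close>

definition mollify_kernel :: "real \<Rightarrow> R4 \<Rightarrow> real" where
  "mollify_kernel \<epsilon> = (\<lambda>(x, v).
     (if norm v \<le> norm x \<and> (norm x)\<^sup>2 - \<epsilon> \<le> (norm v)\<^sup>2 then 1 / (2 * pi * norm x) else 0) +
     (if norm v \<le> norm x then \<epsilon> / ((norm x)\<^sup>2 + \<epsilon>) / (2 * pi * norm x) else 0))"

lemma borel_measurable_mollify_kernel [measurable]: "mollify_kernel \<epsilon> \<in> borel_measurable borel"
  unfolding mollify_kernel_def case_prod_beta by measurable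

lemma norm_smooth_J_diff_le:
  assumes "\<epsilon> > 0"
  shows "norm (smooth_J \<epsilon> x v - J x v) \<le> mollify_kernel \<epsilon> (x, v)"
proof (cases "norm v \<le> norm x \<and> x \<noteq> 0")
  case True
  define q where "q = x \<bullet> x"
  define c where "c = cutoff \<epsilon> (q - v \<bullet> v)"
  have q: "0 < q" "q = norm x * norm x" using True by (auto simp: q_def norm_eq_sqrt_inner)
  have qe: "q + \<epsilon> > 0" using q assms by simp
  have c: "0 \<le> c" "c \<le> 1" using cutoff_bounds assms by (auto simp: c_def)
  have "smooth_J \<epsilon> x v - J x v = - ((1 - c * (q / (q + \<epsilon>))) / (2 * pi * q)) *\<^sub>R perp x"
    using True q(1) qe by (simp add: smooth_J_def J_def q_def[symmetric] c_def[symmetric] power2_norm_eq_inner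
       scaleR_diff_left[symmetric] diff_divide_distrib)
  then have "norm (smooth_J \<epsilon> x v - J x v) = \<bar>1 - c * (q / (q + \<epsilon>))\<bar> / (2 * pi * q) * norm x"
    using q by (simp add: abs_div)
  also have "1 - c * (q / (q + \<epsilon>)) = (1 - c) * (q / (q + \<epsilon>)) + \<epsilon> / (q + \<epsilon>)"
  proof -
    have "q / (q + \<epsilon>) + \<epsilon> / (q + \<epsilon>) = 1" using qe by (simp flip: add_divide_distrib)
    moreover have "(1 - c) * (q / (q + \<epsilon>)) = q / (q + \<epsilon>) - c * (q / (q + \<epsilon>))"
      by (simp only: left_diff_distrib mult_1_left)
    ultimately show ?thesis by linarith
  qed
  also have "\<bar>(1 - c) * (q / (q + \<epsilon>)) + \<epsilon> / (q + \<epsilon>)\<bar> = (1 - c) * (q / (q + \<epsilon>)) + \<epsilon> / (q + \<epsilon>)"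
    using c q qe assms by (intro abs_of_nonneg add_nonneg_nonneg mult_nonneg_nonneg) auto
  also have "((1 - c) * (q / (q + \<epsilon>)) + \<epsilon> / (q + \<epsilon>)) / (2 * pi * q) * norm x
     \<le> ((if q - \<epsilon> \<le> (norm v)\<^sup>2 then 1 else 0) + \<epsilon> / (q + \<epsilon>)) / (2 * pi * q) * norm x"
  proof (intro mult_right_mono divide_right_mono add_mono)
    show "(1 - c) * (q / (q + \<epsilon>)) \<le> (if q - \<epsilon> \<le> (norm v)\<^sup>2 then 1 else 0)"
    proof (cases "q - \<epsilon> \<le> (norm v)\<^sup>2")
      case True
      have "(1 - c) * (q / (q + \<epsilon>)) \<le> 1 * 1" using c q qe assms by (intro mult_mono) auto
      with True show ?thesis by simp
    next
      case False
      then have "c = 1" using cutoff_bounds(4)[OF assms] by (simp add: c_def q_def power2_norm_eq_inner)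
      with False show ?thesis by simp
    qed
  qed (use q qe assms in auto)
  also have "\<dots> = ((if q - \<epsilon> \<le> (norm v)\<^sup>2 then 1 else 0) + \<epsilon> / (q + \<epsilon>)) / (2 * pi * norm x)"
  proof -
    have "X / (2 * pi * q) * norm x = X / (2 * pi * norm x)" for X
      using True by (simp add: q(2))
    then show ?thesis .
  qed
  also have "\<dots> = mollify_kernel \<epsilon> (x, v)"
    using True by (simp add: mollify_kernel_def power2_eq_square add_divide_distrib q(2))
  finally show ?thesis .
next
  case False
  then have "x \<bullet> x - v \<bullet> v \<le> 0"
    by (auto simp: power2_norm_eq_inner[symmetric] intro!: power_mono)
  then have "smooth_J \<epsilon> x v = 0" using cutoff_bounds(3)[OF assms] by (simp add: smooth_J_def)
  moreover have "J x v = 0" using False by (auto simp: J_def perp_def)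
  moreover have "0 \<le> mollify_kernel \<epsilon> (x, v)" using assms by (auto simp: mollify_kernel_def)
  ultimately show ?thesis by simp
qed

text \<open>Each of the two terms gives at most sqrt \<epsilon> / 2: the annulus because
  \<open>min \<epsilon> (r\<^sup>2)\<close> is at most the geometric mean sqrt \<epsilon> r, the
  denominator by 2 r sqrt \<epsilon> \<le> r^2 + \<epsilon>. Both are worst at r = sqrt \<epsilon>,
  which explains the rate.\<close>

lemma nn_integral_mollify_kernel:
  assumes "\<epsilon> > 0"
  shows "(\<integral>\<^sup>+ v. ennreal (mollify_kernel \<epsilon> (x, v)) \<partial>lborel) \<le> ennreal (sqrt \<epsilon>)"
proof -
  let ?r = "norm x"
  let ?a = "\<lambda>v::R2. if norm v \<le> ?r \<and> ?r\<^sup>2 - \<epsilon> \<le> (norm v)\<^sup>2 then 1 / (2 * pi * ?r) else 0"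
  let ?b = "\<lambda>v::R2. if norm v \<le> ?r then \<epsilon> / (?r\<^sup>2 + \<epsilon>) / (2 * pi * ?r) else 0"
  have amgm: "2 * ?r * sqrt \<epsilon> \<le> ?r\<^sup>2 + \<epsilon>" using sum_squares_bound[of ?r "sqrt \<epsilon>"] assms by simp
  have "(\<integral>\<^sup>+ v. ennreal (mollify_kernel \<epsilon> (x, v)) \<partial>lborel) = (\<integral>\<^sup>+ v. ennreal (?a v) + ennreal (?b v) \<partial>lborel)"
    using assms by (intro nn_integral_cong) (simp add: mollify_kernel_def)
  also have "\<dots> = (\<integral>\<^sup>+ v. ennreal (?a v) \<partial>lborel) + (\<integral>\<^sup>+ v. ennreal (?b v) \<partial>lborel)"
    by (rule nn_integral_add) measurable
  also have "\<dots> \<le> ennreal (1 / (2 * pi * ?r) * (pi * min \<epsilon> (?r\<^sup>2)))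
      + ennreal (\<epsilon> / (?r\<^sup>2 + \<epsilon>) / (2 * pi * ?r) * (pi * min (?r\<^sup>2) (?r\<^sup>2)))"
    using assms by (intro add_mono nn_integral_slice_le) auto
  also have "\<dots> \<le> ennreal (sqrt \<epsilon> / 2) + ennreal (sqrt \<epsilon> / 2)"
  proof (intro add_mono ennreal_leI)
    have "min \<epsilon> (?r\<^sup>2) \<le> sqrt \<epsilon> * ?r"
    proof (cases "sqrt \<epsilon> \<le> ?r")
      case True
      then have "sqrt \<epsilon> * sqrt \<epsilon> \<le> sqrt \<epsilon> * ?r" using assms by (intro mult_left_mono) auto
      then show ?thesis using assms by simp
    next
      case False
      then have "?r * ?r \<le> sqrt \<epsilon> * ?r" by (intro mult_right_mono) auto
      then show ?thesis by (simp add: power2_eq_square)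
    qed
    then have "1 / (2 * pi * ?r) * (pi * min \<epsilon> (?r\<^sup>2)) \<le> 1 / (2 * pi * ?r) * (pi * (sqrt \<epsilon> * ?r))"
      by (intro mult_left_mono) auto
    also have "\<dots> \<le> sqrt \<epsilon> / 2" using assms by auto
    finally show "1 / (2 * pi * ?r) * (pi * min \<epsilon> (?r\<^sup>2)) \<le> sqrt \<epsilon> / 2" .
    show "\<epsilon> / (?r\<^sup>2 + \<epsilon>) / (2 * pi * ?r) * (pi * min (?r\<^sup>2) (?r\<^sup>2)) \<le> sqrt \<epsilon> / 2"
    proof (cases "x = 0")
      case False
      have "\<epsilon> / (?r\<^sup>2 + \<epsilon>) / (2 * pi * ?r) * (pi * min (?r\<^sup>2) (?r\<^sup>2)) = \<epsilon> * (?r / (2 * (?r\<^sup>2 + \<epsilon>)))"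
        using False assms by (simp add: power2_eq_square)
      also have "\<dots> = sqrt \<epsilon> * sqrt \<epsilon> * (?r / (2 * (?r\<^sup>2 + \<epsilon>)))" using assms by simp
      also have "\<dots> = sqrt \<epsilon> * (sqrt \<epsilon> * ?r / (2 * (?r\<^sup>2 + \<epsilon>)))" by simp
      also have "\<dots> \<le> sqrt \<epsilon> * (1 / 2)"
      proof (intro mult_left_mono)
        have "?r\<^sup>2 + \<epsilon> > 0" using assms by (simp add: add_nonneg_pos)
        moreover have "0 \<le> sqrt \<epsilon> * ?r" using assms by simp
        moreover have "2 * (sqrt \<epsilon> * ?r) \<le> ?r\<^sup>2 + \<epsilon>" using amgm by (simp add: ac_simps)
        moreover have "s / (2 * P) \<le> 1 / 2" if "0 < P" "0 \<le> s" "2 * s \<le> P" for s P :: real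
          using that by (simp add: pos_divide_le_eq)
        ultimately show "sqrt \<epsilon> * ?r / (2 * (?r\<^sup>2 + \<epsilon>)) \<le> 1 / 2" by blast
      qed (use assms in simp)
      finally show ?thesis by simp
    qed (use assms in auto)
  qed
  also have "\<dots> = ennreal (sqrt \<epsilon>)"
    using assms by (subst ennreal_plus[symmetric]) auto
  finally show ?thesis .
qed

text \<open>The remainder quotients are bounded by 2 B, one B from the mean value inequality and one
  from the derivative itself, and a constant is integrable for a finite measure. The limit is tested
  along sequences to make dominated convergence applicable.\<close>

lemma has_derivative_integral:
  fixes k :: "'a::euclidean_space \<Rightarrow> 'w \<Rightarrow> 'b::euclidean_space"
  assumes fin: "finite_measure \<mu>"
    and der: "\<And>y w. ((\<lambda>y. k y w) has_derivative k' y w) (at y)"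
    and bd: "\<And>y w \<xi>. norm (k' y w \<xi>) \<le> B * norm \<xi>"
    and int: "\<And>y. integrable \<mu> (k y)"
    and meas': "\<And>\<xi>. (\<lambda>w. k' x w \<xi>) \<in> borel_measurable \<mu>"
  shows "((\<lambda>y. \<integral>w. k y w \<partial>\<mu>) has_derivative (\<lambda>\<xi>. \<integral>w. k' x w \<xi> \<partial>\<mu>)) (at x)"
proof -
  interpret finite_measure \<mu> by (rule fin)
  have int': "integrable \<mu> (\<lambda>w. k' x w \<xi>)" for \<xi>
    by (rule integrable_const_bound[where B = "B * norm \<xi>"]) (auto intro: bd meas')
  have lin: "linear (k' x w)" for w
    using der[of w x] has_derivative_linear by blast
  show ?thesis
    unfolding has_derivative_at
  proof
    show "bounded_linear (\<lambda>\<xi>. \<integral>w. k' x w \<xi> \<partial>\<mu>)"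
    proof (subst linear_conv_bounded_linear[symmetric], rule linearI)
      show "(\<integral>w. k' x w (a + b) \<partial>\<mu>) = (\<integral>w. k' x w a \<partial>\<mu>) + (\<integral>w. k' x w b \<partial>\<mu>)" for a b
        by (simp add: linear_add[OF lin] int')
      show "(\<integral>w. k' x w (c *\<^sub>R a) \<partial>\<mu>) = c *\<^sub>R (\<integral>w. k' x w a \<partial>\<mu>)" for c a
        by (simp add: linear_scale[OF lin])
    qed
    show "(\<lambda>\<xi>. norm ((\<integral>w. k (x + \<xi>) w \<partial>\<mu>) - (\<integral>w. k x w \<partial>\<mu>) - (\<integral>w. k' x w \<xi> \<partial>\<mu>)) / norm \<xi>) \<midarrow>0\<rightarrow> 0"
      unfolding tendsto_at_iff_sequentially
    proof (intro allI impI)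
      fix X :: "nat \<Rightarrow> 'a"
      assume X0: "\<forall>i. X i \<in> UNIV - {0}" and X: "X \<longlonglongrightarrow> 0"
      define s where "s i w = (k (x + X i) w - k x w - k' x w (X i)) /\<^sub>R norm (X i)" for i w
      have "(\<lambda>i. \<integral>w. s i w \<partial>\<mu>) \<longlonglongrightarrow> (\<integral>w. 0 \<partial>\<mu>)"
      proof (rule integral_dominated_convergence[where w = "\<lambda>_. 2 * B"])
        show "s i \<in> borel_measurable \<mu>" for i
          unfolding s_def using int int' by (intro borel_measurable_scaleR borel_measurable_diff) auto
        show "AE w in \<mu>. (\<lambda>i. s i w) \<longlonglongrightarrow> 0"
        proof (intro AE_I2)
          fix w
          have "(\<lambda>\<xi>. norm (k (x + \<xi>) w - k x w - k' x w \<xi>) / norm \<xi>) \<midarrow>0\<rightarrow> 0"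
            using der[of w x] unfolding has_derivative_at by blast
          then have "(\<lambda>i. norm (s i w)) \<longlonglongrightarrow> 0"
            unfolding tendsto_at_iff_sequentially s_def using X0 X by (auto simp: comp_def divide_inverse mult.commute)
          then show "(\<lambda>i. s i w) \<longlonglongrightarrow> 0" by (rule tendsto_norm_zero_cancel)
        qed
        show "AE w in \<mu>. norm (s i w) \<le> 2 * B" for i
        proof (intro AE_I2)
          fix w
          have n: "norm (X i) > 0" using X0 by simp
          have "norm (k (x + X i) w - k x w) \<le> B * norm (x + X i - x)"
            by (rule differentiable_bound[of UNIV _ "\<lambda>y. k' y w"])
               (auto intro: has_derivative_at_withinI der onorm_bound bd  order_trans[OF norm_ge_zero] onorm_le)
          moreover have "norm (k (x + X i) w - k x w - k' x w (X i)) \<le> norm (k (x + X i) w - k x w) + norm (k' x w (X i))"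
            by (rule norm_triangle_ineq4)
          ultimately have "norm (k (x + X i) w - k x w - k' x w (X i)) \<le> 2 * B * norm (X i)"
            using bd[of x w "X i"] by simp
          moreover have "norm (s i w) = norm (k (x + X i) w - k x w - k' x w (X i)) / norm (X i)"
            by (simp add: s_def divide_inverse mult.commute)
          ultimately show "norm (s i w) \<le> 2 * B"
            using n by (simp add: pos_divide_le_eq)
        qed
      qed auto
      moreover have "(\<integral>w. s i w \<partial>\<mu>) = ((\<integral>w. k (x + X i) w \<partial>\<mu>) - (\<integral>w. k x w \<partial>\<mu>) - (\<integral>w. k' x w (X i) \<partial>\<mu>)) /\<^sub>R norm (X i)" for i
        unfolding s_def using int int' by simp
      ultimately have "(\<lambda>i. norm (((\<integral>w. k (x + X i) w \<partial>\<mu>) - (\<integral>w. k x w \<partial>\<mu>) - (\<integral>w. k' x w (X i) \<partial>\<mu>)) /\<^sub>R norm (X i))) \<longlonglongrightarrow> 0"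
        using tendsto_norm_zero by fastforce
      then show "((\<lambda>\<xi>. norm ((\<integral>w. k (x + \<xi>) w \<partial>\<mu>) - (\<integral>w. k x w \<partial>\<mu>) - (\<integral>w. k' x w \<xi> \<partial>\<mu>)) / norm \<xi>) \<circ> X) \<longlonglongrightarrow> 0"
        by (simp add: comp_def divide_inverse mult.commute)
    qed
  qed
qed

section \<open>Almost measure-preserving maps\<close>

text \<open>Distortion of Lebesgue measure by at most the factor \<kappa> in either direction,
  expressed by integrals of nonnegative functions instead of Jacobians: in this form the factors
  multiply under composition, and the bounds can be passed to a uniform limit.\<close>

definition quasi_preserving :: "real \<Rightarrow> ('a::euclidean_space \<Rightarrow> 'a) \<Rightarrow> bool" where
  "quasi_preserving \<kappa> \<phi> \<longleftrightarrow> \<phi> \<in> borel_measurable borel \<and>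
     (\<forall>g \<in> borel_measurable borel.
        (\<integral>\<^sup>+ z. g (\<phi> z) \<partial>lborel) \<le> ennreal \<kappa> * (\<integral>\<^sup>+ z. g z \<partial>lborel) \<and>
        (\<integral>\<^sup>+ z. g z \<partial>lborel) \<le> ennreal \<kappa> * (\<integral>\<^sup>+ z. g (\<phi> z) \<partial>lborel))"

lemma quasi_preservingD:
  assumes "quasi_preserving \<kappa> \<phi>"
  shows "\<phi> \<in> borel_measurable borel"
    and "g \<in> borel_measurable borel \<Longrightarrow> (\<integral>\<^sup>+ z. g (\<phi> z) \<partial>lborel) \<le> ennreal \<kappa> * (\<integral>\<^sup>+ z. g z \<partial>lborel)"
    and "g \<in> borel_measurable borel \<Longrightarrow> (\<integral>\<^sup>+ z. g z \<partial>lborel) \<le> ennreal \<kappa> * (\<integral>\<^sup>+ z. g (\<phi> z) \<partial>lborel)"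
  using assms by (auto simp: quasi_preserving_def)

lemma quasi_preserving_id: "quasi_preserving 1 (\<lambda>z. z)"
  by (simp add: quasi_preserving_def)

lemma quasi_preserving_compose:
  assumes 1: "quasi_preserving \<kappa> \<phi>" and 2: "quasi_preserving \<kappa>' \<psi>" and \<kappa>: "0 \<le> \<kappa>" "0 \<le> \<kappa>'"
  shows "quasi_preserving (\<kappa> * \<kappa>') (\<lambda>z. \<psi> (\<phi> z))"
  unfolding quasi_preserving_def
proof (intro conjI ballI)
  note [measurable] = quasi_preservingD(1)[OF 1] quasi_preservingD(1)[OF 2]
  show "(\<lambda>z. \<psi> (\<phi> z)) \<in> borel_measurable borel" by measurable
  fix g :: "'a \<Rightarrow> ennreal" assume [measurable]: "g \<in> borel_measurable borel"
  have "(\<integral>\<^sup>+ z. g (\<psi> (\<phi> z)) \<partial>lborel) \<le> ennreal \<kappa> * (\<integral>\<^sup>+ z. g (\<psi> z) \<partial>lborel)"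
    by (rule quasi_preservingD(2)[OF 1, of "\<lambda>z. g (\<psi> z)"]) measurable
  also have "\<dots> \<le> ennreal \<kappa> * (ennreal \<kappa>' * (\<integral>\<^sup>+ z. g z \<partial>lborel))"
    by (intro mult_left_mono quasi_preservingD(2)[OF 2]) auto
  finally show "(\<integral>\<^sup>+ z. g (\<psi> (\<phi> z)) \<partial>lborel) \<le> ennreal (\<kappa> * \<kappa>') * (\<integral>\<^sup>+ z. g z \<partial>lborel)"
    using \<kappa> by (simp add: ennreal_mult mult.assoc)
  have "(\<integral>\<^sup>+ z. g z \<partial>lborel) \<le> ennreal \<kappa>' * (\<integral>\<^sup>+ z. g (\<psi> z) \<partial>lborel)"
    by (rule quasi_preservingD(3)[OF 2]) measurable
  also have "\<dots> \<le> ennreal \<kappa>' * (ennreal \<kappa> * (\<integral>\<^sup>+ z. g (\<psi> (\<phi> z)) \<partial>lborel))"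
    by (intro mult_left_mono quasi_preservingD(3)[OF 1, of "\<lambda>z. g (\<psi> z)"]) auto
  finally show "(\<integral>\<^sup>+ z. g z \<partial>lborel) \<le> ennreal (\<kappa> * \<kappa>') * (\<integral>\<^sup>+ z. g (\<psi> (\<phi> z)) \<partial>lborel)"
    using \<kappa> by (simp add: ennreal_mult mult.assoc mult.left_commute)
qed

lemma quasi_preserving_mono:
  assumes "quasi_preserving \<kappa> \<phi>" and "\<kappa> \<le> \<kappa>'"
  shows "quasi_preserving \<kappa>' \<phi>"
  unfolding quasi_preserving_def
proof (intro conjI ballI)
  show "\<phi> \<in> borel_measurable borel" by (rule quasi_preservingD(1)[OF assms(1)])
  have m: "ennreal \<kappa> * c \<le> ennreal \<kappa>' * c" for c
    using assms(2) by (intro mult_right_mono ennreal_leI) auto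
  fix g :: "'a \<Rightarrow> ennreal" assume g: "g \<in> borel_measurable borel"
  show "(\<integral>\<^sup>+ z. g (\<phi> z) \<partial>lborel) \<le> ennreal \<kappa>' * (\<integral>\<^sup>+ z. g z \<partial>lborel)"
    by (rule order_trans[OF quasi_preservingD(2)[OF assms(1) g] m])
  show "(\<integral>\<^sup>+ z. g z \<partial>lborel) \<le> ennreal \<kappa>' * (\<integral>\<^sup>+ z. g (\<phi> z) \<partial>lborel)"
    by (rule order_trans[OF quasi_preservingD(3)[OF assms(1) g] m])
qed

lemma quasi_preserving_emeasureI:
  fixes \<phi> :: "'a::euclidean_space \<Rightarrow> 'a"
  assumes [measurable]: "\<phi> \<in> borel_measurable borel"
    and le: "\<And>S. S \<in> sets borel \<Longrightarrow> emeasure lborel (\<phi> -` S) \<le> ennreal \<kappa> * emeasure lborel S"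
    and ge: "\<And>S. S \<in> sets borel \<Longrightarrow> emeasure lborel S \<le> ennreal \<kappa> * emeasure lborel (\<phi> -` S)"
  shows "quasi_preserving \<kappa> \<phi>"
  unfolding quasi_preserving_def
proof (intro conjI ballI)
  let ?D = "distr lborel borel \<phi>"
  have D: "emeasure ?D S = emeasure lborel (\<phi> -` S)" if "S \<in> sets borel" for S
    using that by (subst emeasure_distr) auto
  fix g :: "'a \<Rightarrow> ennreal" assume [measurable]: "g \<in> borel_measurable borel"
  have "?D \<le> scale_measure (ennreal \<kappa>) lborel"
    by (rule le_measure[THEN iffD2]) (auto simp: le D le_fun_def intro: le)
  then have "nn_integral ?D g \<le> nn_integral (scale_measure (ennreal \<kappa>) lborel) g"
    by (intro nn_integral_mono_measure) auto
  then show "(\<integral>\<^sup>+ z. g (\<phi> z) \<partial>lborel) \<le> ennreal \<kappa> * (\<integral>\<^sup>+ z. g z \<partial>lborel)"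
    by (simp add: nn_integral_distr nn_integral_scale_measure)
  have "lborel \<le> scale_measure (ennreal \<kappa>) ?D"
    by (rule le_measure[THEN iffD2]) (auto simp: ge D le_fun_def)
  then have "nn_integral lborel g \<le> nn_integral (scale_measure (ennreal \<kappa>) ?D) g"
    by (intro nn_integral_mono_measure) auto
  then show "(\<integral>\<^sup>+ z. g z \<partial>lborel) \<le> ennreal \<kappa> * (\<integral>\<^sup>+ z. g (\<phi> z) \<partial>lborel)"
    by (simp add: nn_integral_distr nn_integral_scale_measure)
qed fact

section \<open>Planar maps close to the identity\<close>

lemma bij_perturbation_of_identity:
  fixes W :: "'a::banach \<Rightarrow> 'a"
  assumes lip: "\<And>x y. norm (W x - W y) \<le> c * norm (x - y)" and c: "0 \<le> c" "c < 1"
  shows "bij (\<lambda>x. x + W x)"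
proof (rule bijI)
  show "inj (\<lambda>x. x + W x)"
  proof (rule injI)
    fix x y assume "x + W x = y + W y"
    then have "x - y = W y - W x" by (simp add: algebra_simps)
    then have "norm (x - y) \<le> c * norm (x - y)" using lip[of y x] by (simp add: norm_minus_commute)
    moreover have "c * norm (x - y) < 1 * norm (x - y)" if "x \<noteq> y"
      using that c by (intro mult_strict_right_mono) auto
    ultimately show "x = y" by (cases "x = y") simp_all
  qed
  show "surj (\<lambda>x. x + W x)"
    unfolding surj_def
  proof
    fix y
    have "\<exists>!x. y - W x = x"
      by (rule banach_fix_type[OF c]) (auto simp: dist_norm norm_minus_commute intro!: lip)
    then obtain x where "y - W x = x" by blast
    then have "y = x + W x" by (simp add: algebra_simps)
    then show "\<exists>x. y = x + W x" ..
  qed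
qed

text \<open>In the plane det (I + A) = 1 + tr A + det A. With zero trace the linear term is absent,
  and |det A| is at most 2 c^2 because each entry of A is bounded by c.\<close>

lemma det_identity_plus_traceless:
  fixes A :: "R2 \<Rightarrow> R2"
  assumes A: "linear A" and bd: "\<And>\<xi>. norm (A \<xi>) \<le> c * norm \<xi>"
    and tr: "A (axis 1 1) $ 1 + A (axis 2 1) $ 2 = 0"
  shows "\<bar>det (matrix (\<lambda>\<xi>. \<xi> + A \<xi>)) - 1\<bar> \<le> 2 * c\<^sup>2"
proof -
  let ?a = "A (axis 1 1) $ 1" and ?b = "A (axis 2 1) $ 1" and ?c = "A (axis 1 1) $ 2"
  have d: "A (axis 2 1) $ 2 = - ?a" using tr by simp
  have ax: "axis (1::2) (1::real) $ 2 = 0" "axis (2::2) (1::real) $ 1 = 0" by (simp_all add: axis_def)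
  have "det (matrix (\<lambda>\<xi>. \<xi> + A \<xi>)) = (1 + ?a) * (1 - ?a) - ?b * ?c"
    by (simp add: det_2 matrix_def ax d)
  then have eq: "det (matrix (\<lambda>\<xi>. \<xi> + A \<xi>)) - 1 = - (?a * ?a) - ?b * ?c" by (simp add: algebra_simps)
  have le: "\<bar>A (axis i 1) $ j\<bar> \<le> c" for i j
    using component_le_norm_cart[of "A (axis i 1)" j] bd[of "axis i 1"] by simp
  have "\<bar>?a * ?a\<bar> \<le> c * c" "\<bar>?b * ?c\<bar> \<le> c * c"
    unfolding abs_mult by (intro mult_mono le; simp add: order_trans[OF abs_ge_zero le])+
  then show ?thesis unfolding eq power2_eq_square by linarith
qed

text \<open>The change of variables formula for an injective differentiable map compares a set of
  finite measure with its image. The preimage of S is exhausted by bounded pieces, and both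
  inequalities pass to the supremum.\<close>

lemma emeasure_vimage_near_identity:
  fixes W :: "R2 \<Rightarrow> R2"
  assumes der: "\<And>x. (W has_derivative W' x) (at x)"
    and bd: "\<And>x \<xi>. norm (W' x \<xi>) \<le> c * norm \<xi>"
    and tr: "\<And>x. W' x (axis 1 1) $ 1 + W' x (axis 2 1) $ 2 = 0"
    and c: "0 \<le> c" "c \<le> 1 / 2" and S: "S \<in> sets borel"
  shows "emeasure lborel ((\<lambda>x. x + W x) -` S) \<le> ennreal (1 + 4 * c\<^sup>2) * emeasure lborel S"
    and "emeasure lborel S \<le> ennreal (1 + 4 * c\<^sup>2) * emeasure lborel ((\<lambda>x. x + W x) -` S)"
proof -
  let ?\<phi> = "\<lambda>x. x + W x" and ?\<kappa> = "1 + 4 * c\<^sup>2"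
  let ?d = "\<lambda>x. \<bar>det (matrix (\<lambda>\<xi>. \<xi> + W' x \<xi>))\<bar>"
  have lip: "norm (W x - W y) \<le> c * norm (x - y)" for x y
    by (rule differentiable_bound[of UNIV _ W'])
       (auto intro: has_derivative_at_withinI der onorm_le bd)
  then have bij: "bij ?\<phi>" by (rule bij_perturbation_of_identity) (use c in auto)
  have cW: "continuous_on UNIV W"
    using has_derivative_continuous[OF der] by (auto simp: continuous_on_eq_continuous_at)
  have [measurable]: "?\<phi> \<in> borel_measurable borel"
    by (intro borel_measurable_continuous_onI continuous_intros cW)
  have c2: "c\<^sup>2 \<le> 1 / 4" using power_mono[OF c(2,1), of 2] by (simp add: power2_eq_square)
  have det: "1 - 2 * c\<^sup>2 \<le> ?d x" "?d x \<le> 1 + 2 * c\<^sup>2" for x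
  proof -
    have "\<bar>det (matrix (\<lambda>\<xi>. \<xi> + W' x \<xi>)) - 1\<bar> \<le> 2 * c\<^sup>2"
      by (rule det_identity_plus_traceless[OF has_derivative_linear[OF der] bd tr])
    then show "1 - 2 * c\<^sup>2 \<le> ?d x" "?d x \<le> 1 + 2 * c\<^sup>2" by linarith+
  qed
  have main: "emeasure lborel T \<le> ennreal ?\<kappa> * emeasure lborel A \<and> emeasure lborel A \<le> ennreal ?\<kappa> * emeasure lborel T"
    if A: "A \<in> sets borel" "emeasure lborel A < \<infinity>" and T: "T = ?\<phi> ` A" "T \<in> sets borel" for A T
  proof -
    have Am: "A \<in> lmeasurable" using A by (simp add: fmeasurable_def)
    have der': "(?\<phi> has_derivative (\<lambda>\<xi>. \<xi> + W' x \<xi>)) (at x within A)" for x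
      by (rule has_derivative_add[OF has_derivative_ident has_derivative_at_withinI[OF der]])
    have inj: "inj_on ?\<phi> A" using bij by (meson bij_is_inj inj_on_subset subset_UNIV)
    have meas: "?d \<in> borel_measurable (lebesgue_on A)"
      by (intro borel_measurable_abs borel_measurable_det_Jacobian[of A ?\<phi>] der') (use Am in auto)
    have const: "(\<lambda>x. k) integrable_on A" "integral A (\<lambda>x. k) = k * measure lebesgue A" for k :: real
      using integrable_on_const[OF Am, of k] lmeasure_integral[OF Am] integral_mult_right[of A k "\<lambda>_. 1"] by auto
    have int: "?d integrable_on A"
      by (rule measurable_bounded_by_integrable_imp_integrable[OF meas const(1)[of "1 + 2 * c\<^sup>2"]])
         (use det Am in auto)
    have Tm: "T \<in> lmeasurable" and mT: "measure lebesgue T = integral A ?d"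
      using measurable_differentiable_image_eq[OF _ der' inj] measure_differentiable_image_eq[OF _ der' inj int] int Am T
      by auto
    have "measure lebesgue T \<le> (1 + 2 * c\<^sup>2) * measure lebesgue A"
      unfolding mT const(2)[symmetric] by (rule integral_le[OF int const(1)]) (rule det)
    moreover have "(1 - 2 * c\<^sup>2) * measure lebesgue A \<le> measure lebesgue T"
      unfolding mT const(2)[symmetric] by (rule integral_le[OF const(1) int]) (rule det)
    moreover have "emeasure lborel T = ennreal (measure lebesgue T)" "emeasure lborel A = ennreal (measure lebesgue A)"
      using emeasure_eq_measure2[OF Tm] emeasure_eq_measure2[OF Am] T(2) A(1) by simp_all
    moreover have "(1 + 2 * c\<^sup>2) * a \<le> ?\<kappa> * a" if "0 \<le> a" for a using that by (intro mult_right_mono) auto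
    moreover have "a \<le> ?\<kappa> * ((1 - 2 * c\<^sup>2) * a)" if "0 \<le> a" for a
    proof -
      \<comment> \<open>The Jacobian lies between 1 - 2 c^2 and 1 + 2 c^2; inverting the lower bound
        is what doubles the constant, since (1 + 4 s) (1 - 2 s) \<ge> 1 for 0 \<le> s \<le>
        1/4.\<close>
      have "c\<^sup>2 * c\<^sup>2 \<le> 1 / 4 * c\<^sup>2" using c2 by (intro mult_right_mono) auto
      then have "1 \<le> ?\<kappa> * (1 - 2 * c\<^sup>2)" by (simp add: algebra_simps)
      then show ?thesis using that by (metis mult.assoc mult_1 mult_right_mono)
    qed
    moreover have "?\<kappa> * ((1 - 2 * c\<^sup>2) * measure lebesgue A) \<le> ?\<kappa> * measure lebesgue T"
      using calculation(2) by (intro mult_left_mono) auto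
    ultimately have "measure lebesgue T \<le> ?\<kappa> * measure lebesgue A" "measure lebesgue A \<le> ?\<kappa> * measure lebesgue T"
      and e: "emeasure lborel T = ennreal (measure lebesgue T)" "emeasure lborel A = ennreal (measure lebesgue A)"
      by (meson measure_nonneg order_trans)+
    moreover have "ennreal ?\<kappa> * ennreal a = ennreal (?\<kappa> * a)" if "0 \<le> a" for a
      using that by (intro ennreal_mult[symmetric]) auto
    ultimately show ?thesis by (simp only: e measure_nonneg ennreal_leI)
  qed
  \<comment> \<open>\<open>T n\<close> is the image of \<open>A n\<close>; written as S cut with the
    image of a compact ball, it is visibly a Borel set.\<close>
  define A T where "A n = ?\<phi> -` S \<inter> cball 0 (real n)" and "T n = S \<inter> ?\<phi> ` cball 0 (real n)" for n
  have TA: "T n = ?\<phi> ` A n" for n by (auto simp: A_def T_def)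
  have Ab: "A n \<in> sets borel" for n
    unfolding A_def using measurable_sets[OF \<open>?\<phi> \<in> borel_measurable borel\<close> S] by auto
  have Tb: "T n \<in> sets borel" for n
  proof -
    have "compact (?\<phi> ` cball 0 (real n))"
      by (intro compact_continuous_image continuous_intros continuous_on_subset[OF cW]) auto
    then show ?thesis unfolding T_def using S by (intro sets.Int) (auto intro: borel_compact)
  qed
  have Af: "emeasure lborel (A n) < \<infinity>" for n
  proof -
    have "emeasure lborel (A n) \<le> emeasure lborel (cball 0 (real n) :: R2 set)"
      by (intro emeasure_mono) (auto simp: A_def)
    then show ?thesis by (auto simp: emeasure_cball intro: le_less_trans)
  qed
  note m = main[OF Ab Af TA Tb]
  have UA: "(\<Union>n. A n) = ?\<phi> -` S" unfolding A_def by (auto simp: real_arch_simple)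
  have UT: "(\<Union>n. T n) = S"
    unfolding TA image_UN[symmetric] UA using bij by (simp add: bij_is_surj surj_image_vimage_eq)
  have incA: "incseq A" and incT: "incseq T"
    unfolding incseq_def A_def T_def by (auto simp: image_iff intro: order_trans)
  have SA: "emeasure lborel (?\<phi> -` S) = (SUP n. emeasure lborel (A n))"
    unfolding UA[symmetric] by (rule SUP_emeasure_incseq[symmetric]) (use Ab incA in auto)
  have ST: "emeasure lborel S = (SUP n. emeasure lborel (T n))"
    unfolding UT[symmetric] by (rule SUP_emeasure_incseq[symmetric]) (use Tb incT in auto)
  show "emeasure lborel (?\<phi> -` S) \<le> ennreal ?\<kappa> * emeasure lborel S"
    unfolding SA
  proof (rule SUP_least)
    fix n
    have "emeasure lborel (A n) \<le> ennreal ?\<kappa> * emeasure lborel (T n)" using m by blast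
    also have "\<dots> \<le> ennreal ?\<kappa> * emeasure lborel S"
      by (intro mult_left_mono emeasure_mono) (use S in \<open>auto simp: T_def\<close>)
    finally show "emeasure lborel (A n) \<le> ennreal ?\<kappa> * emeasure lborel S" .
  qed
  show "emeasure lborel S \<le> ennreal ?\<kappa> * emeasure lborel (?\<phi> -` S)"
    unfolding ST
  proof (rule SUP_least)
    fix n
    have "emeasure lborel (T n) \<le> ennreal ?\<kappa> * emeasure lborel (A n)" using m by blast
    also have "\<dots> \<le> ennreal ?\<kappa> * emeasure lborel (?\<phi> -` S)"
      using measurable_sets[OF \<open>?\<phi> \<in> borel_measurable borel\<close> S]
      by (intro mult_left_mono emeasure_mono) (auto simp: A_def)
    finally show "emeasure lborel (T n) \<le> ennreal ?\<kappa> * emeasure lborel (?\<phi> -` S)" .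
  qed
qed

lemma quasi_preserving_fst_shift:
  fixes W :: "R2 \<Rightarrow> R2 \<Rightarrow> R2"
  assumes meas [measurable]: "(\<lambda>z. W (fst z) (snd z)) \<in> borel_measurable borel"
    and der: "\<And>x v. ((\<lambda>x. W x v) has_derivative W' x v) (at x)"
    and bd: "\<And>x v \<xi>. norm (W' x v \<xi>) \<le> c * norm \<xi>"
    and tr: "\<And>x v. W' x v (axis 1 1) $ 1 + W' x v (axis 2 1) $ 2 = 0"
    and c: "0 \<le> c" "c \<le> 1 / 2"
  shows "quasi_preserving (1 + 4 * c\<^sup>2) (\<lambda>z. (fst z + W (fst z) (snd z), snd z))"
proof (rule quasi_preserving_emeasureI)
  let ?\<phi> = "\<lambda>z. (fst z + W (fst z) (snd z), snd z)"
  show M: "?\<phi> \<in> borel_measurable borel" by measurable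
  fix S :: "R4 set" assume S: "S \<in> sets borel"
  define sec where "sec v = (\<lambda>x::R2. (x, v)) -` S" for v :: R2
  have [measurable]: "sec v \<in> sets borel" for v
    unfolding sec_def using measurable_sets_borel[OF _ S, of "\<lambda>x. (x, v)"] by simp
  have fib: "emeasure lborel B = (\<integral>\<^sup>+ v. emeasure lborel ((\<lambda>x. (x, v)) -` B) \<partial>lborel)"
    if "B \<in> sets borel" for B :: "R4 set"
    using lborel_pair.emeasure_pair_measure_alt2[unfolded lborel_prod, of B] that by simp
  have pre: "(\<lambda>x. (x, v)) -` (?\<phi> -` S) = (\<lambda>x. x + W x v) -` sec v" for v
    by (auto simp: sec_def)
  have B: "?\<phi> -` S \<in> sets borel" using measurable_sets[OF M S] by simp
  have mS: "(\<lambda>v. emeasure lborel (sec v)) \<in> borel_measurable lborel"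
    unfolding sec_def using lborel_pair.measurable_emeasure_Pair2[unfolded lborel_prod, of S] S by simp
  have mB: "(\<lambda>v. emeasure lborel ((\<lambda>x. x + W x v) -` sec v)) \<in> borel_measurable lborel"
    unfolding pre[symmetric] using lborel_pair.measurable_emeasure_Pair2[unfolded lborel_prod, of "?\<phi> -` S"] B by simp
  note v = emeasure_vimage_near_identity[OF der bd tr c]
  show "emeasure lborel (?\<phi> -` S) \<le> ennreal (1 + 4 * c\<^sup>2) * emeasure lborel S"
    unfolding fib[OF B] fib[OF S] pre sec_def[symmetric]
    by (subst nn_integral_cmult[symmetric, OF mS]) (intro nn_integral_mono v(1), simp)
  show "emeasure lborel S \<le> ennreal (1 + 4 * c\<^sup>2) * emeasure lborel (?\<phi> -` S)"
    unfolding fib[OF B] fib[OF S] pre sec_def[symmetric]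
    by (subst nn_integral_cmult[symmetric, OF mB]) (intro nn_integral_mono v(2), simp)
qed

text \<open>A velocity kick is a position kick conjugated by the swap, so a single type of shift has
  to be analysed.\<close>

lemma quasi_preserving_swap: "quasi_preserving 1 (prod.swap :: 'a::euclidean_space \<times> 'a \<Rightarrow> _)"
proof -
  have [measurable]: "(prod.swap :: 'a \<times> 'a \<Rightarrow> _) \<in> borel_measurable borel"
    unfolding prod.swap_def[abs_def] by measurable
  have "(lborel :: ('a \<times> 'a) measure) = distr lborel lborel (\<lambda>(x, y). (y, x))"
    using lborel_pair.distr_pair_swap[where 'a='a and 'b='a] unfolding lborel_prod .
  moreover have "distr lborel borel (prod.swap :: 'a \<times> 'a \<Rightarrow> _) = distr lborel lborel (\<lambda>(x, y). (y, x))"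
    by (rule distr_cong) (auto simp: prod.swap_def)
  ultimately have "distr lborel borel (prod.swap :: 'a \<times> 'a \<Rightarrow> _) = lborel" by simp
  then have "(\<integral>\<^sup>+ z. g (prod.swap z) \<partial>lborel) = (\<integral>\<^sup>+ z. g z \<partial>lborel)"
    if "g \<in> borel_measurable borel" for g :: "'a \<times> 'a \<Rightarrow> ennreal"
    using nn_integral_distr[of prod.swap lborel borel g] that by simp
  then show ?thesis by (simp add: quasi_preserving_def)
qed

section \<open>Drift generated by a transported density\<close>

definition weight :: "real \<Rightarrow> R2 \<Rightarrow> real" where
  "weight \<gamma> x = (1 + norm x) powr - \<gamma>"

lemma borel_measurable_weight [measurable]: "weight \<gamma> \<in> borel_measurable borel"
  unfolding weight_def[abs_def] by measurable

lemma weight_pos: "0 < weight \<gamma> x"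
proof -
  have "1 + norm x \<noteq> 0" using norm_ge_zero[of x] by linarith
  then show ?thesis by (simp add: weight_def)
qed

lemma weight_le_1: "0 \<le> \<gamma> \<Longrightarrow> weight \<gamma> x \<le> 1"
  using powr_mono2'[of "-\<gamma>" 1 "1 + norm x"] by (simp add: weight_def)

text \<open>If x and y are at most R apart, then 1 + |y| \<le> (1 + R) (1 + |x|). Applied with R the
  distance travelled, once for position and once for velocity, this is the source of the exponent 2
  \<gamma> in the growth of the weighted norm.\<close>

lemma weight_shift:
  assumes "norm (x - y) \<le> R" "0 \<le> \<gamma>"
  shows "weight \<gamma> x \<le> (1 + R) powr \<gamma> * weight \<gamma> y"
proof -
  have R: "0 \<le> R" using assms(1) norm_ge_zero order_trans by blast
  have "norm y \<le> norm x + R"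
    using norm_triangle_ineq2[of y x] assms(1) by (simp add: norm_minus_commute)
  also have "1 + (norm x + R) \<le> (1 + R) * (1 + norm x)"
    using R by (simp add: algebra_simps)
  finally have "1 + norm y \<le> (1 + R) * (1 + norm x)" by simp
  then have "((1 + R) * (1 + norm x)) powr - \<gamma> \<le> (1 + norm y) powr - \<gamma>"
    using assms(2) by (intro powr_mono2') (auto intro: add_pos_nonneg)
  then have "(1 + R) powr - \<gamma> * weight \<gamma> x \<le> weight \<gamma> y"
    using R by (simp add: powr_mult weight_def)
  then have "(1 + R) powr \<gamma> * ((1 + R) powr - \<gamma> * weight \<gamma> x) \<le> (1 + R) powr \<gamma> * weight \<gamma> y"
    by (intro mult_left_mono) auto
  then show ?thesis
    using R by (simp add: mult.assoc[symmetric] powr_add[symmetric])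
qed

definition weight_mass :: "real \<Rightarrow> real" where
  "weight_mass \<gamma> = enn2real (\<integral>\<^sup>+ x. ennreal (weight \<gamma> x) \<partial>lborel)"

lemma weight_mass_nonneg: "0 \<le> weight_mass \<gamma>"
  by (simp add: weight_mass_def)

lemma nn_integral_weight:
  assumes "\<gamma> > 2"
  shows "(\<integral>\<^sup>+ x. ennreal (weight \<gamma> x) \<partial>lborel) = ennreal (weight_mass \<gamma>)"
  using nn_integral_weight_finite[OF assms] by (simp add: weight_mass_def weight_def[abs_def])

text \<open>The field at z of the image of \<nu> under \<Phi>, in Lagrangian form: the particle with
  label w sits at \<open>\<Phi> w\<close>. With the measure fixed, two configurations can be
  compared label by label. The kernel is a parameter because \<open>J\<close> and its
  regularisations share the size estimates.\<close>

definition drift :: "(R2 \<Rightarrow> R2 \<Rightarrow> R2) \<Rightarrow> R4 measure \<Rightarrow> (R4 \<Rightarrow> R4) \<Rightarrow> R4 \<Rightarrow> R2" where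
  "drift j \<nu> \<Phi> z = (\<integral>w. j (fst (z - \<Phi> w)) (snd (z - \<Phi> w)) \<partial>\<nu>)"

text \<open>The two fields differ by exchanging position and velocity, in the target point and in
  the sources alike; hence one estimate for \<open>drift\<close> yields both components.\<close>

definition velocity :: "R4 measure \<Rightarrow> (R4 \<Rightarrow> R4) \<Rightarrow> R4 \<Rightarrow> R4" where
  "velocity \<nu> \<Phi> z = (drift J \<nu> \<Phi> z, drift J \<nu> (\<lambda>w. prod.swap (\<Phi> w)) (prod.swap z))"

text \<open>The source configuration \<Phi> is separate from the point that is moved: both kicks of
  a step keep the sources of its beginning, so each is a fixed map of phase space to which the
  Jacobian estimate applies.\<close>

definition kick :: "R4 measure \<Rightarrow> real \<Rightarrow> real \<Rightarrow> (R4 \<Rightarrow> R4) \<Rightarrow> R4 \<Rightarrow> R4" where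
  "kick \<nu> \<epsilon> h \<Phi> z = (fst z + h *\<^sub>R drift (smooth_J \<epsilon>) \<nu> \<Phi> z, snd z)"

text \<open>One step of a splitting scheme: the position is moved with the velocity frozen, then the
  velocity with the position frozen, so that each half step is a planar map of Jacobian close to 1.\<close>
fun scheme :: "R4 measure \<Rightarrow> real \<Rightarrow> real \<Rightarrow> nat \<Rightarrow> R4 \<Rightarrow> R4" where
  "scheme \<nu> \<epsilon> h 0 w = w"
| "scheme \<nu> \<epsilon> h (Suc k) w =
     prod.swap (kick \<nu> \<epsilon> h (\<lambda>w. prod.swap (scheme \<nu> \<epsilon> h k w))
       (prod.swap (kick \<nu> \<epsilon> h (scheme \<nu> \<epsilon> h k) (scheme \<nu> \<epsilon> h k w))))"

lemma norm_fst_le_norm: "norm (fst z) \<le> norm z" and norm_snd_le_norm: "norm (snd z) \<le> norm z"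
  using norm_fst_le[of "fst z" "snd z"] norm_snd_le[of "snd z" "fst z"] by simp_all

lemma norm_swap [simp]: "norm (prod.swap z) = norm z"
  by (simp add: prod.swap_def norm_prod_def add.commute)

lemma swap_diff [simp]: "prod.swap z - prod.swap w = prod.swap (z - w)"
  by (simp add: prod.swap_def)

lemma borel_measurable_swap [measurable]:
  "prod.swap \<in> borel_measurable (borel :: ('a::second_countable_topology \<times> 'a) measure)"
  unfolding prod.swap_def[abs_def] by measurable

locale initial_density =
  fixes \<gamma> M N :: real and f0 :: "R4 \<Rightarrow> real"
  assumes gamma: "\<gamma> > 2"
    and f0_measurable [measurable]: "f0 \<in> borel_measurable borel"
    and f0_nonneg: "\<And>z. 0 \<le> f0 z"
    and f0_le_M: "\<And>z. f0 z \<le> M"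
    and f0_le_N: "\<And>z. f0 z \<le> N * (weight \<gamma> (fst z) * weight \<gamma> (snd z))"
    and f0_mass: "(\<integral>\<^sup>+ z. ennreal (f0 z) \<partial>lborel) = 1"
begin

definition \<nu> :: "R4 measure" where
  "\<nu> = density lborel (\<lambda>z. ennreal (f0 z))"

lemma sets_\<nu> [simp, measurable_cong]: "sets \<nu> = sets borel"
  by (simp add: \<nu>_def)

lemma space_\<nu> [simp]: "space \<nu> = UNIV"
  by (simp add: \<nu>_def)

lemma nn_integral_\<nu>:
  assumes "u \<in> borel_measurable borel"
  shows "(\<integral>\<^sup>+ w. u w \<partial>\<nu>) = (\<integral>\<^sup>+ w. ennreal (f0 w) * u w \<partial>lborel)"
  using assms unfolding \<nu>_def by (intro nn_integral_density) auto

lemma prob_space_\<nu>: "prob_space \<nu>"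
proof
  show "emeasure \<nu> (space \<nu>) = 1"
    using nn_integral_\<nu>[of "\<lambda>_. 1"] f0_mass by simp
qed

sublocale \<nu>: prob_space \<nu> by (rule prob_space_\<nu>)

lemma M_nonneg: "0 \<le> M"
  using f0_nonneg f0_le_M order_trans by blast

lemma M_pos: "0 < M"
proof (rule ccontr)
  assume "\<not> 0 < M"
  then have "f0 z = 0" for z using f0_nonneg[of z] f0_le_M[of z] by simp
  then show False using f0_mass by simp
qed

lemma N_nonneg: "0 \<le> N"
proof -
  have "0 \<le> N * (weight \<gamma> 0 * weight \<gamma> 0)"
    using order_trans[OF f0_nonneg f0_le_N, of 0] by simp
  moreover have "0 < weight \<gamma> 0 * weight \<gamma> 0" using weight_pos by simp
  ultimately show ?thesis by (simp only: zero_le_mult_iff) linarith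
qed

text \<open>By duality: the image of \<nu> under \<Phi> has a density of at most K. This controls
  the size of the drift.\<close>

definition spread :: "real \<Rightarrow> (R4 \<Rightarrow> R4) \<Rightarrow> bool" where
  "spread K \<Phi> \<longleftrightarrow> \<Phi> \<in> borel_measurable borel \<and> 0 \<le> K \<and>
     (\<forall>u \<in> borel_measurable borel. (\<integral>\<^sup>+ w. u (\<Phi> w) \<partial>\<nu>) \<le> ennreal K * (\<integral>\<^sup>+ \<zeta>. u \<zeta> \<partial>lborel))"

text \<open>By duality again: the image of \<nu> has a density of at most C times the weights. The
  decay makes the inverse-square kernel of the difference estimate integrable, which yields
  Lipschitz bounds.\<close>

definition admissible :: "real \<Rightarrow> (R4 \<Rightarrow> R4) \<Rightarrow> bool" where
  "admissible C \<Phi> \<longleftrightarrow> \<Phi> \<in> borel_measurable borel \<and> 0 \<le> C \<and>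
     (\<forall>u \<in> borel_measurable borel. (\<integral>\<^sup>+ w. u (\<Phi> w) \<partial>\<nu>)
        \<le> (\<integral>\<^sup>+ \<zeta>. u \<zeta> * ennreal (C * (weight \<gamma> (fst \<zeta>) * weight \<gamma> (snd \<zeta>))) \<partial>lborel))"

lemma admissible_measurable: "admissible C \<Phi> \<Longrightarrow> \<Phi> \<in> borel_measurable borel"
  by (simp add: admissible_def)

lemma spread_measurable: "spread C \<Phi> \<Longrightarrow> \<Phi> \<in> borel_measurable borel"
  by (simp add: spread_def)

lemma spreadD:
  assumes "spread K \<Phi>" "u \<in> borel_measurable borel"
  shows "(\<integral>\<^sup>+ w. u (\<Phi> w) \<partial>\<nu>) \<le> ennreal K * (\<integral>\<^sup>+ \<zeta>. u \<zeta> \<partial>lborel)"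
  using assms by (simp add: spread_def)

lemma admissibleD:
  assumes "admissible C \<Phi>" "u \<in> borel_measurable borel"
  shows "(\<integral>\<^sup>+ w. u (\<Phi> w) \<partial>\<nu>)
        \<le> (\<integral>\<^sup>+ \<zeta>. u \<zeta> * ennreal (C * (weight \<gamma> (fst \<zeta>) * weight \<gamma> (snd \<zeta>))) \<partial>lborel)"
  using assms by (simp add: admissible_def)

lemma admissible_imp_spread:
  assumes "admissible C \<Phi>"
  shows "spread C \<Phi>"
  unfolding spread_def
proof (intro conjI ballI)
  show "\<Phi> \<in> borel_measurable borel" "0 \<le> C" using assms by (auto simp: admissible_def)
  fix u :: "R4 \<Rightarrow> ennreal" assume u [measurable]: "u \<in> borel_measurable borel"
  have "(\<integral>\<^sup>+ w. u (\<Phi> w) \<partial>\<nu>) \<le> (\<integral>\<^sup>+ \<zeta>. u \<zeta> * ennreal (C * (weight \<gamma> (fst \<zeta>) * weight \<gamma> (snd \<zeta>))) \<partial>lborel)"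
    by (rule admissibleD[OF assms u])
  also have "\<dots> \<le> (\<integral>\<^sup>+ \<zeta>. ennreal C * u \<zeta> \<partial>lborel)"
  proof (intro nn_integral_mono)
    fix \<zeta> :: R4
    have "C * (weight \<gamma> (fst \<zeta>) * weight \<gamma> (snd \<zeta>)) \<le> C * 1"
      using \<open>0 \<le> C\<close> weight_le_1[of \<gamma>] weight_pos[of \<gamma>, THEN less_imp_le] gamma
      by (intro mult_left_mono mult_le_one) auto
    then show "u \<zeta> * ennreal (C * (weight \<gamma> (fst \<zeta>) * weight \<gamma> (snd \<zeta>))) \<le> ennreal C * u \<zeta>"
      by (subst mult.commute) (intro mult_right_mono ennreal_leI; simp)
  qed
  also have "\<dots> = ennreal C * (\<integral>\<^sup>+ \<zeta>. u \<zeta> \<partial>lborel)"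
    by (rule nn_integral_cmult) measurable
  finally show "(\<integral>\<^sup>+ w. u (\<Phi> w) \<partial>\<nu>) \<le> ennreal C * (\<integral>\<^sup>+ \<zeta>. u \<zeta> \<partial>lborel)" .
qed

lemma admissible_swap:
  assumes "admissible C \<Phi>"
  shows "admissible C (\<lambda>w. prod.swap (\<Phi> w))"
  unfolding admissible_def
proof (intro conjI ballI)
  have [measurable]: "\<Phi> \<in> borel_measurable borel" using assms by (rule admissible_measurable)
  show "(\<lambda>w. prod.swap (\<Phi> w)) \<in> borel_measurable borel" by measurable
  show "0 \<le> C" using assms by (simp add: admissible_def)
  fix u :: "R4 \<Rightarrow> ennreal" assume [measurable]: "u \<in> borel_measurable borel"
  let ?G = "\<lambda>\<zeta>::R4. ennreal (C * (weight \<gamma> (fst \<zeta>) * weight \<gamma> (snd \<zeta>)))"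
  have "(\<integral>\<^sup>+ w. u (prod.swap (\<Phi> w)) \<partial>\<nu>) \<le> (\<integral>\<^sup>+ \<zeta>. u (prod.swap \<zeta>) * ?G \<zeta> \<partial>lborel)"
    by (rule admissibleD[OF assms, of "\<lambda>z. u (prod.swap z)"]) measurable
  also have "\<dots> = (\<integral>\<^sup>+ \<zeta>. u (prod.swap \<zeta>) * ?G (prod.swap \<zeta>) \<partial>lborel)"
    by (simp add: mult.commute)
  also have "\<dots> \<le> ennreal 1 * (\<integral>\<^sup>+ \<zeta>. u \<zeta> * ?G \<zeta> \<partial>lborel)"
    by (rule quasi_preservingD(2)[OF quasi_preserving_swap]) measurable
  finally show "(\<integral>\<^sup>+ w. u (prod.swap (\<Phi> w)) \<partial>\<nu>) \<le> (\<integral>\<^sup>+ \<zeta>. u \<zeta> * ?G \<zeta> \<partial>lborel)" by simp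
qed

lemma spread_swap:
  assumes "spread C \<Phi>"
  shows "spread C (\<lambda>w. prod.swap (\<Phi> w))"
  unfolding spread_def
proof (intro conjI ballI)
  have [measurable]: "\<Phi> \<in> borel_measurable borel" using assms by (rule spread_measurable)
  show "(\<lambda>w. prod.swap (\<Phi> w)) \<in> borel_measurable borel" by measurable
  show "0 \<le> C" using assms by (simp add: spread_def)
  fix u :: "R4 \<Rightarrow> ennreal" assume [measurable]: "u \<in> borel_measurable borel"
  have "(\<integral>\<^sup>+ w. u (prod.swap (\<Phi> w)) \<partial>\<nu>) \<le> ennreal C * (\<integral>\<^sup>+ \<zeta>. u (prod.swap \<zeta>) \<partial>lborel)"
    by (rule spreadD[OF assms, of "\<lambda>z. u (prod.swap z)"]) measurable
  also have "\<dots> \<le> ennreal C * (ennreal 1 * (\<integral>\<^sup>+ \<zeta>. u \<zeta> \<partial>lborel))"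
    by (intro mult_left_mono quasi_preservingD(2)[OF quasi_preserving_swap]) auto
  finally show "(\<integral>\<^sup>+ w. u (prod.swap (\<Phi> w)) \<partial>\<nu>) \<le> ennreal C * (\<integral>\<^sup>+ \<zeta>. u \<zeta> \<partial>lborel)" by simp
qed

lemma nn_integral_kernel_le:
  fixes k :: "R4 \<Rightarrow> real"
  assumes "admissible C \<Phi>" and [measurable]: "k \<in> borel_measurable borel"
    and k: "\<And>x. (\<integral>\<^sup>+ v. ennreal (k (x, v)) \<partial>lborel) \<le> ennreal A" and A: "0 \<le> A"
  shows "(\<integral>\<^sup>+ w. ennreal (k (z - \<Phi> w)) \<partial>\<nu>) \<le> ennreal (A * (C * weight_mass \<gamma>))"
proof -
  have C: "0 \<le> C" using assms(1) by (simp add: admissible_def)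
  have "(\<integral>\<^sup>+ w. ennreal (k (z - \<Phi> w)) \<partial>\<nu>)
    \<le> (\<integral>\<^sup>+ \<zeta>. ennreal (k (z - \<zeta>)) * ennreal (C * (weight \<gamma> (fst \<zeta>) * weight \<gamma> (snd \<zeta>))) \<partial>lborel)"
    by (rule admissibleD[OF assms(1), of "\<lambda>\<zeta>. ennreal (k (z - \<zeta>))"]) measurable
  also have "\<dots> \<le> (\<integral>\<^sup>+ \<zeta>. ennreal (k (z - \<zeta>)) * ennreal (C * weight \<gamma> (fst \<zeta>)) \<partial>lborel)"
    using C weight_le_1[of \<gamma>] weight_pos[of \<gamma>, THEN less_imp_le] gamma
    by (intro nn_integral_mono mult_left_mono ennreal_leI) (auto intro: mult_left_le)
  also have "\<dots> \<le> ennreal A * (\<integral>\<^sup>+ y. ennreal (C * weight \<gamma> y) \<partial>lborel)"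
    using nn_integral_convolution_le[of "\<lambda>\<zeta>. ennreal (k \<zeta>)" "\<lambda>y. ennreal (C * weight \<gamma> y)" "ennreal A" z] k
    by simp
  also have "(\<integral>\<^sup>+ y. ennreal (C * weight \<gamma> y) \<partial>lborel) = ennreal C * ennreal (weight_mass \<gamma>)"
    unfolding nn_integral_weight[OF gamma, symmetric]
    by (subst nn_integral_cmult[symmetric]) (auto simp: ennreal_mult' C)
  also have "ennreal A * \<dots> = ennreal (A * (C * weight_mass \<gamma>))"
    using A C weight_mass_nonneg by (simp add: ennreal_mult)
  finally show ?thesis .
qed

text \<open>Within distance R in the first component the density bound K is used; beyond it the
  kernel is at most 1 / (2 pi R) and the total mass is 1. R stays free, to be optimised
  later.\<close>

lemma nn_integral_J_le:
  assumes \<Phi>: "spread K \<Phi>" and R: "0 < R"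
  shows "(\<integral>\<^sup>+ w. ennreal (norm (J (fst (z - \<Phi> w)) (snd (z - \<Phi> w)))) \<partial>\<nu>)
    \<le> ennreal (1 / (2 * pi * R) + K * (pi * R ^ 3 / 3))"
proof -
  have [measurable]: "\<Phi> \<in> borel_measurable borel" and K: "0 \<le> K" using \<Phi> by (auto simp: spread_def)
  define H where "H \<zeta> = ennreal (norm (J (fst \<zeta>) (snd \<zeta>))) * indicator (cball 0 R) (fst \<zeta>)" for \<zeta> :: R4
  have "(\<lambda>z::R4. indicator (cball 0 R) (fst z) :: ennreal) \<in> borel_measurable borel"
    by (rule measurable_compose[OF borel_measurable_fst], rule borel_measurable_indicator) simp
  then have [measurable]: "H \<in> borel_measurable borel" unfolding H_def[abs_def] by measurable
  have "(\<integral>\<^sup>+ w. ennreal (norm (J (fst (z - \<Phi> w)) (snd (z - \<Phi> w)))) \<partial>\<nu>)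
     \<le> (\<integral>\<^sup>+ w. H (z - \<Phi> w) + ennreal (1 / (2 * pi * R)) \<partial>\<nu>)"
  proof (intro nn_integral_mono)
    fix w
    let ?x = "fst (z - \<Phi> w)" and ?v = "snd (z - \<Phi> w)"
    show "ennreal (norm (J ?x ?v)) \<le> H (z - \<Phi> w) + ennreal (1 / (2 * pi * R))"
    proof (cases "norm ?x \<le> R")
      case True
      then have "indicator (cball 0 R) ?x = (1::ennreal)" by simp
      then show ?thesis unfolding H_def by simp
    next
      case False
      then have "1 / (2 * pi * norm ?x) \<le> 1 / (2 * pi * R)"
        using R by (intro frac_le) (auto simp del: fst_diff)
      then have "norm (J ?x ?v) \<le> 1 / (2 * pi * R)" using R by (auto simp: norm_J simp del: fst_diff snd_diff)
      then have "ennreal (norm (J ?x ?v)) \<le> ennreal (1 / (2 * pi * R))" by (rule ennreal_leI)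
      also have "\<dots> \<le> H (z - \<Phi> w) + ennreal (1 / (2 * pi * R))" by simp
      finally show ?thesis .
    qed
  qed
  also have "\<dots> = (\<integral>\<^sup>+ w. H (z - \<Phi> w) \<partial>\<nu>) + ennreal (1 / (2 * pi * R))"
    by (subst nn_integral_add) (auto simp: \<nu>.emeasure_space_1[simplified])
  also have "(\<integral>\<^sup>+ w. H (z - \<Phi> w) \<partial>\<nu>) \<le> ennreal K * (\<integral>\<^sup>+ \<zeta>. H (z - \<zeta>) \<partial>lborel)"
    by (rule spreadD[OF \<Phi>, of "\<lambda>\<zeta>. H (z - \<zeta>)"]) measurable
  also have "(\<integral>\<^sup>+ \<zeta>. H (z - \<zeta>) \<partial>lborel) = (\<integral>\<^sup>+ \<zeta>. H \<zeta> \<partial>lborel)"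
    by (rule nn_integral_lborel_reflect) measurable
  also have "ennreal K * (\<integral>\<^sup>+ \<zeta>. H \<zeta> \<partial>lborel) \<le> ennreal K * ennreal (pi * R ^ 3 / 3)"
    unfolding H_def using R by (intro mult_left_mono nn_integral_J_disc_le) auto
  finally show ?thesis
    using R K by (simp add: ennreal_mult[symmetric] ennreal_plus[symmetric] add.commute add_mono del: ennreal_plus)
qed

definition subkernel :: "(R2 \<Rightarrow> R2 \<Rightarrow> R2) \<Rightarrow> bool" where
  "subkernel j \<longleftrightarrow> (\<lambda>z. j (fst z) (snd z)) \<in> borel_measurable borel \<and> (\<forall>x v. norm (j x v) \<le> norm (J x v))"

lemma subkernel_J: "subkernel J"
  by (simp add: subkernel_def)

lemma subkernel_smooth_J: "\<epsilon> > 0 \<Longrightarrow> subkernel (smooth_J \<epsilon>)"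
  by (simp add: subkernel_def norm_smooth_J_le)

lemma subkernel_measurable:
  assumes "subkernel j" "\<Phi> \<in> borel_measurable borel"
  shows "(\<lambda>w. j (fst (z - \<Phi> w)) (snd (z - \<Phi> w))) \<in> borel_measurable borel"
proof -
  have "(\<lambda>w. z - \<Phi> w) \<in> borel_measurable borel" using assms(2) by measurable
  from measurable_compose[OF this, of "\<lambda>z. j (fst z) (snd z)"] show ?thesis
    using assms(1) by (simp add: subkernel_def)
qed

lemma integrable_subkernel:
  assumes "subkernel j" and \<Phi>: "spread K \<Phi>"
  shows "integrable \<nu> (\<lambda>w. j (fst (z - \<Phi> w)) (snd (z - \<Phi> w)))"
proof (rule integrableI_bounded)
  show "(\<lambda>w. j (fst (z - \<Phi> w)) (snd (z - \<Phi> w))) \<in> borel_measurable \<nu>"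
    using subkernel_measurable[OF assms(1) spread_measurable[OF \<Phi>]] by simp
  have "(\<integral>\<^sup>+ w. ennreal (norm (j (fst (z - \<Phi> w)) (snd (z - \<Phi> w)))) \<partial>\<nu>)
     \<le> (\<integral>\<^sup>+ w. ennreal (norm (J (fst (z - \<Phi> w)) (snd (z - \<Phi> w)))) \<partial>\<nu>)"
    using assms(1) by (intro nn_integral_mono ennreal_leI) (simp add: subkernel_def)
  also have "\<dots> < \<infinity>"
    by (rule le_less_trans[OF nn_integral_J_le[OF \<Phi>, of 1]]) auto
  finally show "(\<integral>\<^sup>+ w. ennreal (norm (j (fst (z - \<Phi> w)) (snd (z - \<Phi> w)))) \<partial>\<nu>) < \<infinity>" .
qed

lemma norm_drift_le:
  assumes "subkernel j" and \<Phi>: "spread K \<Phi>" and R: "0 < R"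
  shows "norm (drift j \<nu> \<Phi> z) \<le> 1 / (2 * pi * R) + K * (pi * R ^ 3 / 3)"
proof -
  have K: "0 \<le> K" using \<Phi> by (simp add: spread_def)
  have "ennreal (norm (drift j \<nu> \<Phi> z)) \<le> (\<integral>\<^sup>+ w. ennreal (norm (j (fst (z - \<Phi> w)) (snd (z - \<Phi> w)))) \<partial>\<nu>)"
    unfolding drift_def by (rule integral_norm_bound_ennreal[OF integrable_subkernel[OF assms(1,2)]])
  also have "\<dots> \<le> (\<integral>\<^sup>+ w. ennreal (norm (J (fst (z - \<Phi> w)) (snd (z - \<Phi> w)))) \<partial>\<nu>)"
    using assms(1) by (intro nn_integral_mono ennreal_leI) (simp add: subkernel_def)
  also have "\<dots> \<le> ennreal (1 / (2 * pi * R) + K * (pi * R ^ 3 / 3))"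
    by (rule nn_integral_J_le[OF \<Phi> R])
  finally show ?thesis
    using R K by (subst (asm) ennreal_le_iff) auto
qed

text \<open>The kernel sees only the differences z - \<Phi> w, which change by at most |z - z'| + d
  for every label w; so a shift of the point and a change of the map are treated at once. Two near
  terms contribute 1/4 each and two layer terms 2 each: 9/2, rounded up to 5.\<close>

lemma norm_drift_J_diff_le:
  assumes \<Phi>: "admissible C \<Phi>" and \<Psi>: "admissible C \<Psi>" and d: "\<And>w. norm (\<Phi> w - \<Psi> w) \<le> d"
  shows "norm (drift J \<nu> \<Phi> z - drift J \<nu> \<Psi> z') \<le> 5 * C * weight_mass \<gamma> * (norm (z - z') + d)"
proof -
  have [measurable]: "\<Phi> \<in> borel_measurable borel" "\<Psi> \<in> borel_measurable borel"
    using \<Phi> \<Psi> by (auto simp: admissible_def)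
  have C: "0 \<le> C" using \<Phi> by (simp add: admissible_def)
  let ?\<delta> = "norm (z - z') + d" and ?W = "C * weight_mass \<gamma>"
  have W: "0 \<le> ?W" using C weight_mass_nonneg by simp
  have \<delta>: "0 \<le> ?\<delta>" using d[of 0] norm_ge_zero[of "\<Phi> 0 - \<Psi> 0"] norm_ge_zero[of "z - z'"] by linarith
  let ?j = "\<lambda>w. J (fst (z - \<Phi> w)) (snd (z - \<Phi> w)) - J (fst (z' - \<Psi> w)) (snd (z' - \<Psi> w))"
  note int = integrable_subkernel[OF subkernel_J admissible_imp_spread]
  have pt: "norm (?j w) \<le> ?\<delta> * (near_kernel (z - \<Phi> w) + near_kernel (z' - \<Psi> w))
      + (layer_kernel ?\<delta> (z - \<Phi> w) + layer_kernel ?\<delta> (z' - \<Psi> w))" for w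
  proof -
    have "norm ((z - \<Phi> w) - (z' - \<Psi> w)) \<le> norm (z - z') + norm (\<Phi> w - \<Psi> w)"
      using norm_triangle_ineq4[of "z - z'" "\<Phi> w - \<Psi> w"] by (simp add: algebra_simps)
    then have t: "norm ((z - \<Phi> w) - (z' - \<Psi> w)) \<le> ?\<delta>" using d[of w] by linarith
    have "norm (fst (z - \<Phi> w) - fst (z' - \<Psi> w)) \<le> ?\<delta>"
      using order_trans[OF norm_fst_le_norm t] by (simp only: fst_diff)
    moreover have "norm (snd (z - \<Phi> w) - snd (z' - \<Psi> w)) \<le> ?\<delta>"
      using order_trans[OF norm_snd_le_norm t] by (simp only: snd_diff)
    ultimately show ?thesis
      using norm_J_diff_le[of "fst (z - \<Phi> w)" "fst (z' - \<Psi> w)" ?\<delta> "snd (z - \<Phi> w)" "snd (z' - \<Psi> w)"]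
      by (simp only: prod.collapse)
  qed
  have near: "(\<integral>\<^sup>+ w. ennreal (near_kernel (y - \<Xi> w)) \<partial>\<nu>) \<le> ennreal (1 / 4 * ?W)" if "admissible C \<Xi>" for \<Xi> y
    by (rule nn_integral_kernel_le[OF that]) (auto simp: nn_integral_near_kernel[simplified])
  have layer: "(\<integral>\<^sup>+ w. ennreal (layer_kernel ?\<delta> (y - \<Xi> w)) \<partial>\<nu>) \<le> ennreal (2 * ?\<delta> * ?W)" if "admissible C \<Xi>" for \<Xi> y
    by (rule nn_integral_kernel_le[OF that _ nn_integral_layer_kernel[OF \<delta>]]) (use \<delta> in auto)
  have nn: "0 \<le> near_kernel q" "0 \<le> layer_kernel ?\<delta> q" for q
    by (auto simp: near_kernel_def layer_kernel_def case_prod_beta)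
  have "ennreal (norm (drift J \<nu> \<Phi> z - drift J \<nu> \<Psi> z')) = ennreal (norm (\<integral>w. ?j w \<partial>\<nu>))"
    unfolding drift_def using int[OF \<Phi>] int[OF \<Psi>] by (simp only: Bochner_Integration.integral_diff)
  also have "\<dots> \<le> (\<integral>\<^sup>+ w. ennreal (norm (?j w)) \<partial>\<nu>)"
    using int[OF \<Phi>] int[OF \<Psi>] by (intro integral_norm_bound_ennreal) simp
  also have "\<dots> \<le> (\<integral>\<^sup>+ w. ennreal (?\<delta> * (near_kernel (z - \<Phi> w) + near_kernel (z' - \<Psi> w))
      + (layer_kernel ?\<delta> (z - \<Phi> w) + layer_kernel ?\<delta> (z' - \<Psi> w))) \<partial>\<nu>)"
    by (intro nn_integral_mono ennreal_leI pt)
  also have "\<dots> = (\<integral>\<^sup>+ w. ennreal ?\<delta> * (ennreal (near_kernel (z - \<Phi> w)) + ennreal (near_kernel (z' - \<Psi> w)))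
      + (ennreal (layer_kernel ?\<delta> (z - \<Phi> w)) + ennreal (layer_kernel ?\<delta> (z' - \<Psi> w))) \<partial>\<nu>)"
  proof (intro nn_integral_cong)
    have "ennreal (a * (b + c) + (e + f)) = ennreal a * (ennreal b + ennreal c) + (ennreal e + ennreal f)"
      if "0 \<le> a" "0 \<le> b" "0 \<le> c" "0 \<le> e" "0 \<le> f" for a b c e f
      using that by (simp add: ennreal_mult)
    then show "ennreal (?\<delta> * (near_kernel (z - \<Phi> w) + near_kernel (z' - \<Psi> w))
        + (layer_kernel ?\<delta> (z - \<Phi> w) + layer_kernel ?\<delta> (z' - \<Psi> w)))
      = ennreal ?\<delta> * (ennreal (near_kernel (z - \<Phi> w)) + ennreal (near_kernel (z' - \<Psi> w)))
        + (ennreal (layer_kernel ?\<delta> (z - \<Phi> w)) + ennreal (layer_kernel ?\<delta> (z' - \<Psi> w)))" for w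
      using nn \<delta> by blast
  qed
  also have "\<dots> = ennreal ?\<delta> * ((\<integral>\<^sup>+ w. ennreal (near_kernel (z - \<Phi> w)) \<partial>\<nu>) + (\<integral>\<^sup>+ w. ennreal (near_kernel (z' - \<Psi> w)) \<partial>\<nu>))
      + ((\<integral>\<^sup>+ w. ennreal (layer_kernel ?\<delta> (z - \<Phi> w)) \<partial>\<nu>) + (\<integral>\<^sup>+ w. ennreal (layer_kernel ?\<delta> (z' - \<Psi> w)) \<partial>\<nu>))"
    by (simp add: nn_integral_add nn_integral_cmult)
  also have "\<dots> \<le> ennreal ?\<delta> * (ennreal (1 / 4 * ?W) + ennreal (1 / 4 * ?W)) + (ennreal (2 * ?\<delta> * ?W) + ennreal (2 * ?\<delta> * ?W))"
    by (intro add_mono mult_left_mono near layer \<Phi> \<Psi>) auto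
  also have "\<dots> = ennreal (?\<delta> * (1 / 4 * ?W + 1 / 4 * ?W) + (2 * ?\<delta> * ?W + 2 * ?\<delta> * ?W))"
  proof -
    have "ennreal a * (ennreal (1 / 4 * b) + ennreal (1 / 4 * b)) + (ennreal (2 * a * b) + ennreal (2 * a * b))
      = ennreal (a * (1 / 4 * b + 1 / 4 * b) + (2 * a * b + 2 * a * b))" if "0 \<le> a" "0 \<le> b" for a b
      using that by (simp add: ennreal_mult[symmetric] ennreal_plus[symmetric] del: ennreal_plus)
    from this[OF \<delta> W] show ?thesis .
  qed
  finally have "ennreal (norm (drift J \<nu> \<Phi> z - drift J \<nu> \<Psi> z'))
    \<le> ennreal (?\<delta> * (1 / 4 * ?W + 1 / 4 * ?W) + (2 * ?\<delta> * ?W + 2 * ?\<delta> * ?W))" .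
  moreover have "X \<le> 5 * (b * a)"
    if "ennreal X \<le> ennreal (a * (1 / 4 * b + 1 / 4 * b) + (2 * a * b + 2 * a * b))" "0 \<le> a" "0 \<le> b" for X a b
  proof -
    have "a * (1 / 4 * b + 1 / 4 * b) + (2 * a * b + 2 * a * b) = 9 / 2 * (a * b)" by (simp add: field_simps)
    moreover have "0 \<le> a * b" using that by simp
    ultimately show ?thesis using that(1) by (simp add: ennreal_le_iff mult.commute)
  qed
  ultimately have "norm (drift J \<nu> \<Phi> z - drift J \<nu> \<Psi> z') \<le> 5 * (?W * ?\<delta>)" using \<delta> W by blast
  then show ?thesis by (simp add: mult.assoc)
qed

lemma norm_velocity_diff_le:
  assumes \<Phi>: "admissible C \<Phi>" and \<Psi>: "admissible C \<Psi>" and d: "\<And>w. norm (\<Phi> w - \<Psi> w) \<le> d"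
  shows "norm (velocity \<nu> \<Phi> z - velocity \<nu> \<Psi> z') \<le> 10 * C * weight_mass \<gamma> * (norm (z - z') + d)"
proof -
  have "norm (velocity \<nu> \<Phi> z - velocity \<nu> \<Psi> z') \<le> norm (drift J \<nu> \<Phi> z - drift J \<nu> \<Psi> z')
     + norm (drift J \<nu> (\<lambda>w. prod.swap (\<Phi> w)) (prod.swap z) - drift J \<nu> (\<lambda>w. prod.swap (\<Psi> w)) (prod.swap z'))"
    by (simp add: velocity_def norm_Pair_le)
  also have "\<dots> \<le> 5 * C * weight_mass \<gamma> * (norm (z - z') + d) + 5 * C * weight_mass \<gamma> * (norm (prod.swap z - prod.swap z') + d)"
    by (intro add_mono norm_drift_J_diff_le admissible_swap assms) (simp add: d)
  finally show ?thesis by simp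
qed

lemma norm_drift_smooth_diff_le:
  assumes \<Phi>: "admissible C \<Phi>" and \<epsilon>: "0 < \<epsilon>"
  shows "norm (drift (smooth_J \<epsilon>) \<nu> \<Phi> z - drift J \<nu> \<Phi> z) \<le> sqrt \<epsilon> * (C * weight_mass \<gamma>)"
proof -
  have [measurable]: "\<Phi> \<in> borel_measurable borel" and C: "0 \<le> C"
    using \<Phi> by (auto simp: admissible_def)
  let ?j = "\<lambda>w. smooth_J \<epsilon> (fst (z - \<Phi> w)) (snd (z - \<Phi> w)) - J (fst (z - \<Phi> w)) (snd (z - \<Phi> w))"
  note int = integrable_subkernel[OF _ admissible_imp_spread[OF \<Phi>]]
  note ints = int[OF subkernel_J] int[OF subkernel_smooth_J[OF \<epsilon>]]
  have "ennreal (norm (drift (smooth_J \<epsilon>) \<nu> \<Phi> z - drift J \<nu> \<Phi> z)) = ennreal (norm (\<integral>w. ?j w \<partial>\<nu>))"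
    unfolding drift_def using ints by (simp only: Bochner_Integration.integral_diff)
  also have "\<dots> \<le> (\<integral>\<^sup>+ w. ennreal (norm (?j w)) \<partial>\<nu>)"
    using ints by (intro integral_norm_bound_ennreal) simp
  also have "\<dots> \<le> (\<integral>\<^sup>+ w. ennreal (mollify_kernel \<epsilon> (z - \<Phi> w)) \<partial>\<nu>)"
    using norm_smooth_J_diff_le[OF \<epsilon>] by (intro nn_integral_mono ennreal_leI) (metis prod.collapse)
  also have "\<dots> \<le> ennreal (sqrt \<epsilon> * (C * weight_mass \<gamma>))"
    by (rule nn_integral_kernel_le[OF \<Phi> _ nn_integral_mollify_kernel[OF \<epsilon>]]) (use \<epsilon> in auto)
  finally show ?thesis
    using \<epsilon> C weight_mass_nonneg by (subst (asm) ennreal_le_iff) auto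
qed

end

section \<open>The splitting scheme\<close>

text \<open>The completed steps plus the fraction of the current one form the time integral of a
  step function. In this form the scheme solves an approximate integral equation, and schemes with
  different meshes can be compared.\<close>

lemma has_integral_step:
  fixes c :: "nat \<Rightarrow> 'a::euclidean_space"
  assumes h: "0 < h" and t: "0 \<le> t"
  shows "((\<lambda>s. c (nat \<lfloor>s / h\<rfloor>)) has_integral
    ((\<Sum>i<nat \<lfloor>t / h\<rfloor>. h *\<^sub>R c i) + (t - real (nat \<lfloor>t / h\<rfloor>) * h) *\<^sub>R c (nat \<lfloor>t / h\<rfloor>))) {0..t}"
proof -
  have piece: "((\<lambda>s. c (nat \<lfloor>s / h\<rfloor>)) has_integral ((b - real k * h) *\<^sub>R c k)) {real k * h..b}"
    if "real k * h \<le> b" "b \<le> real (Suc k) * h" for k b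
  proof -
    have "((\<lambda>s. c k) has_integral ((b - real k * h) *\<^sub>R c k)) {real k * h..b}"
      using has_integral_const_real[of "c k" "real k * h" b] that by simp
    then show ?thesis
    proof (rule has_integral_spike_finite[of "{b}", rotated 2])
      \<comment> \<open>At the right end of a full piece the floor already has its next value, so
        this single point is left out.\<close>
      fix s assume s: "s \<in> {real k * h..b} - {b}"
      then have "s < real (Suc k) * h" using that by auto
      then have "real k \<le> s / h" "s / h < real k + 1" using s h by (auto simp: field_simps)
      then have "\<lfloor>s / h\<rfloor> = int k" by (simp add: floor_eq_iff)
      then show "c (nat \<lfloor>s / h\<rfloor>) = c k" by simp
    qed auto
  qed
  have whole: "((\<lambda>s. c (nat \<lfloor>s / h\<rfloor>)) has_integral (\<Sum>i<k. h *\<^sub>R c i)) {0..real k * h}" for k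
  proof (induction k)
    case (Suc k)
    have "((\<lambda>s. c (nat \<lfloor>s / h\<rfloor>)) has_integral (\<Sum>i<k. h *\<^sub>R c i) + (real (Suc k) * h - real k * h) *\<^sub>R c k) {0..real (Suc k) * h}"
      by (rule has_integral_combine[OF _ _ Suc.IH piece]) (use h in \<open>auto simp: algebra_simps\<close>)
    then show ?case by (simp add: algebra_simps)
  qed auto
  let ?k = "nat \<lfloor>t / h\<rfloor>"
  have "real ?k \<le> t / h" "t / h \<le> real (Suc ?k)" using t h by (auto simp: of_nat_nat) linarith
  then have k: "real ?k * h \<le> t" "t \<le> real (Suc ?k) * h" using h by (auto simp: field_simps)
  show ?thesis
    by (rule has_integral_combine[OF _ k(1) whole piece[OF k]]) (use h in auto)
qed

section \<open>Distortion and displacement along the scheme\<close>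

context initial_density
begin

lemma borel_measurable_drift:
  assumes j: "(\<lambda>z. j (fst z) (snd z)) \<in> borel_measurable borel" and [measurable]: "\<Phi> \<in> borel_measurable borel"
  shows "drift j \<nu> \<Phi> \<in> borel_measurable borel"
proof -
  have "(\<lambda>(z, w). z - \<Phi> w) \<in> borel_measurable (borel \<Otimes>\<^sub>M \<nu>)" by measurable
  from measurable_compose[OF this j]
  have "(\<lambda>(z, w). j (fst (z - \<Phi> w)) (snd (z - \<Phi> w))) \<in> borel_measurable (borel \<Otimes>\<^sub>M \<nu>)"
    by (simp add: case_prod_beta')
  then show ?thesis
    unfolding drift_def[abs_def] by (rule \<nu>.borel_measurable_lebesgue_integral)
qed

lemma borel_measurable_drift_smooth:
  assumes "\<Phi> \<in> borel_measurable borel"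
  shows "drift (smooth_J \<epsilon>) \<nu> \<Phi> \<in> borel_measurable borel"
  by (rule borel_measurable_drift[OF _ assms]) measurable

lemma integrable_smooth_J':
  assumes \<epsilon>: "0 < \<epsilon>" and [measurable]: "\<Phi> \<in> borel_measurable borel"
  shows "integrable \<nu> (\<lambda>w. smooth_J' \<epsilon> (x - fst (\<Phi> w)) (v - snd (\<Phi> w)) \<xi>)"
  by (rule \<nu>.integrable_const_bound[where B = "2 / \<epsilon> * norm \<xi>"])
     (rule AE_I2, rule norm_smooth_J'_le[OF \<epsilon>], measurable)

lemma has_derivative_drift_smooth:
  assumes \<epsilon>: "0 < \<epsilon>" and [measurable]: "\<Phi> \<in> borel_measurable borel"
  shows "((\<lambda>x. drift (smooth_J \<epsilon>) \<nu> \<Phi> (x, v)) has_derivative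
    (\<lambda>\<xi>. \<integral>w. smooth_J' \<epsilon> (x - fst (\<Phi> w)) (v - snd (\<Phi> w)) \<xi> \<partial>\<nu>)) (at x)"
proof -
  have "((\<lambda>x. \<integral>w. smooth_J \<epsilon> (x - fst (\<Phi> w)) (v - snd (\<Phi> w)) \<partial>\<nu>) has_derivative
    (\<lambda>\<xi>. \<integral>w. smooth_J' \<epsilon> (x - fst (\<Phi> w)) (v - snd (\<Phi> w)) \<xi> \<partial>\<nu>)) (at x)"
  proof (rule has_derivative_integral[where B = "2 / \<epsilon>"])
    show "finite_measure \<nu>" by (rule \<nu>.finite_measure_axioms)
    fix y w
    have "((\<lambda>y. y - fst (\<Phi> w)) has_derivative (\<lambda>\<xi>. \<xi>)) (at y)"
      by (auto intro!: derivative_eq_intros)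
    from has_derivative_compose[OF this has_derivative_smooth_J[OF \<epsilon>]]
    show "((\<lambda>y. smooth_J \<epsilon> (y - fst (\<Phi> w)) (v - snd (\<Phi> w))) has_derivative
      smooth_J' \<epsilon> (y - fst (\<Phi> w)) (v - snd (\<Phi> w))) (at y)" by simp
    show "norm (smooth_J' \<epsilon> (y - fst (\<Phi> w)) (v - snd (\<Phi> w)) \<xi>) \<le> 2 / \<epsilon> * norm \<xi>" for \<xi>
      by (rule norm_smooth_J'_le[OF \<epsilon>])
    show "integrable \<nu> (\<lambda>w. smooth_J \<epsilon> (y - fst (\<Phi> w)) (v - snd (\<Phi> w)))"
      by (rule \<nu>.integrable_const_bound[where B = "1 / sqrt \<epsilon>"])
         (auto intro!: norm_smooth_J_le(2) \<epsilon>)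
  qed measurable
  then show ?thesis by (simp add: drift_def)
qed

text \<open>The derivative of the shift is h times an average over \<nu> of trace-free maps of norm
  at most 2 / \<epsilon>, hence itself trace-free and of norm at most
  \<open>h * (2 / \<epsilon>)\<close>.\<close>

lemma quasi_preserving_kick:
  assumes \<epsilon>: "0 < \<epsilon>" and \<Phi> [measurable]: "\<Phi> \<in> borel_measurable borel" and h: "0 \<le> h" "h * (2 / \<epsilon>) \<le> 1 / 2"
  shows "quasi_preserving (1 + 4 * (h * (2 / \<epsilon>))\<^sup>2) (kick \<nu> \<epsilon> h \<Phi>)"
proof -
  note [measurable] = borel_measurable_drift_smooth[OF \<Phi>, of \<epsilon>]
  define W' where "W' x v \<xi> = h *\<^sub>R (\<integral>w. smooth_J' \<epsilon> (x - fst (\<Phi> w)) (v - snd (\<Phi> w)) \<xi> \<partial>\<nu>)" for x v \<xi>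
  have "quasi_preserving (1 + 4 * (h * (2 / \<epsilon>))\<^sup>2)
     (\<lambda>z. (fst z + h *\<^sub>R drift (smooth_J \<epsilon>) \<nu> \<Phi> (fst z, snd z), snd z))"
  proof (rule quasi_preserving_fst_shift[where W' = W'])
    show "(\<lambda>z. h *\<^sub>R drift (smooth_J \<epsilon>) \<nu> \<Phi> (fst z, snd z)) \<in> borel_measurable borel" by simp
    show "((\<lambda>x. h *\<^sub>R drift (smooth_J \<epsilon>) \<nu> \<Phi> (x, v)) has_derivative W' x v) (at x)" for x v
      unfolding W'_def[abs_def] by (intro has_derivative_scaleR_right has_derivative_drift_smooth \<epsilon> \<Phi>)
    fix x v
    show "norm (W' x v \<xi>) \<le> h * (2 / \<epsilon>) * norm \<xi>" for \<xi>
    proof -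
      have "norm (\<integral>w. smooth_J' \<epsilon> (x - fst (\<Phi> w)) (v - snd (\<Phi> w)) \<xi> \<partial>\<nu>)
        \<le> (\<integral>w. norm (smooth_J' \<epsilon> (x - fst (\<Phi> w)) (v - snd (\<Phi> w)) \<xi>) \<partial>\<nu>)"
        by (rule integral_norm_bound)
      also have "\<dots> \<le> (\<integral>w. 2 / \<epsilon> * norm \<xi> \<partial>\<nu>)"
        by (intro integral_mono integrable_norm integrable_smooth_J' \<epsilon> \<Phi> norm_smooth_J'_le) simp
      also have "\<dots> = 2 / \<epsilon> * norm \<xi>" by (simp add: \<nu>.prob_space[simplified])
      finally have "h * norm (\<integral>w. smooth_J' \<epsilon> (x - fst (\<Phi> w)) (v - snd (\<Phi> w)) \<xi> \<partial>\<nu>) \<le> h * (2 / \<epsilon> * norm \<xi>)"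
        using h(1) by (rule mult_left_mono)
      moreover have "norm (W' x v \<xi>) = h * norm (\<integral>w. smooth_J' \<epsilon> (x - fst (\<Phi> w)) (v - snd (\<Phi> w)) \<xi> \<partial>\<nu>)"
        using h(1) by (simp add: W'_def)
      ultimately show ?thesis by (simp only: mult.assoc)
    qed
    have comp: "W' x v \<xi> $ i = h * (\<integral>w. smooth_J' \<epsilon> (x - fst (\<Phi> w)) (v - snd (\<Phi> w)) \<xi> $ i \<partial>\<nu>)" for \<xi> i
    proof -
      have "(\<integral>w. smooth_J' \<epsilon> (x - fst (\<Phi> w)) (v - snd (\<Phi> w)) \<xi> $ i \<partial>\<nu>)
        = (\<integral>w. smooth_J' \<epsilon> (x - fst (\<Phi> w)) (v - snd (\<Phi> w)) \<xi> \<partial>\<nu>) $ i"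
        by (rule integral_bounded_linear[OF bounded_linear_vec_nth integrable_smooth_J'[OF \<epsilon> \<Phi>]])
      then show ?thesis by (simp add: W'_def)
    qed
    have int: "integrable \<nu> (\<lambda>w. smooth_J' \<epsilon> (x - fst (\<Phi> w)) (v - snd (\<Phi> w)) \<xi> $ i)" for \<xi> i
      by (rule integrable_bounded_linear[OF bounded_linear_vec_nth integrable_smooth_J'[OF \<epsilon> \<Phi>]])
    show "W' x v (axis 1 1) $ 1 + W' x v (axis 2 1) $ 2 = 0"
      unfolding comp distrib_left[symmetric] Bochner_Integration.integral_add[OF int int, symmetric]
      by (simp add: trace_smooth_J')
  qed (use \<epsilon> h in auto)
  then show ?thesis by (simp add: kick_def[abs_def])
qed

lemma quasi_preserving_scheme:
  assumes \<epsilon>: "0 < \<epsilon>" and h: "0 \<le> h" "h * (2 / \<epsilon>) \<le> 1 / 2"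
  shows "quasi_preserving ((1 + 4 * (h * (2 / \<epsilon>))\<^sup>2) ^ (2 * k)) (scheme \<nu> \<epsilon> h k)"
proof (induction k)
  case 0
  then show ?case using quasi_preserving_id by (simp add: quasi_preserving_def)
next
  case (Suc k)
  let ?\<kappa> = "1 + 4 * (h * (2 / \<epsilon>))\<^sup>2"
  have \<kappa>: "0 \<le> ?\<kappa>" by simp
  have m [measurable]: "scheme \<nu> \<epsilon> h k \<in> borel_measurable borel" by (rule quasi_preservingD(1)[OF Suc.IH])
  have ms: "(\<lambda>w. prod.swap (scheme \<nu> \<epsilon> h k w)) \<in> borel_measurable borel" by measurable
  note 1 = quasi_preserving_compose[OF Suc.IH quasi_preserving_kick[OF \<epsilon> m h] zero_le_power[OF \<kappa>] \<kappa>]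
  note 2 = quasi_preserving_compose[OF 1 quasi_preserving_swap mult_nonneg_nonneg[OF zero_le_power[OF \<kappa>] \<kappa>] zero_le_one, unfolded mult_1_right]
  note 3 = quasi_preserving_compose[OF 2 quasi_preserving_kick[OF \<epsilon> ms h] mult_nonneg_nonneg[OF zero_le_power[OF \<kappa>] \<kappa>] \<kappa>]
  note 4 = quasi_preserving_compose[OF 3 quasi_preserving_swap mult_nonneg_nonneg[OF mult_nonneg_nonneg[OF zero_le_power[OF \<kappa>] \<kappa>] \<kappa>] zero_le_one, unfolded mult_1_right]
  have e: "?\<kappa> ^ (2 * k) * ?\<kappa> * ?\<kappa> = ?\<kappa> ^ (2 * Suc k)" by simp
  show ?case using 4 unfolding e by (simp add: fun_eq_iff)
qed

lemma quasi_preserving_imp_spread: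
  assumes \<Phi>: "quasi_preserving \<kappa> \<Phi>" and \<kappa>: "0 \<le> \<kappa>"
  shows "spread (\<kappa> * M) \<Phi>"
  unfolding spread_def
proof (intro conjI ballI)
  show m [measurable]: "\<Phi> \<in> borel_measurable borel" by (rule quasi_preservingD(1)[OF \<Phi>])
  show "0 \<le> \<kappa> * M" using \<kappa> M_nonneg by simp
  fix u :: "R4 \<Rightarrow> ennreal" assume u [measurable]: "u \<in> borel_measurable borel"
  have "(\<integral>\<^sup>+ w. u (\<Phi> w) \<partial>\<nu>) = (\<integral>\<^sup>+ w. ennreal (f0 w) * u (\<Phi> w) \<partial>lborel)"
    by (rule nn_integral_\<nu>) measurable
  also have "\<dots> \<le> (\<integral>\<^sup>+ w. ennreal M * u (\<Phi> w) \<partial>lborel)"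
    by (intro nn_integral_mono mult_right_mono ennreal_leI f0_le_M) auto
  also have "\<dots> = ennreal M * (\<integral>\<^sup>+ w. u (\<Phi> w) \<partial>lborel)"
    by (rule nn_integral_cmult) measurable
  also have "\<dots> \<le> ennreal M * (ennreal \<kappa> * (\<integral>\<^sup>+ w. u w \<partial>lborel))"
    by (intro mult_left_mono quasi_preservingD(2)[OF \<Phi> u]) auto
  finally show "(\<integral>\<^sup>+ w. u (\<Phi> w) \<partial>\<nu>) \<le> ennreal (\<kappa> * M) * (\<integral>\<^sup>+ \<zeta>. u \<zeta> \<partial>lborel)"
    using \<kappa> M_nonneg by (simp add: ennreal_mult ac_simps)
qed

text \<open>Bounded displacement moves the weights from the starting point w to
  \<open>\<Phi> w\<close>. After that the integrand is a function of \<open>\<Phi> w\<close> alone,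
  and the variables can be changed with the factor \<kappa>.\<close>

lemma quasi_preserving_imp_admissible:
  assumes \<Phi>: "quasi_preserving \<kappa> \<Phi>" and \<kappa>: "0 \<le> \<kappa>"
    and R: "\<And>w. norm (fst (\<Phi> w) - fst w) \<le> R" "\<And>w. norm (snd (\<Phi> w) - snd w) \<le> R"
  shows "admissible (\<kappa> * (N * ((1 + R) powr \<gamma> * (1 + R) powr \<gamma>))) \<Phi>"
  unfolding admissible_def
proof (intro conjI ballI)
  show m [measurable]: "\<Phi> \<in> borel_measurable borel" by (rule quasi_preservingD(1)[OF \<Phi>])
  let ?C = "N * ((1 + R) powr \<gamma> * (1 + R) powr \<gamma>)" and ?w = "\<lambda>\<zeta>::R4. weight \<gamma> (fst \<zeta>) * weight \<gamma> (snd \<zeta>)"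
  have C: "0 \<le> ?C" using N_nonneg by simp
  show "0 \<le> \<kappa> * ?C" using \<kappa> C by simp
  fix u :: "R4 \<Rightarrow> ennreal" assume u [measurable]: "u \<in> borel_measurable borel"
  have le: "f0 w \<le> ?C * ?w (\<Phi> w)" for w
  proof -
    note ws = weight_shift[OF R(1)[of w, unfolded norm_minus_commute[of "fst (\<Phi> w)"]], of \<gamma>]
      weight_shift[OF R(2)[of w, unfolded norm_minus_commute[of "snd (\<Phi> w)"]], of \<gamma>]
    have "f0 w \<le> N * (weight \<gamma> (fst w) * weight \<gamma> (snd w))" by (rule f0_le_N)
    also have "\<dots> \<le> N * (((1 + R) powr \<gamma> * weight \<gamma> (fst (\<Phi> w))) * ((1 + R) powr \<gamma> * weight \<gamma> (snd (\<Phi> w))))"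
      using N_nonneg ws gamma weight_pos[of \<gamma>, THEN less_imp_le]
      by (intro mult_left_mono mult_mono) auto
    finally show ?thesis by (simp add: ac_simps)
  qed
  have "(\<integral>\<^sup>+ w. u (\<Phi> w) \<partial>\<nu>) = (\<integral>\<^sup>+ w. ennreal (f0 w) * u (\<Phi> w) \<partial>lborel)"
    by (rule nn_integral_\<nu>) measurable
  also have "\<dots> \<le> (\<integral>\<^sup>+ w. u (\<Phi> w) * ennreal (?C * ?w (\<Phi> w)) \<partial>lborel)"
    by (subst mult.commute) (intro nn_integral_mono mult_left_mono ennreal_leI le, simp)
  also have "\<dots> \<le> ennreal \<kappa> * (\<integral>\<^sup>+ w. u w * ennreal (?C * ?w w) \<partial>lborel)"
    by (rule quasi_preservingD(2)[OF \<Phi>, of "\<lambda>w. u w * ennreal (?C * ?w w)"]) measurable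
  also have "\<dots> = (\<integral>\<^sup>+ w. ennreal \<kappa> * (u w * ennreal (?C * ?w w)) \<partial>lborel)"
    by (rule nn_integral_cmult[symmetric]) measurable
  also have "\<dots> = (\<integral>\<^sup>+ w. u w * ennreal (\<kappa> * ?C * ?w w) \<partial>lborel)"
  proof (intro nn_integral_cong)
    have "ennreal (\<kappa> * ?C * ?w w) = ennreal \<kappa> * ennreal (?C * ?w w)" for w
      unfolding mult.assoc[of \<kappa>] by (rule ennreal_mult'[OF \<kappa>])
    then show "ennreal \<kappa> * (u w * ennreal (?C * ?w w)) = u w * ennreal (\<kappa> * ?C * ?w w)" for w
      by (simp only: mult.left_commute)
  qed
  finally show "(\<integral>\<^sup>+ w. u (\<Phi> w) \<partial>\<nu>) \<le> (\<integral>\<^sup>+ w. u w * ennreal (\<kappa> * ?C * ?w w) \<partial>lborel)" .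
qed

text \<open>The bound of \<open>norm_drift_le\<close> at R = 1 with density bound 2 M, where the 2
  leaves room for the volume distortion of the approximations. It is a rough a priori constant; for
  the limit flow the sharper \<open>max_speed\<close> is available.\<close>

definition speed :: real where
  "speed = 1 / (2 * pi) + 2 * M * (pi / 3)"

lemma speed_pos: "0 < speed"
  using M_nonneg by (simp add: speed_def add_pos_nonneg)

lemma norm_drift_le_speed:
  assumes "subkernel j" "spread (2 * M) \<Phi>"
  shows "norm (drift j \<nu> \<Phi> z) \<le> speed"
  using norm_drift_le[OF assms, of 1] by (simp add: speed_def)

lemma norm_velocity_le:
  assumes "spread (2 * M) \<Phi>"
  shows "norm (velocity \<nu> \<Phi> z) \<le> 2 * speed"
proof -
  have "norm (velocity \<nu> \<Phi> z) \<le> norm (drift J \<nu> \<Phi> z) + norm (drift J \<nu> (\<lambda>w. prod.swap (\<Phi> w)) (prod.swap z))"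
    by (simp add: velocity_def norm_Pair_le)
  also have "\<dots> \<le> speed + speed"
    by (intro add_mono norm_drift_le_speed subkernel_J spread_swap assms)
  finally show ?thesis by simp
qed

text \<open>Weighted density bound up to time T: the displacement \<open>T * speed\<close> costs a
  power \<gamma> for each of the two components, and the 2 accounts for volume distortion.\<close>

definition adm :: "real \<Rightarrow> real" where
  "adm T = 2 * (N * ((1 + T * speed) powr \<gamma> * (1 + T * speed) powr \<gamma>))"

definition lip :: "real \<Rightarrow> real" where
  "lip T = 10 * adm T * weight_mass \<gamma>"

lemma adm_nonneg: "0 \<le> adm T"
  using N_nonneg by (simp add: adm_def)

lemma lip_nonneg: "0 \<le> lip T"
  using adm_nonneg weight_mass_nonneg by (simp add: lip_def)

context
  fixes \<epsilon> h T :: real and n :: nat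
  assumes \<epsilon>: "0 < \<epsilon>" and h: "0 < h" "h * (2 / \<epsilon>) \<le> 1 / 2" and T: "real n * h \<le> T"
    and \<kappa>: "(1 + 4 * (h * (2 / \<epsilon>))\<^sup>2) ^ (2 * n) \<le> 2"
begin

lemma quasi_preserving_scheme_2:
  assumes "k \<le> n"
  shows "quasi_preserving 2 (scheme \<nu> \<epsilon> h k)"
proof (rule quasi_preserving_mono[OF quasi_preserving_scheme[OF \<epsilon> less_imp_le[OF h(1)] h(2)]])
  have "(1 + 4 * (h * (2 / \<epsilon>))\<^sup>2) ^ (2 * k) \<le> (1 + 4 * (h * (2 / \<epsilon>))\<^sup>2) ^ (2 * n)"
    using assms by (intro power_increasing) auto
  then show "(1 + 4 * (h * (2 / \<epsilon>))\<^sup>2) ^ (2 * k) \<le> 2" using \<kappa> by linarith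
qed

lemma spread_scheme: "k \<le> n \<Longrightarrow> spread (2 * M) (scheme \<nu> \<epsilon> h k)"
  by (rule quasi_preserving_imp_spread[OF quasi_preserving_scheme_2]) auto

text \<open>The drift is bounded through \<open>spread\<close>, which rests on volume distortion
  alone. Weighted bounds stay out of the induction, so admissibility can be deduced from the
  displacement afterwards without a circle.\<close>

lemma scheme_displacement:
  assumes "k \<le> n"
  shows "norm (fst (scheme \<nu> \<epsilon> h k w) - fst w) \<le> real k * h * speed \<and>
    norm (snd (scheme \<nu> \<epsilon> h k w) - snd w) \<le> real k * h * speed"
  using assms
proof (induction k)
  case (Suc k)
  let ?\<Phi> = "scheme \<nu> \<epsilon> h k"
  have s: "spread (2 * M) ?\<Phi>" using Suc.prems by (intro spread_scheme) auto
  have step: "norm (a + h *\<^sub>R drift (smooth_J \<epsilon>) \<nu> \<Psi> z - b) \<le> real (Suc k) * h * speed"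
    if "norm (a - b) \<le> real k * h * speed" "spread (2 * M) \<Psi>" for a b \<Psi> z
  proof -
    have "norm (a + h *\<^sub>R drift (smooth_J \<epsilon>) \<nu> \<Psi> z - b) \<le> norm (a - b) + norm (h *\<^sub>R drift (smooth_J \<epsilon>) \<nu> \<Psi> z)"
      using norm_triangle_ineq[of "a - b" "h *\<^sub>R drift (smooth_J \<epsilon>) \<nu> \<Psi> z"] by (simp add: algebra_simps)
    also have "\<dots> \<le> real k * h * speed + h * speed"
      using that h norm_drift_le_speed[OF subkernel_smooth_J[OF \<epsilon>] that(2), of z] by (intro add_mono) auto
    finally show ?thesis by (simp add: algebra_simps)
  qed
  show ?case
    using Suc step[OF _ s] step[OF _ spread_swap[OF s]] by (simp add: kick_def)
qed simp

lemma admissible_scheme: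
  assumes k: "k \<le> n"
  shows "admissible (adm T) (scheme \<nu> \<epsilon> h k)"
  unfolding adm_def
proof (rule quasi_preserving_imp_admissible[OF quasi_preserving_scheme_2[OF k]])
  have "real k * h \<le> real n * h" using k h by (intro mult_right_mono) auto
  then have "real k * h * speed \<le> T * speed" using T speed_pos by (intro mult_right_mono) auto
  then show "norm (fst (scheme \<nu> \<epsilon> h k w) - fst w) \<le> T * speed" "norm (snd (scheme \<nu> \<epsilon> h k w) - snd w) \<le> T * speed" for w
    using scheme_displacement[OF k, of w] by linarith+
qed simp

text \<open>Consistency of one step: each kick uses the regularisation in place of \<open>J\<close>,
  at a cost of order sqrt \<epsilon>, and the velocity kick is evaluated at a point already moved by
  up to \<open>h * speed\<close>, which the Lipschitz bound absorbs.\<close>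

lemma scheme_step:
  assumes k: "k < n"
  shows "norm (scheme \<nu> \<epsilon> h (Suc k) w - scheme \<nu> \<epsilon> h k w - h *\<^sub>R velocity \<nu> (scheme \<nu> \<epsilon> h k) (scheme \<nu> \<epsilon> h k w))
    \<le> h * (lip T * (sqrt \<epsilon> + h * speed))"
proof -
  let ?\<Phi> = "scheme \<nu> \<epsilon> h k"
  let ?S = "\<lambda>w. prod.swap (?\<Phi> w)"
  define p where "p = ?\<Phi> w"
  define q where "q = kick \<nu> \<epsilon> h ?\<Phi> p"
  define a where "a = adm T * weight_mass \<gamma>"
  have a: "0 \<le> a" using adm_nonneg weight_mass_nonneg by (simp add: a_def)
  have adm: "admissible (adm T) ?\<Phi>" and s: "spread (2 * M) ?\<Phi>"
    using k by (auto intro: admissible_scheme spread_scheme)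
  have qp: "norm (q - p) \<le> h * speed"
    using norm_drift_le_speed[OF subkernel_smooth_J[OF \<epsilon>] s, of p] h
    by (simp add: q_def kick_def norm_prod_def)
  let ?e1 = "drift (smooth_J \<epsilon>) \<nu> ?\<Phi> p - drift J \<nu> ?\<Phi> p"
  let ?e2 = "drift (smooth_J \<epsilon>) \<nu> ?S (prod.swap q) - drift J \<nu> ?S (prod.swap q)"
  let ?e3 = "drift J \<nu> ?S (prod.swap q) - drift J \<nu> ?S (prod.swap p)"
  have e1: "norm ?e1 \<le> sqrt \<epsilon> * a" "norm ?e2 \<le> sqrt \<epsilon> * a"
    unfolding a_def by (intro norm_drift_smooth_diff_le admissible_swap adm \<epsilon>)+
  have "norm ?e3 \<le> 5 * adm T * weight_mass \<gamma> * (norm (prod.swap q - prod.swap p) + 0)"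
    by (intro norm_drift_J_diff_le admissible_swap adm) simp
  also have "\<dots> \<le> 5 * adm T * weight_mass \<gamma> * (h * speed)"
    using qp adm_nonneg weight_mass_nonneg by (intro mult_left_mono) auto
  finally have e3: "norm ?e3 \<le> 5 * a * (h * speed)" by (simp add: a_def mult.assoc)
  have "scheme \<nu> \<epsilon> h (Suc k) w - p - h *\<^sub>R velocity \<nu> ?\<Phi> p = (h *\<^sub>R ?e1, h *\<^sub>R (?e2 + ?e3))"
    by (simp add: p_def[symmetric] q_def[symmetric])
       (simp add: q_def kick_def velocity_def prod_eq_iff algebra_simps)
  then have "norm (scheme \<nu> \<epsilon> h (Suc k) w - p - h *\<^sub>R velocity \<nu> ?\<Phi> p) \<le> norm (h *\<^sub>R ?e1) + norm (h *\<^sub>R (?e2 + ?e3))"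
    by (simp only: norm_Pair_le)
  also have "\<dots> = h * (norm ?e1 + norm (?e2 + ?e3))" using h by (simp add: distrib_left)
  also have "\<dots> \<le> h * (sqrt \<epsilon> * a + (sqrt \<epsilon> * a + 5 * a * (h * speed)))"
    using h norm_triangle_ineq[of ?e2 ?e3] e1 e3 by (intro mult_left_mono add_mono) auto
  also have "\<dots> \<le> h * (10 * a * (sqrt \<epsilon> + h * speed))"
  proof (intro mult_left_mono)
    have "0 \<le> a * sqrt \<epsilon>" "0 \<le> a * (h * speed)" using a h speed_pos \<epsilon> by simp_all
    then show "sqrt \<epsilon> * a + (sqrt \<epsilon> * a + 5 * a * (h * speed)) \<le> 10 * a * (sqrt \<epsilon> + h * speed)"
      by (simp add: algebra_simps)
  qed (use h in simp)
  finally show ?thesis by (simp add: p_def lip_def a_def mult.assoc)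
qed

lemma scheme_sum:
  assumes "k \<le> n"
  shows "norm (scheme \<nu> \<epsilon> h k w - w - (\<Sum>i<k. h *\<^sub>R velocity \<nu> (scheme \<nu> \<epsilon> h i) (scheme \<nu> \<epsilon> h i w)))
    \<le> real k * h * (lip T * (sqrt \<epsilon> + h * speed))"
  using assms
proof (induction k)
  case (Suc k)
  let ?v = "\<lambda>i. h *\<^sub>R velocity \<nu> (scheme \<nu> \<epsilon> h i) (scheme \<nu> \<epsilon> h i w)"
  have "norm (scheme \<nu> \<epsilon> h (Suc k) w - w - (\<Sum>i<Suc k. ?v i))
     \<le> norm (scheme \<nu> \<epsilon> h (Suc k) w - scheme \<nu> \<epsilon> h k w - ?v k) + norm (scheme \<nu> \<epsilon> h k w - w - (\<Sum>i<k. ?v i))"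
    using norm_triangle_ineq[of "scheme \<nu> \<epsilon> h (Suc k) w - scheme \<nu> \<epsilon> h k w - ?v k" "scheme \<nu> \<epsilon> h k w - w - (\<Sum>i<k. ?v i)"]
    by (simp add: algebra_simps del: scheme.simps)
  also have "\<dots> \<le> h * (lip T * (sqrt \<epsilon> + h * speed)) + real k * h * (lip T * (sqrt \<epsilon> + h * speed))"
    using Suc by (intro add_mono scheme_step) auto
  finally show ?case by (simp add: algebra_simps del: scheme.simps)
qed simp

end

end

section \<open>Convergence to a measure-preserving flow\<close>

text \<open>A substitute for Gronwall's inequality that needs no measurability of \<open>u\<close>: the weight \<open>e\<close>
  will be an exponential for which the Picard map is a contraction by the factor 1/2.\<close>
lemma weighted_contraction_bound:
  fixes u e :: "'i \<Rightarrow> real"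
  assumes e: "\<And>i. i \<in> S \<Longrightarrow> 0 < e i" and B: "\<And>i. i \<in> S \<Longrightarrow> u i \<le> B * e i" and \<delta>: "0 \<le> \<delta>"
    and step: "\<And>a. 0 \<le> a \<Longrightarrow> (\<And>i. i \<in> S \<Longrightarrow> u i \<le> a * e i) \<Longrightarrow> (\<And>i. i \<in> S \<Longrightarrow> u i \<le> (\<delta> + a / 2) * e i)"
    and i: "i \<in> S"
  shows "u i \<le> 2 * \<delta> * e i"
proof -
  define B' where "B' = max 0 B"
  have iter: "\<forall>j\<in>S. u j \<le> (2 * \<delta> + B' / 2 ^ n) * e j" for n
  proof (induction n)
    case 0
    have "B * e j \<le> (2 * \<delta> + B') * e j" if "j \<in> S" for j
      using e[OF that] \<delta> by (intro mult_right_mono) (auto simp: B'_def)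
    with B show ?case by (force intro: order_trans)
  next
    case (Suc n)
    have "u j \<le> (\<delta> + (2 * \<delta> + B' / 2 ^ n) / 2) * e j" if "j \<in> S" for j
      by (rule step[OF _ _ that]) (use \<delta> Suc in \<open>auto simp: B'_def\<close>)
    then show ?case by (simp add: field_simps)
  qed
  have "(\<lambda>n. (2 * \<delta> + B' / 2 ^ n) * e i) \<longlonglongrightarrow> (2 * \<delta> + 0) * e i"
    by (intro tendsto_intros LIMSEQ_divide_realpow_zero) simp
  then have "u i \<le> (2 * \<delta> + 0) * e i"
    by (rule LIMSEQ_le_const) (use iter i in blast)
  then show ?thesis by simp
qed

text \<open>The rate 2 K is chosen so that K times the integral of the exponential returns the
  exponential with the factor 1/2, as \<open>weighted_contraction_bound\<close> demands.\<close>

lemma norm_integral_exp_le: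
  fixes f :: "real \<Rightarrow> 'a::euclidean_space"
  assumes f: "f integrable_on {0..t}" and t: "0 \<le> t"
    and le: "\<And>s. s \<in> {0..t} \<Longrightarrow> norm (f s) \<le> K * (a * exp (2 * K * s))"
  shows "norm (integral {0..t} f) \<le> a / 2 * exp (2 * K * t) - a / 2"
proof -
  have "((\<lambda>s. K * (a * exp (2 * K * s))) has_integral (a / 2 * exp (2 * K * t) - a / 2 * exp (2 * K * 0))) {0..t}"
    using t by (intro fundamental_theorem_of_calculus)
      (auto intro!: derivative_eq_intros simp: has_real_derivative_iff_has_vector_derivative[symmetric])
  then show ?thesis
    using integral_norm_bound_integral[OF f has_integral_integrable le] by (auto simp: has_integral_iff)
qed

text \<open>Lebesgue measure is determined by its values on open boxes. The frontier of a box is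
  compact and null, hence null for the image measure too, so open boxes can be exchanged for closed
  ones, which are compact.\<close>

lemma distr_eq_lborel_if_compact:
  fixes \<phi> :: "'a::euclidean_space \<Rightarrow> 'a"
  assumes [measurable]: "\<phi> \<in> borel_measurable borel"
    and eq: "\<And>C. compact C \<Longrightarrow> emeasure lborel (\<phi> -` C) = emeasure lborel C"
  shows "distr lborel borel \<phi> = lborel"
proof (rule lborel_eqI[symmetric])
  let ?D = "distr lborel borel \<phi>"
  have D: "emeasure ?D C = emeasure lborel C" if "compact C" for C
    using eq[OF that] borel_compact[OF that] by (subst emeasure_distr) auto
  fix l u :: 'a assume le: "\<And>b. b \<in> Basis \<Longrightarrow> l \<bullet> b \<le> u \<bullet> b"
  have "compact (cbox l u - box l u)"
    by (rule compact_diff) auto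
  from D[OF this] have "emeasure ?D (cbox l u - box l u) = 0"
    using le by (simp add: emeasure_Diff box_subset_cbox)
  then have null: "cbox l u - box l u \<in> null_sets ?D" by (simp add: null_sets_def)
  have "emeasure ?D (box l u) = emeasure ?D (box l u \<union> (cbox l u - box l u))"
    by (rule emeasure_Un_null_set[symmetric, OF _ null]) simp
  also have "box l u \<union> (cbox l u - box l u) = cbox l u" using box_subset_cbox[of l u] by auto
  finally show "emeasure ?D (box l u) = (\<Prod>b\<in>Basis. (u - l) \<bullet> b)"
    using D[OF compact_cbox[of l u]] le by simp
qed simp

lemma quasi_preserving_emeasure:
  assumes \<phi>: "quasi_preserving \<kappa> \<phi>" and S: "S \<in> sets borel"
  shows "emeasure lborel (\<phi> -` S) \<le> ennreal \<kappa> * emeasure lborel S"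
    and "emeasure lborel S \<le> ennreal \<kappa> * emeasure lborel (\<phi> -` S)"
proof -
  have ind: "(\<lambda>z. indicator S (\<phi> z)) = (indicator (\<phi> -` S) :: _ \<Rightarrow> ennreal)"
    by (auto split: split_indicator)
  have [measurable]: "\<phi> -` S \<in> sets borel"
    using measurable_sets[OF quasi_preservingD(1)[OF \<phi>] S] by simp
  show "emeasure lborel (\<phi> -` S) \<le> ennreal \<kappa> * emeasure lborel S"
    using quasi_preservingD(2)[OF \<phi>, of "indicator S"] S by (simp add: ind)
  show "emeasure lborel S \<le> ennreal \<kappa> * emeasure lborel (\<phi> -` S)"
    using quasi_preservingD(3)[OF \<phi>, of "indicator S"] S by (simp add: ind)
qed

text \<open>Uniform closeness puts the preimage of C under either map into the preimage, under the
  other, of a thickening of C. The thickenings are compact and shrink to C, so once m has gone to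
  infinity the thickness is sent to 0 by continuity from above.\<close>

lemma emeasure_vimage_compact_of_uniform_limit:
  fixes \<phi> :: "nat \<Rightarrow> 'a::euclidean_space \<Rightarrow> 'a"
  assumes qp: "\<forall>\<^sub>F m in sequentially. quasi_preserving (\<kappa> m) (\<phi> m)" and \<kappa>: "\<kappa> \<longlonglongrightarrow> 1"
    and lim: "uniform_limit UNIV \<phi> \<psi> sequentially"
    and \<psi> [measurable]: "\<psi> \<in> borel_measurable borel" and C: "compact C"
  shows "emeasure lborel (\<psi> -` C) = emeasure lborel C"
proof -
  define T where "T n = {x. infdist x C \<le> inverse (real (Suc n))}" for n
  have [measurable]: "C \<in> sets borel" using C by (rule borel_compact)
  show ?thesis
  proof (cases "C = {}")
    case False
    have cT: "compact (T n)" for n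
      unfolding T_def by (rule compact_infdist_le[OF False C]) simp
    have Tb [measurable]: "T n \<in> sets borel" for n by (rule borel_compact[OF cT])
    have vm [measurable]: "\<psi> -` B \<in> sets borel" if "B \<in> sets borel" for B
      using measurable_sets[OF \<psi> that] by simp
    have Tint: "(\<Inter>n. T n) = C"
    proof -
      have "x \<in> C" if "\<forall>n. infdist x C \<le> inverse (real (Suc n))" for x
      proof -
        have "infdist x C \<le> 0"
          by (rule LIMSEQ_le_const[OF LIMSEQ_inverse_real_of_nat]) (use that in auto)
        then show "x \<in> C"
          using in_closed_iff_infdist_zero[OF compact_imp_closed[OF C] False] infdist_nonneg[of x C] by simp
      qed
      then show ?thesis by (auto simp: T_def)
    qed
    have dec: "decseq T"
      unfolding decseq_def T_def by (auto intro: order_trans le_imp_inverse_le)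
    have finT: "emeasure lborel (T n) < \<infinity>" for n
      using emeasure_bounded_finite[OF compact_imp_bounded[OF cT]] by simp
    have near: "\<forall>\<^sub>F m in sequentially. \<phi> m -` C \<subseteq> \<psi> -` T n \<and> \<psi> -` C \<subseteq> \<phi> m -` T n" for n
    proof -
      have "\<forall>\<^sub>F m in sequentially. \<forall>x\<in>UNIV. dist (\<phi> m x) (\<psi> x) < inverse (real (Suc n))"
        by (rule uniform_limitD[OF lim]) simp
      then show ?thesis
      proof eventually_elim
        case (elim m)
        have "infdist y C \<le> inverse (real (Suc n))" if "x \<in> C" "dist x y < inverse (real (Suc n))" for x y
          using infdist_le[OF that(1), of y] that(2) by (simp add: dist_commute)
        with elim show ?case unfolding T_def by (auto simp: dist_commute)
      qed
    qed
    have le1: "emeasure lborel (\<psi> -` C) \<le> emeasure lborel (T n)" for n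
    proof -
      have "(\<lambda>m. ennreal (\<kappa> m) * emeasure lborel (T n)) \<longlonglongrightarrow> ennreal 1 * emeasure lborel (T n)"
        using finT[of n] by (intro tendsto_mult_ennreal tendsto_ennrealI \<kappa>) auto
      moreover have "\<forall>\<^sub>F m in sequentially. emeasure lborel (\<psi> -` C) \<le> ennreal (\<kappa> m) * emeasure lborel (T n)"
        using qp near[of n]
      proof eventually_elim
        case (elim m)
        have "\<phi> m -` T n \<in> sets borel"
          using measurable_sets[OF quasi_preservingD(1)[OF elim(1)], of "T n"] by simp
        then have "emeasure lborel (\<psi> -` C) \<le> emeasure lborel (\<phi> m -` T n)"
          using elim by (intro emeasure_mono) auto
        also have "\<dots> \<le> ennreal (\<kappa> m) * emeasure lborel (T n)"
          by (rule quasi_preserving_emeasure[OF elim(1)]) simp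
        finally show ?case .
      qed
      ultimately have "emeasure lborel (\<psi> -` C) \<le> ennreal 1 * emeasure lborel (T n)"
        by (intro tendsto_lowerbound[of _ _ sequentially]) auto
      then show ?thesis by simp
    qed
    \<comment> \<open>Continuity from above along the preimages under \<psi> requires finite
      measure. It is borrowed from a single \<open>\<phi> m\<close> within distance 1 of \<psi>, at
      the price of enlarging \<open>T n\<close> to its unit neighbourhood D.\<close>
    have fin1: "emeasure lborel (\<psi> -` T n) < \<infinity>" for n
    proof -
      have ne: "T n \<noteq> {}" using False Tint by blast
      define D where "D = {x. infdist x (T n) \<le> 1}"
      have cD: "compact D" unfolding D_def by (rule compact_infdist_le[OF ne cT]) simp
      have [measurable]: "D \<in> sets borel" by (rule borel_compact[OF cD])
      have "\<forall>\<^sub>F m in sequentially. \<forall>x\<in>UNIV. dist (\<phi> m x) (\<psi> x) < 1"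
        by (rule uniform_limitD[OF lim]) simp
      from eventually_happens'[OF _ eventually_conj[OF this qp]]
      obtain m where m: "\<And>x. dist (\<phi> m x) (\<psi> x) < 1" "quasi_preserving (\<kappa> m) (\<phi> m)" by auto
      have "\<psi> -` T n \<subseteq> \<phi> m -` D"
      proof
        fix x assume "x \<in> \<psi> -` T n"
        then show "x \<in> \<phi> m -` D"
          using infdist_le[of "\<psi> x" "T n" "\<phi> m x"] m(1)[of x] by (simp add: D_def)
      qed
      moreover have "\<phi> m -` D \<in> sets borel"
        using measurable_sets[OF quasi_preservingD(1)[OF m(2)], of D] by simp
      ultimately have "emeasure lborel (\<psi> -` T n) \<le> emeasure lborel (\<phi> m -` D)"
        by (intro emeasure_mono) auto
      also have "\<dots> \<le> ennreal (\<kappa> m) * emeasure lborel D"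
        by (rule quasi_preserving_emeasure[OF m(2)]) simp
      also have "\<dots> < \<infinity>"
        using emeasure_bounded_finite[OF compact_imp_bounded[OF cD]] by (simp add: ennreal_mult_less_top)
      finally show ?thesis .
    qed
    have le2: "emeasure lborel C \<le> emeasure lborel (\<psi> -` T n)" for n
    proof -
      have "(\<lambda>m. ennreal (\<kappa> m) * emeasure lborel (\<psi> -` T n)) \<longlonglongrightarrow> ennreal 1 * emeasure lborel (\<psi> -` T n)"
        using fin1[of n] by (intro tendsto_mult_ennreal tendsto_ennrealI \<kappa>) auto
      moreover have "\<forall>\<^sub>F m in sequentially. emeasure lborel C \<le> ennreal (\<kappa> m) * emeasure lborel (\<psi> -` T n)"
        using qp near[of n]
      proof eventually_elim
        case (elim m)
        have "emeasure lborel C \<le> ennreal (\<kappa> m) * emeasure lborel (\<phi> m -` C)"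
          by (rule quasi_preserving_emeasure[OF elim(1)]) simp
        also have "\<dots> \<le> ennreal (\<kappa> m) * emeasure lborel (\<psi> -` T n)"
          using elim by (intro mult_left_mono emeasure_mono) auto
        finally show ?case .
      qed
      ultimately have "emeasure lborel C \<le> ennreal 1 * emeasure lborel (\<psi> -` T n)"
        by (intro tendsto_lowerbound[of _ _ sequentially]) auto
      then show ?thesis by simp
    qed
    have lim1: "(\<lambda>n. emeasure lborel (T n)) \<longlonglongrightarrow> emeasure lborel C"
    proof -
      have "range T \<subseteq> sets lborel" using Tb by auto
      then show ?thesis using Lim_emeasure_decseq[of T lborel] dec finT by (simp add: Tint less_top)
    qed
    have "decseq (\<lambda>n. \<psi> -` T n)" using dec by (auto simp: decseq_def)
    then have lim2: "(\<lambda>n. emeasure lborel (\<psi> -` T n)) \<longlonglongrightarrow> emeasure lborel (\<psi> -` C)"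
    proof -
      assume "decseq (\<lambda>n. \<psi> -` T n)"
      moreover have "range (\<lambda>n. \<psi> -` T n) \<subseteq> sets lborel" using vm[OF Tb] by auto
      moreover have "(\<Inter>n. \<psi> -` T n) = \<psi> -` C" unfolding Tint[symmetric] by auto
      ultimately show ?thesis
        using Lim_emeasure_decseq[of "\<lambda>n. \<psi> -` T n" lborel] fin1 by (simp add: less_top)
    qed
    show ?thesis
    proof (rule antisym)
      show "emeasure lborel (\<psi> -` C) \<le> emeasure lborel C"
        by (rule LIMSEQ_le_const[OF lim1]) (use le1 in auto)
      show "emeasure lborel C \<le> emeasure lborel (\<psi> -` C)"
        by (rule LIMSEQ_le_const[OF lim2]) (use le2 in auto)
    qed
  qed simp
qed

section \<open>Choice of the parameters and the Cauchy estimate\<close>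

context initial_density
begin

text \<open>The quotient of \<open>mesh\<close> and \<open>eps\<close> is (m + 2)^-3, so about T (m
  + 2)^4 steps with Jacobian errors of order (m + 2)^-6 accumulate an error of order (m + 2)^-2. The
  shift by 2 makes the kicks small enough for the Jacobian estimate from m = 0 on.\<close>

definition eps :: "nat \<Rightarrow> real" where "eps m = 1 / (real m + 2)"
definition mesh :: "nat \<Rightarrow> real" where "mesh m = 1 / (real m + 2) ^ 4"
text \<open>Total volume distortion up to time T: at most 2 T / \<open>mesh m\<close> kicks, each
  with a factor 1 + s \<le> exp s for s = 16 / (m + 2)^6, give the exponent 32 T / (m +
  2)^2.\<close>

definition rate :: "real \<Rightarrow> nat \<Rightarrow> real" where "rate T m = exp (32 * T / (real m + 2)\<^sup>2)"
text \<open>The first summand collects the consistency errors of the completed steps; the second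
  bounds the step left unfinished, with phase-space velocity at most
  \<open>2 * speed\<close>.\<close>

definition err :: "real \<Rightarrow> nat \<Rightarrow> real" where
  "err T m = T * (lip T * (sqrt (eps m) + mesh m * speed)) + 2 * speed * mesh m"
definition approx :: "nat \<Rightarrow> real \<Rightarrow> R4 \<Rightarrow> R4" where
  "approx m t = scheme \<nu> (eps m) (mesh m) (nat \<lfloor>t / mesh m\<rfloor>)"

lemma eps_pos: "0 < eps m" and mesh_pos: "0 < mesh m"
  by (simp_all add: eps_def mesh_def)

lemma mesh_eps: "mesh m * (2 / eps m) = 2 / (real m + 2) ^ 3"
proof -
  have "1 / r ^ 4 * (2 / (1 / r)) = 2 / r ^ 3" if "r \<noteq> 0" for r :: real
    using that by (simp add: eval_nat_numeral)
  then show ?thesis by (simp only: eps_def mesh_def)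
qed

lemma mesh_eps_le: "mesh m * (2 / eps m) \<le> 1 / 2"
proof -
  have "(2::real) ^ 3 \<le> (real m + 2) ^ 3" by (intro power_mono) auto
  then have "4 \<le> (real m + 2) ^ 3" by simp
  then show ?thesis unfolding mesh_eps by (simp add: field_simps)
qed

lemma mesh_tendsto: "mesh \<longlonglongrightarrow> 0" and eps_tendsto: "eps \<longlonglongrightarrow> 0"
  unfolding mesh_def[abs_def] eps_def[abs_def] by real_asymp+

lemma rate_tendsto: "rate T \<longlonglongrightarrow> 1"
  unfolding rate_def[abs_def] by real_asymp

lemma err_tendsto: "err T \<longlonglongrightarrow> 0"
  unfolding err_def[abs_def]
  by (rule tendsto_eq_intros mesh_tendsto tendsto_real_sqrt[OF eps_tendsto] refl | simp)+

lemma rate_antimono: "0 \<le> T \<Longrightarrow> m \<le> m' \<Longrightarrow> rate T m' \<le> rate T m"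
  unfolding rate_def by (intro exp_le_cancel_iff[THEN iffD2] divide_left_mono power_mono) auto

lemma err_antimono:
  assumes "0 \<le> T" "m \<le> m'"
  shows "err T m' \<le> err T m"
proof -
  have "eps m' \<le> eps m" "mesh m' \<le> mesh m"
    unfolding eps_def mesh_def using assms by (auto intro!: divide_left_mono power_mono)
  then show ?thesis
    unfolding err_def using assms(1) lip_nonneg speed_pos
    by (intro add_mono mult_left_mono mult_right_mono) auto
qed

lemma err_nonneg: "0 \<le> T \<Longrightarrow> 0 \<le> err T m"
  using lip_nonneg[of T] speed_pos eps_pos[of m] mesh_pos[of m] by (simp add: err_def)

lemma power_le_rate:
  assumes "real k * mesh m \<le> T"
  shows "(1 + 4 * (mesh m * (2 / eps m))\<^sup>2) ^ (2 * k) \<le> rate T m"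
proof -
  let ?x = "4 * (mesh m * (2 / eps m))\<^sup>2" and ?r = "real m + 2"
  have r: "?r > 0" by simp
  have "(1 + ?x) ^ (2 * k) \<le> exp ?x ^ (2 * k)"
    by (intro power_mono exp_ge_add_one_self) auto
  also have "\<dots> = exp (real (2 * k) * ?x)" by (rule exp_of_nat_mult[symmetric])
  also have "real (2 * k) * ?x = 32 * (real k * mesh m) / ?r\<^sup>2"
    unfolding mesh_eps by (simp add: mesh_def power_divide power_mult[symmetric] power_add[symmetric])
  also have "exp \<dots> \<le> rate T m"
    unfolding rate_def using assms by (intro exp_le_cancel_iff[THEN iffD2] divide_right_mono) auto
  finally show ?thesis .
qed

context
  fixes T :: real and m :: nat
  assumes T: "0 \<le> T" and rate2: "rate T m \<le> 2"
begin

lemma floor_mesh: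
  assumes "t \<in> {0..T}"
  shows "real (nat \<lfloor>t / mesh m\<rfloor>) * mesh m \<le> t" "nat \<lfloor>t / mesh m\<rfloor> \<le> nat \<lfloor>T / mesh m\<rfloor>"
    "t - real (nat \<lfloor>t / mesh m\<rfloor>) * mesh m \<le> mesh m"
proof -
  have "real (nat \<lfloor>t / mesh m\<rfloor>) \<le> t / mesh m" "t / mesh m \<le> real (nat \<lfloor>t / mesh m\<rfloor>) + 1"
    using assms mesh_pos[of m] by auto
  then show "real (nat \<lfloor>t / mesh m\<rfloor>) * mesh m \<le> t" "t - real (nat \<lfloor>t / mesh m\<rfloor>) * mesh m \<le> mesh m"
    using mesh_pos[of m] by (auto simp: field_simps)
  show "nat \<lfloor>t / mesh m\<rfloor> \<le> nat \<lfloor>T / mesh m\<rfloor>"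
    using assms mesh_pos[of m] by (intro nat_mono floor_mono divide_right_mono) auto
qed

lemma T_in: "T \<in> {0..T}" using T by simp

lemmas total = floor_mesh(1)[OF T_in]

lemmas power_le_2 = order_trans[OF power_le_rate[OF total] rate2]

lemmas scheme_facts =
  spread_scheme[OF eps_pos mesh_pos mesh_eps_le total power_le_2]
  scheme_displacement[OF eps_pos mesh_pos mesh_eps_le total power_le_2]
  admissible_scheme[OF eps_pos mesh_pos mesh_eps_le total power_le_2]
  scheme_sum[OF eps_pos mesh_pos mesh_eps_le total power_le_2]

lemma approx_quasi_preserving:
  assumes "t \<in> {0..T}"
  shows "quasi_preserving (rate T m) (approx m t)"
  unfolding approx_def
proof (rule quasi_preserving_mono[OF quasi_preserving_scheme[OF eps_pos less_imp_le[OF mesh_pos] mesh_eps_le]])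
  have "real (nat \<lfloor>t / mesh m\<rfloor>) * mesh m \<le> T" using floor_mesh(1)[OF assms] assms by simp
  then show "(1 + 4 * (mesh m * (2 / eps m))\<^sup>2) ^ (2 * nat \<lfloor>t / mesh m\<rfloor>) \<le> rate T m"
    by (rule power_le_rate)
qed

lemma approx_admissible: "t \<in> {0..T} \<Longrightarrow> admissible (adm T) (approx m t)"
  unfolding approx_def by (intro scheme_facts floor_mesh(2))



lemma approx_displacement:
  assumes t: "t \<in> {0..T}"
  shows "norm (fst (approx m t w) - fst w) \<le> t * speed" "norm (snd (approx m t w) - snd w) \<le> t * speed"
proof -
  have "real (nat \<lfloor>t / mesh m\<rfloor>) * mesh m * speed \<le> t * speed"
    using floor_mesh(1)[OF t] speed_pos by (intro mult_right_mono) auto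
  then show "norm (fst (approx m t w) - fst w) \<le> t * speed" "norm (snd (approx m t w) - snd w) \<le> t * speed"
    using scheme_facts(2)[OF floor_mesh(2)[OF t], of w] unfolding approx_def by linarith+
qed

lemma approx_integral:
  assumes t: "t \<in> {0..T}"
  shows "(\<lambda>s. velocity \<nu> (approx m s) (approx m s w)) integrable_on {0..t}"
    and "norm (approx m t w - w - integral {0..t} (\<lambda>s. velocity \<nu> (approx m s) (approx m s w))) \<le> err T m"
proof -
  let ?S = "scheme \<nu> (eps m) (mesh m)" and ?k = "nat \<lfloor>t / mesh m\<rfloor>"
  define c where "c i = velocity \<nu> (?S i) (?S i w)" for i
  have hi: "((\<lambda>s. velocity \<nu> (approx m s) (approx m s w)) has_integral
     ((\<Sum>i<?k. mesh m *\<^sub>R c i) + (t - real ?k * mesh m) *\<^sub>R c ?k)) {0..t}"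
    using has_integral_step[OF mesh_pos[of m], of t c] t by (simp add: c_def approx_def)
  then show "(\<lambda>s. velocity \<nu> (approx m s) (approx m s w)) integrable_on {0..t}" by (rule has_integral_integrable)
  have "norm (approx m t w - w - integral {0..t} (\<lambda>s. velocity \<nu> (approx m s) (approx m s w)))
    = norm ((approx m t w - w - (\<Sum>i<?k. mesh m *\<^sub>R c i)) - (t - real ?k * mesh m) *\<^sub>R c ?k)"
    by (simp add: integral_unique[OF hi] algebra_simps)
  also have "\<dots> \<le> norm (approx m t w - w - (\<Sum>i<?k. mesh m *\<^sub>R c i)) + norm ((t - real ?k * mesh m) *\<^sub>R c ?k)"
    by (rule norm_triangle_ineq4)
  also have "\<dots> \<le> real ?k * mesh m * (lip T * (sqrt (eps m) + mesh m * speed)) + mesh m * (2 * speed)"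
  proof (intro add_mono)
    show "norm (approx m t w - w - (\<Sum>i<?k. mesh m *\<^sub>R c i)) \<le> real ?k * mesh m * (lip T * (sqrt (eps m) + mesh m * speed))"
      unfolding approx_def c_def by (rule scheme_facts(4)[OF floor_mesh(2)[OF t]])
    have "norm (c ?k) \<le> 2 * speed"
      unfolding c_def by (rule norm_velocity_le[OF scheme_facts(1)[OF floor_mesh(2)[OF t]]])
    then show "norm ((t - real ?k * mesh m) *\<^sub>R c ?k) \<le> mesh m * (2 * speed)"
      using floor_mesh[OF t] mesh_pos[of m] by (simp add: mult_mono)
  qed
  also have "\<dots> \<le> T * (lip T * (sqrt (eps m) + mesh m * speed)) + mesh m * (2 * speed)"
    using floor_mesh(1)[OF t] t lip_nonneg[of T] speed_pos eps_pos[of m] mesh_pos[of m]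
    by (intro add_mono mult_right_mono) auto
  finally show "norm (approx m t w - w - integral {0..t} (\<lambda>s. velocity \<nu> (approx m s) (approx m s w))) \<le> err T m"
    by (simp add: err_def mult.commute mult.left_commute)
qed

end

lemma eventually_rate: "\<forall>\<^sub>F m in sequentially. rate T m \<le> 2"
  using order_tendstoD(2)[OF rate_tendsto[of T], of 2] by (auto elim: eventually_mono)

lemma approx_measurable: "approx m t \<in> borel_measurable borel"
  unfolding approx_def
  by (rule quasi_preservingD(1)[OF quasi_preserving_scheme[OF eps_pos less_imp_le[OF mesh_pos] mesh_eps_le]])

lemma norm_diff_le_fst_snd: "norm (x - y) \<le> norm (fst x - fst y) + norm (snd x - snd y)"
  for x y :: "'a::real_normed_vector \<times> 'b::real_normed_vector"
  using norm_Pair_le[of "fst x - fst y" "snd x - snd y"] by (simp add: minus_prod_def)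

text \<open>Both families solve the same integral equation up to their errors. As the velocity
  depends on the whole map, the comparison runs over all times and starting points at once, and
  \<open>lip T\<close> counts twice, for the moved point and for the changed sources. Bounded
  displacement supplies the finite bound from which the contraction starts.\<close>

lemma approx_diff:
  assumes T: "0 \<le> T" and m: "rate T m \<le> 2" "rate T m' \<le> 2" and t: "t \<in> {0..T}"
  shows "norm (approx m t z - approx m' t z) \<le> 2 * (err T m + err T m') * exp (2 * (2 * lip T) * t)"
proof -
  define u where "u = (\<lambda>(s, z). norm (approx m s z - approx m' s z))"
  define e where "e = (\<lambda>(s, z::R4). exp (2 * (2 * lip T) * s))"
  have e1: "1 \<le> e (s, z)" if "s \<in> {0..T}" for s z
    using that lip_nonneg[of T] by (simp add: e_def)
  have "u (t, z) \<le> 2 * (err T m + err T m') * e (t, z)"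
  proof (rule weighted_contraction_bound[where S = "{0..T} \<times> UNIV" and B = "4 * (T * speed)"])
    show "0 < e i" for i by (simp add: e_def case_prod_beta)
    show "0 \<le> err T m + err T m'" using err_nonneg[OF T] by (simp add: add_nonneg_nonneg)
    show "(t, z) \<in> {0..T} \<times> UNIV" using t by simp
    show "u i \<le> 4 * (T * speed) * e i" if "i \<in> {0..T} \<times> UNIV" for i
    proof -
      obtain s z where i: "i = (s, z)" by (rule prod.exhaust)
      then have s: "s \<in> {0..T}" using that by simp
      have d: "norm (approx k s z - z) \<le> 2 * (T * speed)" if "rate T k \<le> 2" for k
      proof -
        have "s * speed \<le> T * speed" using s speed_pos by (intro mult_right_mono) auto
        then show ?thesis
          using norm_diff_le_fst_snd[of "approx k s z" z] approx_displacement[OF T that s, of z] by linarith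
      qed
      have "u i \<le> norm (approx m s z - z) + norm (approx m' s z - z)"
        unfolding i u_def using norm_triangle_ineq4[of "approx m s z - z" "approx m' s z - z"] by simp
      also have "\<dots> \<le> 4 * (T * speed) * 1" using d[OF m(1)] d[OF m(2)] by simp
      also have "\<dots> \<le> 4 * (T * speed) * e i"
        unfolding i using e1[OF s] T speed_pos by (intro mult_left_mono) auto
      finally show ?thesis .
    qed
    fix a i assume a: "0 \<le> a" and ua: "\<And>i. i \<in> {0..T} \<times> UNIV \<Longrightarrow> u i \<le> a * e i" and i0: "i \<in> {0..T} \<times> (UNIV::R4 set)"
    obtain s z where i: "i = (s, z)" by (rule prod.exhaust)
    then have s: "s \<in> {0..T}" using i0 by simp
    let ?v = "\<lambda>m r. velocity \<nu> (approx m r) (approx m r z)"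
    have int: "?v m integrable_on {0..s}" "?v m' integrable_on {0..s}"
      by (rule approx_integral(1)[OF T m(1) s], rule approx_integral(1)[OF T m(2) s])
    have D: "norm (integral {0..s} (\<lambda>r. ?v m r - ?v m' r)) \<le> a / 2 * exp (2 * (2 * lip T) * s) - a / 2"
    proof (rule norm_integral_exp_le)
      show "(\<lambda>r. ?v m r - ?v m' r) integrable_on {0..s}" by (intro integrable_diff int)
      show "0 \<le> s" using s by simp
      fix r assume "r \<in> {0..s}"
      then have r: "r \<in> {0..T}" using s by auto
      have le: "norm (approx m r w - approx m' r w) \<le> a * exp (2 * (2 * lip T) * r)" for w
        using ua[of "(r, w)"] r by (simp add: u_def e_def)
      have "norm (?v m r - ?v m' r) \<le> lip T * (norm (approx m r z - approx m' r z) + a * exp (2 * (2 * lip T) * r))"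
        unfolding lip_def[symmetric]
        using norm_velocity_diff_le[OF approx_admissible[OF T m(1) r] approx_admissible[OF T m(2) r] le, of "approx m r z" "approx m' r z"]
        by (simp add: lip_def)
      also have "\<dots> \<le> lip T * (a * exp (2 * (2 * lip T) * r) + a * exp (2 * (2 * lip T) * r))"
        using le[of z] lip_nonneg[of T] a by (intro mult_left_mono add_mono) auto
      finally show "norm (?v m r - ?v m' r) \<le> 2 * lip T * (a * exp (2 * (2 * lip T) * r))" by simp
    qed
    have eq: "approx m s z - approx m' s z
       = (approx m s z - z - integral {0..s} (?v m)) - (approx m' s z - z - integral {0..s} (?v m')) + integral {0..s} (\<lambda>r. ?v m r - ?v m' r)"
      by (simp add: integral_diff[OF int])
    have tri: "norm (x - y + w) \<le> norm x + norm y + norm w" for x y w :: R4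
      using norm_triangle_ineq[of "x - y" w] norm_triangle_ineq4[of x y] by linarith
    have "norm (approx m s z - approx m' s z)
      \<le> norm (approx m s z - z - integral {0..s} (?v m)) + norm (approx m' s z - z - integral {0..s} (?v m'))
        + norm (integral {0..s} (\<lambda>r. ?v m r - ?v m' r))"
      by (rule ord_eq_le_trans[OF arg_cong[where f = norm, OF eq] tri])
    also have "\<dots> \<le> err T m + err T m' + (a / 2 * exp (2 * (2 * lip T) * s) - a / 2)"
      by (intro add_mono approx_integral(2)[OF T m(1) s] approx_integral(2)[OF T m(2) s] D)
    finally have "u i \<le> err T m + err T m' + (a / 2 * e i - a / 2)"
      by (simp add: i u_def e_def)
    also have "\<dots> \<le> (err T m + err T m') * e i + a / 2 * e i"
    proof -
      have "(err T m + err T m') * 1 \<le> (err T m + err T m') * e i"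
        unfolding i using e1[OF s] err_nonneg[OF T] by (intro mult_left_mono) (auto simp: add_nonneg_nonneg)
      then show ?thesis using a by simp
    qed
    finally show "u i \<le> (err T m + err T m' + a / 2) * e i" by (simp add: algebra_simps)
  qed
  then show ?thesis by (simp add: u_def e_def)
qed

section \<open>The limit flow\<close>

definition flow :: "real \<Rightarrow> R4 \<Rightarrow> R4" where
  "flow t z = lim (\<lambda>m. approx m t z)"

definition gap :: "real \<Rightarrow> nat \<Rightarrow> real" where
  "gap T m = 4 * err T m * exp (2 * (2 * lip T) * T)"

lemma gap_tendsto: "gap T \<longlonglongrightarrow> 0"
  unfolding gap_def[abs_def] by (rule tendsto_eq_intros err_tendsto refl | simp)+

lemma approx_gap:
  assumes T: "0 \<le> T" and m: "rate T m \<le> 2" "m \<le> m'" and t: "t \<in> {0..T}"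
  shows "norm (approx m t z - approx m' t z) \<le> gap T m"
proof -
  have "rate T m' \<le> 2" using rate_antimono[OF T m(2)] m(1) by linarith
  then have "norm (approx m t z - approx m' t z) \<le> 2 * (err T m + err T m') * exp (2 * (2 * lip T) * t)"
    by (rule approx_diff[OF T m(1) _ t])
  also have "\<dots> \<le> 4 * err T m * exp (2 * (2 * lip T) * T)"
  proof (rule mult_mono)
    show "2 * (err T m + err T m') \<le> 4 * err T m" using err_antimono[OF T m(2)] by simp
    show "exp (2 * (2 * lip T) * t) \<le> exp (2 * (2 * lip T) * T)"
      using t lip_nonneg[of T] by (simp add: mult_left_mono)
  qed (use err_nonneg[OF T] in auto)
  finally show ?thesis by (simp add: gap_def)
qed

lemma approx_tendsto_flow:
  assumes t: "0 \<le> t"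
  shows "(\<lambda>m. approx m t z) \<longlonglongrightarrow> flow t z"
proof -
  obtain m0 where m0: "\<And>m. m \<ge> m0 \<Longrightarrow> rate t m \<le> 2"
    using eventually_rate[of t] by (auto simp: eventually_sequentially)
  have "Cauchy (\<lambda>m. approx m t z)"
  proof (rule metric_CauchyI)
    fix e :: real assume "0 < e"
    then obtain m1 where m1: "\<And>m. m \<ge> m1 \<Longrightarrow> gap t m < e / 2"
      using order_tendstoD(2)[OF gap_tendsto[of t], of "e / 2"] by (auto simp: eventually_sequentially)
    let ?m = "max m0 m1"
    have g: "dist (approx ?m t z) (approx k t z) < e / 2" if "k \<ge> ?m" for k
      using approx_gap[OF t m0[of ?m] that, of t z] m1[of ?m] t by (simp add: dist_norm)
    show "\<exists>M. \<forall>m\<ge>M. \<forall>n\<ge>M. dist (approx m t z) (approx n t z) < e"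
      by (intro exI[of _ ?m] allI impI) (metis g dist_commute dist_triangle_half_l)
  qed
  then show ?thesis by (simp add: flow_def Cauchy_convergent_iff convergent_LIMSEQ_iff)
qed

lemma approx_flow_gap:
  assumes T: "0 \<le> T" and m: "rate T m \<le> 2" and t: "t \<in> {0..T}"
  shows "norm (approx m t z - flow t z) \<le> gap T m"
proof (rule LIMSEQ_le_const2)
  show "(\<lambda>k. norm (approx m t z - approx k t z)) \<longlonglongrightarrow> norm (approx m t z - flow t z)"
    using t by (intro tendsto_intros approx_tendsto_flow) auto
  show "\<exists>K. \<forall>k\<ge>K. norm (approx m t z - approx k t z) \<le> gap T m"
    using approx_gap[OF T m _ t] by blast
qed

lemma uniform_limit_flow:
  assumes t: "0 \<le> t"
  shows "uniform_limit UNIV (\<lambda>m. approx m t) (flow t) sequentially"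
proof (rule uniform_limitI)
  fix e :: real assume "0 < e"
  from order_tendstoD(2)[OF gap_tendsto[of t] this] eventually_rate[of t]
  show "\<forall>\<^sub>F m in sequentially. \<forall>x\<in>UNIV. dist (approx m t x) (flow t x) < e"
  proof eventually_elim
    case (elim m)
    show ?case
    proof
      fix x show "dist (approx m t x) (flow t x) < e"
        using approx_flow_gap[OF t elim(2), of t x] t elim(1) by (simp add: dist_norm)
    qed
  qed
qed

lemma flow_measurable:
  assumes "0 \<le> t"
  shows "flow t \<in> borel_measurable borel"
  by (rule borel_measurable_LIMSEQ_metric[OF approx_measurable approx_tendsto_flow[OF assms]])

lemma distr_flow:
  assumes t: "0 \<le> t"
  shows "distr lborel borel (flow t) = lborel"
proof (rule distr_eq_lborel_if_compact[OF flow_measurable[OF t]])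
  fix C :: "R4 set" assume C: "compact C"
  have "\<forall>\<^sub>F m in sequentially. quasi_preserving (rate t m) (approx m t)"
    using eventually_rate[of t]
  proof eventually_elim
    case (elim m)
    then show ?case using approx_quasi_preserving[OF t elim, of t] t by simp
  qed
  then show "emeasure lborel (flow t -` C) = emeasure lborel C"
    by (rule emeasure_vimage_compact_of_uniform_limit[OF _ rate_tendsto uniform_limit_flow[OF t] flow_measurable[OF t] C])
qed

lemma nn_integral_flow:
  assumes t: "0 \<le> t" and g [measurable]: "g \<in> borel_measurable borel"
  shows "(\<integral>\<^sup>+ z. g (flow t z) \<partial>lborel) = (\<integral>\<^sup>+ z. g z \<partial>lborel)"
proof -
  note [measurable] = flow_measurable[OF t]
  have "(\<integral>\<^sup>+ z. g z \<partial>lborel) = (\<integral>\<^sup>+ z. g z \<partial>(distr lborel borel (flow t)))"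
    by (simp only: distr_flow[OF t])
  also have "\<dots> = (\<integral>\<^sup>+ z. g (flow t z) \<partial>lborel)"
    by (rule nn_integral_distr) (use flow_measurable[OF t] in auto)
  finally show ?thesis by simp
qed

lemma quasi_preserving_flow: "0 \<le> t \<Longrightarrow> quasi_preserving 1 (flow t)"
  unfolding quasi_preserving_def by (simp add: flow_measurable nn_integral_flow)

lemma flow_displacement:
  assumes t: "0 \<le> t"
  shows "norm (fst (flow t w) - fst w) \<le> t * speed" "norm (snd (flow t w) - snd w) \<le> t * speed"
proof -
  have *: "\<forall>\<^sub>F m in sequentially. norm (fst (approx m t w) - fst w) \<le> t * speed \<and> norm (snd (approx m t w) - snd w) \<le> t * speed"
    using eventually_rate[of t]
  proof eventually_elim
    case (elim m)
    then show ?case using approx_displacement[OF t elim, of t w] t by simp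
  qed
  note l = approx_tendsto_flow[OF t, of w]
  show "norm (fst (flow t w) - fst w) \<le> t * speed"
    by (rule tendsto_upperbound[OF tendsto_norm[OF tendsto_diff[OF tendsto_fst[OF l] tendsto_const]]])
       (use * in \<open>auto elim: eventually_mono\<close>)
  show "norm (snd (flow t w) - snd w) \<le> t * speed"
    by (rule tendsto_upperbound[OF tendsto_norm[OF tendsto_diff[OF tendsto_snd[OF l] tendsto_const]]])
       (use * in \<open>auto elim: eventually_mono\<close>)
qed

lemma flow_admissible:
  assumes t: "t \<in> {0..T}"
  shows "admissible (adm T) (flow t)"
  unfolding adm_def
proof (rule quasi_preserving_imp_admissible)
  show "quasi_preserving 2 (flow t)"
    using quasi_preserving_mono[OF quasi_preserving_flow, of t 2] t by simp
  have "t * speed \<le> T * speed" using t speed_pos by (intro mult_right_mono) auto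
  then show "norm (fst (flow t w) - fst w) \<le> T * speed" "norm (snd (flow t w) - snd w) \<le> T * speed" for w
    using flow_displacement[of t w] t by auto
qed simp

lemma flow_spread: "0 \<le> t \<Longrightarrow> spread M (flow t)"
  using quasi_preserving_imp_spread[OF quasi_preserving_flow] by simp

text \<open>Integrability in time holds because the velocity along the limit is a uniform limit of
  step functions in time. The stability estimate for the velocity then carries the approximate
  equation to the limit.\<close>

lemma flow_integral:
  assumes t: "0 \<le> t"
  shows "(\<lambda>s. velocity \<nu> (flow s) (flow s z)) integrable_on {0..t}"
    and "flow t z = z + integral {0..t} (\<lambda>s. velocity \<nu> (flow s) (flow s z))"
proof -
  let ?v = "\<lambda>s. velocity \<nu> (flow s) (flow s z)" and ?a = "\<lambda>m s. velocity \<nu> (approx m s) (approx m s z)"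
  have close: "norm (?v s - ?a m s) \<le> 2 * lip t * gap t m" if "rate t m \<le> 2" "s \<in> {0..t}" for m s
  proof -
    have g: "norm (flow s w - approx m s w) \<le> gap t m" for w
      using approx_flow_gap[OF t that, of w] by (simp add: norm_minus_commute)
    have "norm (?v s - ?a m s) \<le> lip t * (norm (flow s z - approx m s z) + gap t m)"
      unfolding lip_def
      by (rule norm_velocity_diff_le[OF flow_admissible[OF that(2)] approx_admissible[OF t that] g])
    also have "\<dots> \<le> lip t * (gap t m + gap t m)"
      using g[of z] lip_nonneg[of t] by (intro mult_left_mono add_mono) auto
    finally show ?thesis by simp
  qed
  have ai: "?a m integrable_on {0..t}" if "rate t m \<le> 2" for m
    using approx_integral(1)[OF t that, of t z] t by simp
  have lim0: "(\<lambda>m. 2 * lip t * gap t m) \<longlonglongrightarrow> 0"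
    using tendsto_mult[OF tendsto_const gap_tendsto, of "2 * lip t" t] by simp
  show int: "?v integrable_on {0..t}"
  proof (subst box_real(2)[symmetric], rule integrable_uniform_limit)
    fix e :: real assume "0 < e"
    from eventually_happens'[OF _ eventually_conj[OF order_tendstoD(2)[OF lim0 this] eventually_rate[of t]]]
    obtain m where m: "2 * lip t * gap t m < e" "rate t m \<le> 2" by auto
    show "\<exists>g. (\<forall>x\<in>cbox 0 t. norm (?v x - g x) \<le> e) \<and> g integrable_on cbox 0 t"
    proof (intro exI[of _ "?a m"] conjI ballI)
      fix s assume "s \<in> cbox 0 t"
      then show "norm (?v s - ?a m s) \<le> e" using close[OF m(2), of s] m(1) by simp
    qed (use ai[OF m(2)] in simp)
  qed
  let ?b = "\<lambda>m. gap t m + err t m + 2 * lip t * gap t m * t"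
  have "norm (flow t z - z - integral {0..t} ?v) \<le> 0"
  proof (rule tendsto_lowerbound)
    show "?b \<longlonglongrightarrow> 0" by (rule tendsto_eq_intros gap_tendsto err_tendsto refl | simp)+
    show "\<forall>\<^sub>F m in sequentially. norm (flow t z - z - integral {0..t} ?v) \<le> ?b m"
      using eventually_rate[of t]
    proof eventually_elim
      case (elim m)
      have "norm (integral {0..t} (\<lambda>s. ?v s - ?a m s)) \<le> integral {0..t} (\<lambda>s. 2 * lip t * gap t m)"
        by (intro integral_norm_bound_integral integrable_diff int ai elim close integrable_const_ivl)
      also have "\<dots> = 2 * lip t * gap t m * t" using t by simp
      finally have 1: "norm (integral {0..t} ?v - integral {0..t} (?a m)) \<le> 2 * lip t * gap t m * t"
        by (simp add: integral_diff[OF int ai[OF elim]])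
      have 2: "norm (approx m t z - z - integral {0..t} (?a m)) \<le> err t m"
        using approx_integral(2)[OF t elim, of t z] t by simp
      have 3: "norm (flow t z - approx m t z) \<le> gap t m"
        using approx_flow_gap[OF t elim, of t z] t by (simp add: norm_minus_commute)
      have eq: "flow t z - z - integral {0..t} ?v = (flow t z - approx m t z)
         + (approx m t z - z - integral {0..t} (?a m)) - (integral {0..t} ?v - integral {0..t} (?a m))" by simp
      have "norm (flow t z - z - integral {0..t} ?v)
         \<le> norm (flow t z - approx m t z) + norm (approx m t z - z - integral {0..t} (?a m))
         + norm (integral {0..t} ?v - integral {0..t} (?a m))"
        by (rule ord_eq_le_trans[OF arg_cong[where f = norm, OF eq]
              order_trans[OF norm_triangle_ineq4 add_right_mono[OF norm_triangle_ineq]]])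
      also have "\<dots> \<le> gap t m + err t m + 2 * lip t * gap t m * t"
        by (rule add_mono[OF add_mono[OF 3 2] 1])
      finally show ?case .
    qed
  qed (rule trivial_limit_sequentially)
  then show "flow t z = z + integral {0..t} ?v"
    by (simp only: norm_le_zero_iff diff_diff_eq right_minus_eq)
qed

end

section \<open>Inverting the flow\<close>

lemma norm_integral_exp_back_le:
  fixes f :: "real \<Rightarrow> 'a::euclidean_space"
  assumes f: "f integrable_on {t - r..t}" and r: "0 \<le> r"
    and le: "\<And>s. s \<in> {t - r..t} \<Longrightarrow> norm (f s) \<le> K * (a * exp (2 * K * (t - s)))"
  shows "norm (integral {t - r..t} f) \<le> a / 2 * exp (2 * K * r) - a / 2"
proof -
  have "((\<lambda>s. K * (a * exp (2 * K * (t - s)))) has_integral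
     (- (a / 2 * exp (2 * K * (t - t))) - - (a / 2 * exp (2 * K * (t - (t - r)))))) {t - r..t}"
    using r by (intro fundamental_theorem_of_calculus)
      (auto intro!: derivative_eq_intros simp: has_real_derivative_iff_has_vector_derivative[symmetric])
  then show ?thesis
    using integral_norm_bound_integral[OF f has_integral_integrable le] by (auto simp: has_integral_iff)
qed

section \<open>Sharp speed and two-sided Lipschitz bounds of the flow\<close>

context initial_density
begin

text \<open>The minimum over R of 1 / (2 pi R) + M pi R^3 / 3. It is attained at R^4 = 1 / (2 pi^2
  M), where the second term is a third of the first, and equals 2 / (3 pi R).\<close>

definition max_speed :: real where
  "max_speed = 2 powr (5 / 4) / (3 * sqrt pi) * M powr (1 / 4)"

lemma max_speed_pos: "0 < max_speed"
  using M_pos by (simp add: max_speed_def)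

lemma norm_drift_le_max_speed:
  assumes \<Phi>: "spread M \<Phi>" and j: "subkernel j"
  shows "norm (drift j \<nu> \<Phi> z) \<le> max_speed"
proof -
  text \<open>With \<open>R = 1 / b\<close> the derivative in \<open>R\<close> of the bound in \<open>norm_drift_le\<close> vanishes.\<close>
  define b where "b = (2 * pi\<^sup>2 * M) powr (1 / 4)"
  have b: "0 < b" using M_pos by (simp add: b_def)
  have "b ^ 4 = (2 * pi\<^sup>2 * M) powr (1 / 4 * 4)"
    unfolding b_def using M_pos by (subst powr_powr[symmetric]) (simp add: powr_numeral)
  then have b4: "b ^ 4 = 2 * pi\<^sup>2 * M" using M_pos by simp
  have "norm (drift j \<nu> \<Phi> z) \<le> 1 / (2 * pi * (1 / b)) + M * (pi * (1 / b) ^ 3 / 3)"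
    by (rule norm_drift_le[OF j \<Phi>]) (use b in simp)
  also have "M = b ^ 4 / (2 * pi\<^sup>2)" using b4 by simp
  also have "1 / (2 * pi * (1 / b)) + b ^ 4 / (2 * pi\<^sup>2) * (pi * (1 / b) ^ 3 / 3) = 2 / (3 * pi) * b"
    using b by (simp add: power_divide power2_eq_square eval_nat_numeral field_simps)
  also have "\<dots> = max_speed"
  proof -
    have "b = 2 powr (1 / 4) * sqrt pi * M powr (1 / 4)"
      unfolding b_def using M_pos
      by (simp add: powr_mult powr_half_sqrt[symmetric] powr_powr powr_numeral[symmetric] del: powr_numeral)
    moreover have "(2::real) powr (5 / 4) = 2 * 2 powr (1 / 4)"
      using powr_add[of "2::real" 1 "1 / 4"] by simp
    moreover have "2 / (3 * pi) * (x * sqrt pi * y) = 2 * x / (3 * sqrt pi) * y" for x y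
    proof -
      have "2 / (3 * (s * s)) * (x * s * y) = 2 * x / (3 * s) * y" if "s \<noteq> 0" for s
        using that by (simp add: field_simps)
      from this[of "sqrt pi"] show ?thesis by simp
    qed
    ultimately show ?thesis by (simp only: max_speed_def)
  qed
  finally show ?thesis .
qed

definition field :: "real \<Rightarrow> R4 \<Rightarrow> R4" where
  "field t z = velocity \<nu> (flow t) z"

lemma norm_field_components:
  assumes "0 \<le> t"
  shows "norm (fst (field t z)) \<le> max_speed" "norm (snd (field t z)) \<le> max_speed"
  unfolding field_def velocity_def
  using norm_drift_le_max_speed[OF _ subkernel_J] flow_spread[OF assms] spread_swap by auto

lemma norm_field_le: "0 \<le> t \<Longrightarrow> norm (field t z) \<le> 2 * max_speed"
  using norm_diff_le_fst_snd[of "field t z" 0] norm_field_components[of t z] by simp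

lemma field_integrable: "0 \<le> t \<Longrightarrow> (\<lambda>s. field s (flow s z)) integrable_on {0..t}"
  unfolding field_def by (rule flow_integral)

lemma flow_eq: "0 \<le> t \<Longrightarrow> flow t z = z + integral {0..t} (\<lambda>s. field s (flow s z))"
  unfolding field_def by (rule flow_integral)

lemma flow_0 [simp]: "flow 0 z = z"
  using flow_eq[of 0 z] by simp

lemma flow_increment:
  assumes "0 \<le> s" "s \<le> t"
  shows "(\<lambda>r. field r (flow r z)) integrable_on {s..t}"
    and "flow t z = flow s z + integral {s..t} (\<lambda>r. field r (flow r z))"
proof -
  show "(\<lambda>r. field r (flow r z)) integrable_on {s..t}"
    by (rule integrable_on_subinterval[OF field_integrable[of t]]) (use assms in auto)
  have "integral {0..s} (\<lambda>r. field r (flow r z)) + integral {s..t} (\<lambda>r. field r (flow r z))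
    = integral {0..t} (\<lambda>r. field r (flow r z))"
    by (rule Henstock_Kurzweil_Integration.integral_combine[OF assms field_integrable]) (use assms in simp)
  then show "flow t z = flow s z + integral {s..t} (\<lambda>r. field r (flow r z))"
    using flow_eq[of t z] flow_eq[of s z] assms by (simp add: algebra_simps)
qed

lemma flow_displacement_max_speed:
  assumes t: "0 \<le> t"
  shows "norm (fst (flow t z) - fst z) \<le> t * max_speed" "norm (snd (flow t z) - snd z) \<le> t * max_speed"
proof -
  note int = field_integrable[OF t, of z]
  have bound: "norm (integral {0..t} g) \<le> t * max_speed"
    if "g integrable_on {0..t}" "\<And>s. s \<in> {0..t} \<Longrightarrow> norm (g s) \<le> max_speed" for g :: "real \<Rightarrow> R2"
  proof -
    have "norm (integral {0..t} g) \<le> integral {0..t} (\<lambda>s. max_speed)"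
      by (intro integral_norm_bound_integral that integrable_const_ivl)
    then show ?thesis using t by simp
  qed
  have "fst (flow t z) - fst z = integral {0..t} (\<lambda>s. fst (field s (flow s z)))"
    using flow_eq[OF t, of z] integral_linear[OF int bounded_linear_fst] by (simp add: comp_def)
  then show "norm (fst (flow t z) - fst z) \<le> t * max_speed"
    using bound[of "\<lambda>s. fst (field s (flow s z))"] integrable_linear[OF int bounded_linear_fst] norm_field_components(1)
    by (simp add: comp_def)
  have "snd (flow t z) - snd z = integral {0..t} (\<lambda>s. snd (field s (flow s z)))"
    using flow_eq[OF t, of z] integral_linear[OF int bounded_linear_snd] by (simp add: comp_def)
  then show "norm (snd (flow t z) - snd z) \<le> t * max_speed"
    using bound[of "\<lambda>s. snd (field s (flow s z))"] integrable_linear[OF int bounded_linear_snd] norm_field_components(2)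
    by (simp add: comp_def)
qed

lemma norm_flow_minus_id: "0 \<le> t \<Longrightarrow> norm (flow t z - z) \<le> 2 * (t * max_speed)"
  using norm_diff_le_fst_snd[of "flow t z" z] flow_displacement_max_speed[of t z] by linarith

lemma flow_lipschitz_time:
  assumes "0 \<le> s" "0 \<le> t"
  shows "norm (flow t z - flow s z) \<le> 2 * max_speed * \<bar>t - s\<bar>"
proof -
  have *: "norm (flow t z - flow s z) \<le> 2 * max_speed * \<bar>t - s\<bar>" if "0 \<le> s" "s \<le> t" for s t
  proof -
    have "norm (integral {s..t} (\<lambda>r. field r (flow r z))) \<le> integral {s..t} (\<lambda>r. 2 * max_speed)"
      using that by (intro integral_norm_bound_integral flow_increment norm_field_le integrable_const_ivl) auto
    then show ?thesis using flow_increment(2)[OF that, of z] that by (simp add: ac_simps)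
  qed
  show ?thesis
  proof (cases "s \<le> t")
    case False
    then show ?thesis using *[of t s] assms by (simp add: norm_minus_commute abs_minus_commute)
  qed (use * assms in auto)
qed

lemma field_lipschitz:
  assumes "s \<in> {0..T}" "t \<in> {0..T}"
  shows "norm (field t z - field s z') \<le> lip T * (norm (z - z') + 2 * max_speed * \<bar>t - s\<bar>)"
  unfolding field_def lip_def
  using assms by (intro norm_velocity_diff_le flow_admissible flow_lipschitz_time) auto

lemma flow_lipschitz_space:
  assumes t: "t \<in> {0..T}"
  shows "norm (flow t z - flow t z') \<le> 2 * norm (z - z') * exp (2 * lip T * T)"
proof -
  have T: "0 \<le> T" using t by simp
  let ?u = "\<lambda>s. norm (flow s z - flow s z')" and ?e = "\<lambda>s. exp (2 * lip T * s)"
  have e1: "1 \<le> ?e s" if "s \<in> {0..T}" for s using that lip_nonneg[of T] by simp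
  have "?u t \<le> 2 * norm (z - z') * ?e t"
  proof (rule weighted_contraction_bound[where S = "{0..T}" and B = "norm (z - z') + 4 * (T * max_speed)"
        and u = ?u and e = ?e and i = t])
    show "t \<in> {0..T}" by (rule t)
    fix s assume s: "s \<in> {0..T}"
    have "s * max_speed \<le> T * max_speed" using s max_speed_pos by (intro mult_right_mono) auto
    then have "?u s \<le> norm (z - z') + 4 * (T * max_speed)"
      using norm_flow_minus_id[of s z] norm_flow_minus_id[of s z'] s
        norm_triangle_ineq[of "flow s z - z + (z - z')" "z' - flow s z'"]
        norm_triangle_ineq[of "flow s z - z" "z - z'"]
      by (simp add: norm_minus_commute)
    also have "\<dots> \<le> (norm (z - z') + 4 * (T * max_speed)) * ?e s"
    proof -
      have "0 \<le> norm (z - z') + 4 * (T * max_speed)" using T max_speed_pos by simp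
      from mult_left_mono[OF e1[OF s] this] show ?thesis by (simp only: mult_1_right)
    qed
    finally show "?u s \<le> (norm (z - z') + 4 * (T * max_speed)) * ?e s" .
  next
    fix a s assume a: "0 \<le> a" and ua: "\<And>s. s \<in> {0..T} \<Longrightarrow> ?u s \<le> a * ?e s" and s: "s \<in> {0..T}"
    let ?v = "\<lambda>z r. field r (flow r z)"
    have s0: "0 \<le> s" using s by simp
    note int = field_integrable[OF s0, of z] field_integrable[OF s0, of z']
    have D: "norm (integral {0..s} (\<lambda>r. ?v z r - ?v z' r)) \<le> a / 2 * ?e s - a / 2"
    proof (rule norm_integral_exp_le[OF integrable_diff[OF int] s0])
      fix r assume "r \<in> {0..s}"
      then have r: "r \<in> {0..T}" using s by auto
      have "norm (?v z r - ?v z' r) \<le> lip T * ?u r"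
        using field_lipschitz[OF r r, of "flow r z" "flow r z'"] by simp
      also have "\<dots> \<le> lip T * (a * ?e r)" using ua[OF r] lip_nonneg[of T] by (intro mult_left_mono) auto
      finally show "norm (?v z r - ?v z' r) \<le> lip T * (a * ?e r)" .
    qed
    have eq: "flow s z - flow s z' = (z - z') + integral {0..s} (\<lambda>r. ?v z r - ?v z' r)"
      using flow_eq[OF s0, of z] flow_eq[OF s0, of z'] by (simp add: integral_diff[OF int])
    have "?u s \<le> norm (z - z') + norm (integral {0..s} (\<lambda>r. ?v z r - ?v z' r))"
      by (rule ord_eq_le_trans[OF arg_cong[where f = norm, OF eq] norm_triangle_ineq])
    also have "\<dots> \<le> norm (z - z') * ?e s + a / 2 * ?e s"
    proof (rule add_mono)
      show "norm (z - z') \<le> norm (z - z') * ?e s"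
        using mult_left_mono[OF e1[OF s], of "norm (z - z')"] by simp
    qed (use D a in simp)
    finally show "?u s \<le> (norm (z - z') + a / 2) * ?e s" by (simp only: distrib_right)
  qed simp_all
  also have "\<dots> \<le> 2 * norm (z - z') * exp (2 * lip T * T)"
    using t lip_nonneg[of T] by (intro mult_left_mono) (auto intro: mult_left_mono)
  finally show ?thesis .
qed

text \<open>The comparison of two trajectories is run backwards from time t, with r the elapsed
  backward time, so that their distance at time t bounds the one at time 0. Injectivity of the flow
  follows.\<close>

lemma flow_expansive:
  assumes t: "0 \<le> t"
  shows "norm (z - z') \<le> 2 * norm (flow t z - flow t z') * exp (2 * lip t * t)"
proof -
  let ?u = "\<lambda>r. norm (flow (t - r) z - flow (t - r) z')" and ?e = "\<lambda>r. exp (2 * lip t * r)"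
  let ?\<delta> = "norm (flow t z - flow t z')"
  have e1: "1 \<le> ?e r" if "r \<in> {0..t}" for r using that lip_nonneg[of t] by simp
  have "?u t \<le> 2 * ?\<delta> * ?e t"
  proof (rule weighted_contraction_bound[where S = "{0..t}" and B = "norm (z - z') + 4 * (t * max_speed)"
        and u = ?u and e = ?e and i = t])
    show "t \<in> {0..t}" using t by simp
    fix r assume r: "r \<in> {0..t}"
    have "(t - r) * max_speed \<le> t * max_speed" using r max_speed_pos by (intro mult_right_mono) auto
    then have "?u r \<le> norm (z - z') + 4 * (t * max_speed)"
      using norm_flow_minus_id[of "t - r" z] norm_flow_minus_id[of "t - r" z'] r
        norm_triangle_ineq[of "flow (t - r) z - z + (z - z')" "z' - flow (t - r) z'"]
        norm_triangle_ineq[of "flow (t - r) z - z" "z - z'"]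
      by (simp add: norm_minus_commute)
    also have "\<dots> \<le> (norm (z - z') + 4 * (t * max_speed)) * ?e r"
    proof -
      have "0 \<le> norm (z - z') + 4 * (t * max_speed)" using t max_speed_pos by simp
      from mult_left_mono[OF e1[OF r] this] show ?thesis by (simp only: mult_1_right)
    qed
    finally show "?u r \<le> (norm (z - z') + 4 * (t * max_speed)) * ?e r" .
  next
    fix a r assume a: "0 \<le> a" and ua: "\<And>r. r \<in> {0..t} \<Longrightarrow> ?u r \<le> a * ?e r" and r: "r \<in> {0..t}"
    let ?v = "\<lambda>z s. field s (flow s z)"
    have tr: "0 \<le> t - r" "t - r \<le> t" and r0: "0 \<le> r" using r by auto
    note int = flow_increment(1)[OF tr, of z] flow_increment(1)[OF tr, of z']
    have D: "norm (integral {t - r..t} (\<lambda>s. ?v z s - ?v z' s)) \<le> a / 2 * ?e r - a / 2"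
    proof (rule norm_integral_exp_back_le[OF integrable_diff[OF int] r0])
      fix s assume "s \<in> {t - r..t}"
      then have s: "s \<in> {0..t}" "t - s \<in> {0..t}" using r by auto
      have "norm (?v z s - ?v z' s) \<le> lip t * norm (flow s z - flow s z')"
        using field_lipschitz[OF s(1) s(1), of "flow s z" "flow s z'"] by simp
      also have "\<dots> \<le> lip t * (a * ?e (t - s))"
        using ua[OF s(2)] lip_nonneg[of t] by (intro mult_left_mono) auto
      finally show "norm (?v z s - ?v z' s) \<le> lip t * (a * exp (2 * lip t * (t - s)))" .
    qed
    have eq: "flow (t - r) z - flow (t - r) z' = (flow t z - flow t z') - integral {t - r..t} (\<lambda>s. ?v z s - ?v z' s)"
      using flow_increment(2)[OF tr, of z] flow_increment(2)[OF tr, of z'] by (simp add: integral_diff[OF int])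
    have "?u r \<le> ?\<delta> + norm (integral {t - r..t} (\<lambda>s. ?v z s - ?v z' s))"
      by (rule ord_eq_le_trans[OF arg_cong[where f = norm, OF eq] norm_triangle_ineq4])
    also have "\<dots> \<le> ?\<delta> * ?e r + a / 2 * ?e r"
    proof (rule add_mono)
      show "?\<delta> \<le> ?\<delta> * ?e r" using mult_left_mono[OF e1[OF r], of ?\<delta>] by simp
    qed (use D a in simp)
    finally show "?u r \<le> (?\<delta> + a / 2) * ?e r" by (simp only: distrib_right)
  qed simp_all
  then show ?thesis by simp
qed

section \<open>The inverse flow\<close>

lemma continuous_on_flow:
  assumes "0 \<le> t"
  shows "continuous_on S (flow t)"
proof (rule continuous_onI)
  fix x and e :: real assume "0 < e"
  show "\<exists>d>0. \<forall>x'\<in>S. dist x' x < d \<longrightarrow> dist (flow t x') (flow t x) \<le> e"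
  proof (intro exI[of _ "e / (2 * exp (2 * lip t * t))"] conjI ballI impI)
    show "0 < e / (2 * exp (2 * lip t * t))" using \<open>0 < e\<close> by simp
    fix x' assume "dist x' x < e / (2 * exp (2 * lip t * t))"
    then show "dist (flow t x') (flow t x) \<le> e"
      using flow_lipschitz_space[of t t x' x] \<open>0 \<le> t\<close> by (simp add: dist_norm field_simps)
  qed
qed

text \<open>Injectivity is the backward estimate. For surjectivity, the map sending y to x + (y -
  \<open>flow t y\<close>) takes a ball about x, larger than the maximal displacement, into itself,
  and a Brouwer fixed point is a preimage of x.\<close>

lemma bij_flow:
  assumes t: "0 \<le> t"
  shows "bij (flow t)"
proof (rule bijI)
  show "inj (flow t)"
  proof (rule injI)
    fix x y assume "flow t x = flow t y"
    then have "norm (x - y) \<le> 0" using flow_expansive[OF t, of x y] by simp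
    then show "x = y" by simp
  qed
  show "surj (flow t)"
    unfolding surj_def
  proof
    fix x :: R4
    let ?R = "2 * (t * max_speed) + 1"
    have "\<exists>y\<in>cball x ?R. flow t y = x"
    proof (rule brouwer_surjective_cball[where S = "{x}"])
      show "continuous_on (cball x ?R) (flow t)" by (rule continuous_on_flow[OF t])
      show "0 < ?R" using t max_speed_pos by (simp add: add_nonneg_pos)
      show "x' + (y - flow t y) \<in> cball x ?R" if "x' \<in> {x}" "y \<in> cball x ?R" for x' y
        using that norm_flow_minus_id[OF t, of y] by (simp add: dist_norm norm_minus_commute)
    qed simp
    then show "\<exists>y. x = flow t y" by auto
  qed
qed

text \<open>Time is carried along in order to invert jointly in time and space. Negative times are
  clamped to 0, where the flow is the identity, so that the domain is a whole Euclidean space and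
  hence open, as invariance of domain requires.\<close>

definition spacetime_flow :: "real \<times> R4 \<Rightarrow> real \<times> R4" where
  "spacetime_flow q = (fst q, flow (max 0 (fst q)) (snd q))"

definition backflow :: "real \<Rightarrow> R4 \<Rightarrow> R4" where
  "backflow t z = snd (inv spacetime_flow (t, z))"

lemma continuous_spacetime_flow: "continuous_on UNIV spacetime_flow"
proof -
  have "isCont (\<lambda>q. flow (max 0 (fst q)) (snd q)) p" for p :: "real \<times> R4"
    unfolding isCont_def
  proof (rule LIM_zero_cancel, rule Lim_null_comparison)
    define T where "T = max 0 (fst p) + 1"
    let ?b = "\<lambda>q. 2 * norm (snd q - snd p) * exp (2 * lip T * T) + 2 * max_speed * \<bar>max 0 (fst q) - max 0 (fst p)\<bar>"
    show "(?b \<longlongrightarrow> 0) (at p)"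
      by (rule tendsto_eq_intros refl | simp)+
    have "\<forall>\<^sub>F q in at p. fst q < fst p + 1"
      by (rule order_tendstoD(2)[OF tendsto_fst[OF tendsto_ident_at]]) simp
    then show "\<forall>\<^sub>F q in at p. norm (flow (max 0 (fst q)) (snd q) - flow (max 0 (fst p)) (snd p)) \<le> ?b q"
    proof eventually_elim
      case (elim q)
      have q: "max 0 (fst q) \<in> {0..T}" using elim by (auto simp: T_def)
      have "norm (flow (max 0 (fst q)) (snd q) - flow (max 0 (fst p)) (snd p))
        \<le> norm (flow (max 0 (fst q)) (snd q) - flow (max 0 (fst q)) (snd p))
          + norm (flow (max 0 (fst q)) (snd p) - flow (max 0 (fst p)) (snd p))"
        using norm_triangle_ineq[of "flow (max 0 (fst q)) (snd q) - flow (max 0 (fst q)) (snd p)"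
          "flow (max 0 (fst q)) (snd p) - flow (max 0 (fst p)) (snd p)"] by simp
      also have "\<dots> \<le> ?b q"
        by (intro add_mono flow_lipschitz_space[OF q] flow_lipschitz_time) auto
      finally show ?case .
    qed
  qed
  then show ?thesis
    unfolding spacetime_flow_def continuous_on_eq_continuous_at[OF open_UNIV]
    by (auto intro!: continuous_intros)
qed

lemma bij_spacetime_flow: "bij spacetime_flow"
proof (rule bijI)
  show "inj spacetime_flow"
  proof (rule injI)
    fix p q assume eq: "spacetime_flow p = spacetime_flow q"
    then have f: "fst p = fst q" by (simp add: spacetime_flow_def)
    then have "snd p = snd q"
      using eq bij_flow[of "max 0 (fst q)"] by (auto simp: spacetime_flow_def bij_def dest: injD)
    with f show "p = q" by (rule prod_eqI)
  qed
  show "surj spacetime_flow"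
    unfolding surj_def
  proof
    fix q :: "real \<times> R4"
    obtain z where "snd q = flow (max 0 (fst q)) z"
      using surjD[OF bij_is_surj[OF bij_flow[of "max 0 (fst q)"]], of "snd q"] by fastforce
    then show "\<exists>p. q = spacetime_flow p" by (intro exI[of _ "(fst q, z)"]) (simp add: spacetime_flow_def prod_eq_iff)
  qed
qed

text \<open>By invariance of domain a continuous injection between spaces of equal dimension has a
  continuous inverse. Joint continuity will make the transported density measurable on
  space-time.\<close>

lemma continuous_backflow: "continuous_on UNIV (\<lambda>q. backflow (fst q) (snd q))"
proof -
  obtain g where g: "homeomorphism UNIV (range spacetime_flow) spacetime_flow g"
    using invariance_of_domain_homeomorphism[OF open_UNIV continuous_spacetime_flow]
      bij_is_inj[OF bij_spacetime_flow] by auto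
  have "range spacetime_flow = UNIV" using bij_spacetime_flow by (rule bij_is_surj)
  then have cg: "continuous_on UNIV g" and gi: "\<And>x. g (spacetime_flow x) = x"
    using g by (auto simp: homeomorphism_def)
  have "inv spacetime_flow = g"
    using inv_unique_comp[of spacetime_flow g] bij_spacetime_flow gi
    by (metis bij_inv_eq_iff ext)
  then show ?thesis unfolding backflow_def using cg by (auto intro!: continuous_intros)
qed

lemma backflow_flow:
  assumes "0 \<le> t"
  shows "backflow t (flow t z) = z" "flow t (backflow t z) = z"
proof -
  have eq: "spacetime_flow (t, w) = (t, flow t w)" for w using assms by (simp add: spacetime_flow_def)
  show "backflow t (flow t z) = z"
    unfolding backflow_def eq[symmetric] by (simp add: inv_f_f bij_is_inj[OF bij_spacetime_flow])
  obtain w where "flow t w = z" using bij_flow[OF assms] by (metis bij_pointE)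
  with \<open>backflow t (flow t z) = z\<close> show "flow t (backflow t z) = z"
    unfolding backflow_def using eq[of w] by (metis inv_f_f bij_is_inj[OF bij_spacetime_flow] snd_conv)
qed

lemma borel_measurable_backflow: "(\<lambda>q. backflow (fst q) (snd q)) \<in> borel_measurable borel"
  by (rule borel_measurable_continuous_onI[OF continuous_backflow])

lemma borel_measurable_backflow_t: "backflow t \<in> borel_measurable borel"
proof -
  have "continuous_on UNIV (\<lambda>z. backflow (fst (t, z)) (snd (t, z)))"
    by (rule continuous_on_compose2[OF continuous_backflow]) (auto intro!: continuous_intros)
  then show ?thesis by (simp add: borel_measurable_continuous_onI)
qed

lemma distr_backflow:
  assumes t: "0 \<le> t"
  shows "distr lborel borel (backflow t) = lborel"
proof -
  have "distr lborel borel (backflow t) = distr (distr lborel borel (flow t)) borel (backflow t)"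
    by (simp only: distr_flow[OF t])
  also have "\<dots> = distr lborel borel (backflow t \<circ> flow t)"
    by (rule distr_distr) (use flow_measurable[OF t] borel_measurable_backflow_t in auto)
  also have "backflow t \<circ> flow t = (\<lambda>z. z)" by (simp add: fun_eq_iff backflow_flow[OF t])
  finally show ?thesis using distr_id[of "lborel :: R4 measure"] by (simp cong: distr_cong)
qed

end

section \<open>The weak solution\<close>

lemma esssup_measure_preserving:
  assumes \<Psi> [measurable]: "\<Psi> \<in> borel_measurable borel" and d: "distr lborel borel \<Psi> = lborel"
    and h [measurable]: "h \<in> borel_measurable borel"
  shows "esssup lborel (\<lambda>z. h (\<Psi> z)) = esssup lborel (h :: 'a::euclidean_space \<Rightarrow> ennreal)"
proof -
  have "(AE z in lborel. h (\<Psi> z) \<le> c) \<longleftrightarrow> (AE z in lborel. h z \<le> c)" for c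
  proof -
    have "(AE z in distr lborel borel \<Psi>. h z \<le> c) \<longleftrightarrow> (AE z in lborel. h (\<Psi> z) \<le> c)"
      by (rule AE_distr_iff) auto
    then show ?thesis by (simp only: d)
  qed
  then show ?thesis by (simp add: esssup_eq_AE)
qed

lemma Lp_norm_measure_preserving:
  assumes \<Psi> [measurable]: "\<Psi> \<in> borel_measurable borel" and d: "distr lborel borel \<Psi> = lborel"
    and g [measurable]: "g \<in> borel_measurable borel"
  shows "Lp_norm p (\<lambda>z. g (\<Psi> z)) = Lp_norm p g"
proof -
  have "(\<integral>\<^sup>+ z. ennreal (\<bar>g (\<Psi> z)\<bar> powr enn2real p) \<partial>lborel) = (\<integral>\<^sup>+ z. ennreal (\<bar>g z\<bar> powr enn2real p) \<partial>lborel)"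
  proof -
    have "(\<integral>\<^sup>+ z. ennreal (\<bar>g z\<bar> powr enn2real p) \<partial>(distr lborel borel \<Psi>))
      = (\<integral>\<^sup>+ z. ennreal (\<bar>g (\<Psi> z)\<bar> powr enn2real p) \<partial>lborel)"
      by (rule nn_integral_distr) auto
    then show ?thesis by (simp only: d)
  qed
  moreover have "esssup lborel (\<lambda>z. ennreal \<bar>g (\<Psi> z)\<bar>) = esssup lborel (\<lambda>z. ennreal \<bar>g z\<bar>)"
    by (rule esssup_measure_preserving[OF \<Psi> d, of "\<lambda>z. ennreal \<bar>g z\<bar>"]) measurable
  ultimately show ?thesis by (simp add: Lp_norm_def)
qed

lemma Lp_norm_AE_cong:
  assumes [measurable]: "f \<in> borel_measurable borel" "g \<in> borel_measurable borel"
    and ae: "AE z in lborel. f z = g z"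
  shows "Lp_norm p f = Lp_norm p g"
proof -
  have "(\<integral>\<^sup>+ z. ennreal (\<bar>f z\<bar> powr enn2real p) \<partial>lborel) = (\<integral>\<^sup>+ z. ennreal (\<bar>g z\<bar> powr enn2real p) \<partial>lborel)"
    by (rule nn_integral_cong_AE) (use ae in auto)
  moreover have "esssup lborel (\<lambda>z. ennreal \<bar>f z\<bar>) = esssup lborel (\<lambda>z. ennreal \<bar>g z\<bar>)"
    by (rule esssup_AE_cong) (use ae in auto)
  ultimately show ?thesis by (simp add: Lp_norm_def)
qed

section \<open>Test functions on the closed half space\<close>

lemma closed_spacetime: "closed spacetime"
  unfolding spacetime_def by (intro closed_Times) auto

text \<open>The gradients are given only through \<open>has_derivative\<close> relative to the half
  space. Near a point off the support \<psi> vanishes, so 0 is a derivative as well, and uniqueness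
  of the relative derivative forces the gradients to be 0.\<close>

lemma C1c_test_zero_outside:
  assumes \<psi>: "C1c_test \<psi> \<psi>t \<psi>x \<psi>v" and q: "q \<in> spacetime" "q \<notin> closure {q \<in> spacetime. \<psi> q \<noteq> 0}"
  shows "\<psi> q = 0" "\<psi>t q = 0" "\<psi>x q = 0" "\<psi>v q = 0"
proof -
  let ?K = "closure {q \<in> spacetime. \<psi> q \<noteq> 0}"
  let ?D = "\<lambda>(s, \<xi>, \<eta>). \<psi>t q * s + \<psi>x q \<bullet> \<xi> + \<psi>v q \<bullet> \<eta>"
  have out: "\<psi> p = 0" if "p \<in> spacetime" "p \<notin> ?K" for p
    using that closure_subset[of "{q \<in> spacetime. \<psi> q \<noteq> 0}"] by blast
  show "\<psi> q = 0" by (rule out[OF q])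
  have D: "(\<psi> has_derivative ?D) (at q within spacetime)"
    using \<psi> q(1) by (auto simp: C1c_test_def)
  have "open (- ?K)" by (intro open_Compl closed_closure)
  moreover have "q \<in> - ?K" using q(2) by simp
  ultimately obtain e where e0: "e > 0" "ball q e \<subseteq> - ?K" by (rule openE)
  have e: "p \<notin> ?K" if "dist p q < e" for p
  proof -
    have "p \<in> ball q e" using that by (simp add: dist_commute)
    then show ?thesis using e0(2) by blast
  qed
  have "((\<lambda>p. 0) has_derivative (\<lambda>_. 0)) (at q within spacetime)" by (rule has_derivative_const)
  then have Z: "(\<psi> has_derivative (\<lambda>_. 0)) (at q within spacetime)"
    by (rule has_derivative_transform_within[OF _ e0(1) q(1)]) (use out e in simp)
  have eq: "?D = (\<lambda>_. 0)"
  proof (rule frechet_derivative_unique_within[OF D Z])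
    fix i :: "real \<times> R2 \<times> R2" and d :: real
    assume i: "i \<in> Basis" and d: "0 < d"
    \<comment> \<open>Uniqueness relative to a set asks for points of the set nearby in every basis
      direction. Basis vectors never point backwards in time, so positive steps stay in the half
      space even at t = 0.\<close>
    have "0 \<le> fst i" using i by (auto simp: Basis_prod_def)
    then have "q + (d / 2) *\<^sub>R i \<in> spacetime"
      using q(1) d by (cases q; cases i) (auto simp: spacetime_def)
    then show "\<exists>r. 0 < \<bar>r\<bar> \<and> \<bar>r\<bar> < d \<and> q + r *\<^sub>R i \<in> spacetime"
      using d by (intro exI[of _ "d / 2"]) auto
  qed
  have *: "\<psi>t q * s + \<psi>x q \<bullet> \<xi> + \<psi>v q \<bullet> \<eta> = 0" for s \<xi> \<eta>
    using fun_cong[OF eq, of "(s, \<xi>, \<eta>)"] by simp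
  show "\<psi>t q = 0" using *[of 1 0 0] by simp
  show "\<psi>x q = 0" using *[of 0 "\<psi>x q" 0] by simp
  show "\<psi>v q = 0" using *[of 0 0 "\<psi>v q"] by simp
qed

lemma C1c_test_bounded:
  assumes \<psi>: "C1c_test \<psi> \<psi>t \<psi>x \<psi>v"
  shows "\<exists>C\<ge>0. \<forall>q\<in>spacetime. \<bar>\<psi>t q\<bar> \<le> C \<and> norm (\<psi>x q) \<le> C \<and> norm (\<psi>v q) \<le> C"
proof -
  let ?K = "closure {q \<in> spacetime. \<psi> q \<noteq> 0}"
  have K: "compact ?K" "?K \<subseteq> spacetime"
    using \<psi> closure_minimal[OF _ closed_spacetime, of "{q \<in> spacetime. \<psi> q \<noteq> 0}"] by (auto simp: C1c_test_def)
  have bd: "\<exists>C\<ge>0. \<forall>q\<in>spacetime. norm (g q) \<le> C"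
    if "continuous_on spacetime g" "\<And>q. q \<in> spacetime \<Longrightarrow> q \<notin> ?K \<Longrightarrow> g q = 0"
    for g :: "real \<times> R2 \<times> R2 \<Rightarrow> 'b::real_normed_vector"
  proof -
    have "bounded (g ` ?K)"
      by (intro compact_imp_bounded compact_continuous_image continuous_on_subset[OF that(1) K(2)] K(1))
    then obtain C where C: "\<And>q. q \<in> ?K \<Longrightarrow> norm (g q) \<le> C" by (auto simp: bounded_iff)
    have "norm (g q) \<le> max 0 C" if "q \<in> spacetime" for q
      using C[of q] \<open>\<And>q. q \<in> spacetime \<Longrightarrow> q \<notin> ?K \<Longrightarrow> g q = 0\<close>[OF that] by (cases "q \<in> ?K") auto
    then show ?thesis by (intro exI[of _ "max 0 C"]) auto
  qed
  note z = C1c_test_zero_outside[OF \<psi>]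
  obtain C1 where C1: "0 \<le> C1" "\<forall>q\<in>spacetime. norm (\<psi>t q) \<le> C1"
    using bd[of \<psi>t] z(2) \<psi> by (auto simp: C1c_test_def)
  obtain C2 where C2: "0 \<le> C2" "\<forall>q\<in>spacetime. norm (\<psi>x q) \<le> C2"
    using bd[of \<psi>x] z(3) \<psi> by (auto simp: C1c_test_def)
  obtain C3 where C3: "0 \<le> C3" "\<forall>q\<in>spacetime. norm (\<psi>v q) \<le> C3"
    using bd[of \<psi>v] z(4) \<psi> by (auto simp: C1c_test_def)
  show ?thesis
    by (rule exI[of _ "C1 + C2 + C3"]) (use C1 C2 C3 in force)
qed

section \<open>The transported density and the weak formulation\<close>

context initial_density
begin

definition sol :: "real \<Rightarrow> R4 \<Rightarrow> real" where
  "sol t z = f0 (backflow t z)"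

lemma sol_nonneg: "0 \<le> sol t z"
  by (simp add: sol_def f0_nonneg)

lemma borel_measurable_sol: "(\<lambda>q. sol (fst q) (snd q)) \<in> borel_measurable borel"
  unfolding sol_def by (rule measurable_compose[OF borel_measurable_backflow f0_measurable])

lemma borel_measurable_sol_t [measurable]: "sol t \<in> borel_measurable borel"
  unfolding sol_def[abs_def] by (rule measurable_compose[OF borel_measurable_backflow_t f0_measurable])

lemma integral_flow:
  fixes g :: "R4 \<Rightarrow> 'b::{banach, second_countable_topology}"
  assumes "0 \<le> t" "g \<in> borel_measurable borel"
  shows "(\<integral>z. g z \<partial>lborel) = (\<integral>w. g (flow t w) \<partial>lborel)"
  using integral_distr[of "flow t" lborel borel g] flow_measurable[OF assms(1)] assms(2)
  by (simp add: distr_flow[OF assms(1)])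

lemma integral_\<nu>:
  fixes g :: "R4 \<Rightarrow> 'b::{banach, second_countable_topology}"
  assumes "g \<in> borel_measurable borel"
  shows "(\<integral>w. g w \<partial>\<nu>) = (\<integral>w. f0 w *\<^sub>R g w \<partial>lborel)"
  unfolding \<nu>_def by (rule integral_density) (use assms f0_nonneg in auto)

text \<open>This closes the nonlinear loop: the flow was built from the field of the transported
  measure, and volume preservation together with \<open>sol t (flow t w) = f0 w\<close> identifies
  that field with the one generated by the density \<open>sol t\<close>.\<close>

lemma fields_sol:
  assumes t: "0 \<le> t"
  shows "V_field (sol t) x v = fst (field t (x, v))" "A_field (sol t) x v = snd (field t (x, v))"
proof -
  note [measurable] = flow_measurable[OF t]
  have "V_field (sol t) x v = (\<integral>p. sol t p *\<^sub>R J (x - fst p) (v - snd p) \<partial>lborel)"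
    by (simp add: V_field_def case_prod_beta')
  also have "\<dots> = (\<integral>w. sol t (flow t w) *\<^sub>R J (x - fst (flow t w)) (v - snd (flow t w)) \<partial>lborel)"
    by (rule integral_flow[OF t]) measurable
  also have "\<dots> = (\<integral>w. f0 w *\<^sub>R J (x - fst (flow t w)) (v - snd (flow t w)) \<partial>lborel)"
    by (simp add: sol_def backflow_flow[OF t])
  also have "\<dots> = (\<integral>w. J (x - fst (flow t w)) (v - snd (flow t w)) \<partial>\<nu>)"
    by (rule integral_\<nu>[symmetric]) measurable
  also have "\<dots> = fst (field t (x, v))" by (simp add: field_def velocity_def drift_def)
  finally show "V_field (sol t) x v = fst (field t (x, v))" .
  have "A_field (sol t) x v = (\<integral>p. sol t p *\<^sub>R J (v - snd p) (x - fst p) \<partial>lborel)"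
    by (simp add: A_field_def case_prod_beta')
  also have "\<dots> = (\<integral>w. sol t (flow t w) *\<^sub>R J (v - snd (flow t w)) (x - fst (flow t w)) \<partial>lborel)"
    by (rule integral_flow[OF t]) measurable
  also have "\<dots> = (\<integral>w. f0 w *\<^sub>R J (v - snd (flow t w)) (x - fst (flow t w)) \<partial>lborel)"
    by (simp add: sol_def backflow_flow[OF t])
  also have "\<dots> = (\<integral>w. J (v - snd (flow t w)) (x - fst (flow t w)) \<partial>\<nu>)"
    by (rule integral_\<nu>[symmetric]) measurable
  also have "\<dots> = snd (field t (x, v))" by (simp add: field_def velocity_def drift_def)
  finally show "A_field (sol t) x v = snd (field t (x, v))" .
qed

lemma continuous_on_field: "continuous_on spacetime (\<lambda>q. field (fst q) (snd q))"
proof -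
  have "((\<lambda>q. field (fst q) (snd q)) \<longlongrightarrow> field (fst p) (snd p)) (at p within spacetime)"
    if p: "p \<in> spacetime" for p
  proof (rule LIM_zero_cancel, rule Lim_null_comparison)
    define T where "T = fst p + 1"
    let ?b = "\<lambda>q. lip T * (norm (snd q - snd p) + 2 * max_speed * \<bar>fst q - fst p\<bar>)"
    show "(?b \<longlongrightarrow> 0) (at p within spacetime)"
      by (rule tendsto_eq_intros refl | simp)+
    have "\<forall>\<^sub>F q in at p within spacetime. fst q < fst p + 1"
      by (rule order_tendstoD(2)[OF tendsto_fst[OF tendsto_ident_at]]) simp
    moreover have "\<forall>\<^sub>F q in at p within spacetime. q \<in> spacetime"
      by (simp add: eventually_at_filter)
    ultimately show "\<forall>\<^sub>F q in at p within spacetime. norm (field (fst q) (snd q) - field (fst p) (snd p)) \<le> ?b q"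
    proof eventually_elim
      case (elim q)
      then show ?case using p by (intro field_lipschitz) (auto simp: T_def spacetime_def)
    qed
  qed
  then show ?thesis by (simp add: continuous_on_def)
qed

lemma continuous_on_flow_curve: "continuous_on {0..T} (\<lambda>t. flow t w)"
proof (rule continuous_on_cong[THEN iffD1, OF refl])
  show "continuous_on {0..T} (\<lambda>t. snd (spacetime_flow (t, w)))"
    by (intro continuous_on_snd continuous_on_compose2[OF continuous_spacetime_flow] continuous_intros) auto
qed (simp add: spacetime_flow_def)

lemma flow_has_vector_derivative:
  assumes t: "t \<in> {0..T}"
  shows "((\<lambda>t. flow t w) has_vector_derivative field t (flow t w)) (at t within {0..T})"
proof -
  have c: "continuous_on {0..T} (\<lambda>s. field s (flow s w))"
  proof -
    have "continuous_on {0..T} (\<lambda>s. field (fst (s, flow s w)) (snd (s, flow s w)))"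
      by (rule continuous_on_compose2[OF continuous_on_field])
         (auto simp: spacetime_def intro!: continuous_intros continuous_on_flow_curve)
    then show ?thesis by simp
  qed
  have "((\<lambda>t. w + integral {0..t} (\<lambda>s. field s (flow s w))) has_vector_derivative 0 + field t (flow t w)) (at t within {0..T})"
    by (intro has_vector_derivative_add has_vector_derivative_const integral_has_vector_derivative c t)
  then show ?thesis
    by (rule has_vector_derivative_transform[OF t, rotated, THEN has_vector_derivative_eq_rhs])
       (use flow_eq in auto)
qed

context
  fixes \<psi> \<psi>t \<psi>x \<psi>v
  assumes \<psi>: "C1c_test \<psi> \<psi>t \<psi>x \<psi>v"
begin

definition transport :: "real \<times> R4 \<Rightarrow> real" where
  "transport q = \<psi>t q + fst (field (fst q) (snd q)) \<bullet> \<psi>x q + snd (field (fst q) (snd q)) \<bullet> \<psi>v q"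

lemma continuous_on_transport: "continuous_on spacetime transport"
  unfolding transport_def
  using \<psi> by (intro continuous_intros continuous_on_field) (auto simp: C1c_test_def)

lemma borel_measurable_transport: "(\<lambda>q. indicator spacetime q *\<^sub>R transport q) \<in> borel_measurable borel"
  by (rule borel_measurable_continuous_on_indicator[OF _ continuous_on_transport])
     (use closed_spacetime in auto)

lemma test_horizon:
  obtains T where "0 \<le> T" "\<And>t z. T \<le> t \<Longrightarrow> \<psi> (t, z) = 0" "\<And>t z. T \<le> t \<Longrightarrow> transport (t, z) = 0"
proof -
  let ?K = "closure {q \<in> spacetime. \<psi> q \<noteq> 0}"
  have "bounded ?K" using \<psi> by (auto simp: C1c_test_def intro: compact_imp_bounded)
  then obtain B where B: "\<And>q. q \<in> ?K \<Longrightarrow> norm q \<le> B" by (auto simp: bounded_iff)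
  have out: "(t, z) \<in> spacetime" "(t, z) \<notin> ?K" if "max 0 B + 1 \<le> t" for t z
  proof -
    show "(t, z) \<in> spacetime" using that by (simp add: spacetime_def)
    have "B < norm (t, z)" using that norm_fst_le[of t z] by auto
    then show "(t, z) \<notin> ?K" using B by fastforce
  qed
  show thesis
  proof (rule that[of "max 0 B + 1"])
    fix t z assume t: "max 0 B + 1 \<le> t"
    show "\<psi> (t, z) = 0" by (rule C1c_test_zero_outside[OF \<psi> out[OF t]])
    show "transport (t, z) = 0" using C1c_test_zero_outside[OF \<psi> out[OF t, of z]] by (simp add: transport_def)
  qed simp
qed

lemma transport_bounded:
  obtains C where "0 \<le> C" "\<And>q. q \<in> spacetime \<Longrightarrow> \<bar>transport q\<bar> \<le> C"
proof -
  obtain C where C: "0 \<le> C" "\<And>q. q \<in> spacetime \<Longrightarrow> \<bar>\<psi>t q\<bar> \<le> C" "\<And>q. q \<in> spacetime \<Longrightarrow> norm (\<psi>x q) \<le> C"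
    "\<And>q. q \<in> spacetime \<Longrightarrow> norm (\<psi>v q) \<le> C" using C1c_test_bounded[OF \<psi>] by blast
  show thesis
  proof (rule that[of "C + max_speed * C + max_speed * C"])
    show "0 \<le> C + max_speed * C + max_speed * C" using C(1) max_speed_pos by simp
    fix q assume q: "q \<in> spacetime"
    then have q0: "0 \<le> fst q" by (auto simp: spacetime_def)
    have "\<bar>a \<bullet> b\<bar> \<le> max_speed * C" if "norm a \<le> max_speed" "norm b \<le> C" for a b :: R2
      using Cauchy_Schwarz_ineq2[of a b] mult_mono[OF that] max_speed_pos by simp
    note cs = this[OF norm_field_components(1)[OF q0] C(3)[OF q]] this[OF norm_field_components(2)[OF q0] C(4)[OF q]]
    have "\<bar>a + b + c\<bar> \<le> A + B + B" if "\<bar>a\<bar> \<le> A" "\<bar>b\<bar> \<le> B" "\<bar>c\<bar> \<le> B" for a b c A B :: real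
      using that by linarith
    from this[OF C(2)[OF q] cs] show "\<bar>transport q\<bar> \<le> C + max_speed * C + max_speed * C"
      unfolding transport_def .
  qed
qed

lemma integral_transport_along_flow:
  "(\<integral>t. indicator {0..} t * transport (t, flow t w) \<partial>lborel) = - \<psi> (0, w)"
proof -
  obtain T where T: "0 \<le> T" "\<And>t z. T \<le> t \<Longrightarrow> \<psi> (t, z) = 0" "\<And>t z. T \<le> t \<Longrightarrow> transport (t, z) = 0"
    by (rule test_horizon) blast
  let ?c = "\<lambda>t. (t, flow t w)"
  have sub: "?c ` {0..T} \<subseteq> spacetime" by (auto simp: spacetime_def)
  have der: "((\<lambda>t. \<psi> (?c t)) has_vector_derivative transport (?c t)) (at t within {0..T})" if t: "t \<in> {0..T}" for t
  proof -
    let ?D = "\<lambda>(s, \<xi>, \<eta>). \<psi>t (?c t) * s + \<psi>x (?c t) \<bullet> \<xi> + \<psi>v (?c t) \<bullet> \<eta>"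
    have "?c t \<in> spacetime" using t by (simp add: spacetime_def)
    then have "(\<psi> has_derivative ?D) (at (?c t) within spacetime)" using \<psi> by (auto simp: C1c_test_def)
    then have "(\<psi> has_derivative ?D) (at (?c t) within ?c ` {0..T})" by (rule has_derivative_subset[OF _ sub])
    moreover have "(?c has_derivative (\<lambda>s. (s, s *\<^sub>R field t (flow t w)))) (at t within {0..T})"
      using flow_has_vector_derivative[OF t, of w] unfolding has_vector_derivative_def
      by (intro has_derivative_Pair has_derivative_ident)
    ultimately have "((\<lambda>t. \<psi> (?c t)) has_derivative (\<lambda>s. ?D (s, s *\<^sub>R field t (flow t w)))) (at t within {0..T})"
      by (rule has_derivative_in_compose[rotated])
    moreover have "(\<lambda>s. ?D (s, s *\<^sub>R field t (flow t w))) = (\<lambda>s. s *\<^sub>R transport (?c t))"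
      by (auto simp: transport_def fun_eq_iff case_prod_beta algebra_simps inner_commute)
    ultimately show ?thesis by (simp add: has_vector_derivative_def)
  qed
  have cont: "continuous_on {0..T} (\<lambda>t. transport (?c t))"
    by (rule continuous_on_compose2[OF continuous_on_transport _ sub])
       (intro continuous_intros continuous_on_flow_curve)
  have "(\<integral>t. indicator {0..T} t *\<^sub>R transport (?c t) \<partial>lborel) = \<psi> (?c T) - \<psi> (?c 0)"
    by (rule integral_FTC_atLeastAtMost[OF T(1) der cont]) auto
  moreover have "(\<integral>t. indicator {0..} t * transport (?c t) \<partial>lborel) = (\<integral>t. indicator {0..T} t *\<^sub>R transport (?c t) \<partial>lborel)"
    by (rule Bochner_Integration.integral_cong) (use T(3) in \<open>auto split: split_indicator\<close>)
  ultimately show ?thesis using T(2)[of T "flow T w"] by simp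
qed

text \<open>At each time the substitution z = \<open>flow t w\<close> turns \<open>sol\<close> into
  \<open>f0\<close> and puts \<open>transport\<close> on trajectories, where it is the total time
  derivative of \<psi>. After Fubini the time integral leaves minus the value of \<psi> at (0,
  w).\<close>

lemma weak_formulation:
  "integrable lborel (\<lambda>q. indicator spacetime q *\<^sub>R (sol (fst q) (snd q) * transport q))"
  "(\<integral>q. indicator spacetime q *\<^sub>R (sol (fst q) (snd q) * transport q) \<partial>lborel) = - (\<integral>w. f0 w * \<psi> (0, w) \<partial>lborel)"
proof -
  obtain T where T: "0 \<le> T" "\<And>t z. T \<le> t \<Longrightarrow> transport (t, z) = 0"
    by (rule test_horizon) blast
  obtain C where C: "0 \<le> C" "\<And>q. q \<in> spacetime \<Longrightarrow> \<bar>transport q\<bar> \<le> C" by (rule transport_bounded) blast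
  define g where "g q = indicator spacetime q *\<^sub>R (sol (fst q) (snd q) * transport q)" for q
  define h where "h q = indicator spacetime q *\<^sub>R (f0 (snd q) * transport (fst q, flow (fst q) (snd q)))" for q
  have bd: "\<bar>indicator spacetime q * transport (fst q, z)\<bar> \<le> C * indicator {0..T} (fst q)" for q :: "real \<times> R4" and z
  proof (cases "fst q \<in> {0..T}")
    case True
    then show ?thesis using C(1) C(2)[of "(fst q, z)"] by (auto simp: spacetime_def split: split_indicator)
  next
    case False
    then show ?thesis using T(2)[of "fst q" z] by (cases q) (auto simp: spacetime_def split: split_indicator)
  qed
  have mg [measurable]: "g \<in> borel_measurable borel"
  proof -
    have "g q = sol (fst q) (snd q) * (indicator spacetime q *\<^sub>R transport q)" for q by (simp add: g_def)
    then show ?thesis using borel_measurable_times[OF borel_measurable_sol borel_measurable_transport] by presburger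
  qed
  have "continuous_on spacetime (\<lambda>q. transport (spacetime_flow q))"
    by (rule continuous_on_compose2[OF continuous_on_transport continuous_on_subset[OF continuous_spacetime_flow]])
       (auto simp: spacetime_def spacetime_flow_def)
  then have mt: "(\<lambda>q. indicator spacetime q *\<^sub>R transport (spacetime_flow q)) \<in> borel_measurable borel"
    by (intro borel_measurable_continuous_on_indicator) (use closed_spacetime in auto)
  have mh [measurable]: "h \<in> borel_measurable borel"
  proof -
    have "h q = f0 (snd q) * (indicator spacetime q *\<^sub>R transport (spacetime_flow q))" for q
      by (cases q) (auto simp: h_def spacetime_flow_def spacetime_def split: split_indicator)
    moreover have "(\<lambda>q::real \<times> R4. f0 (snd q)) \<in> borel_measurable borel" by measurable
    ultimately show ?thesis using borel_measurable_times[OF _ mt] by presburger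
  qed
  have nn_sol: "(\<integral>\<^sup>+ z. ennreal (sol t z) \<partial>lborel) = 1" if "0 \<le> t" for t
    using nn_integral_flow[OF that, of "\<lambda>z. ennreal (sol t z)"] that
    by (simp add: sol_def[of _ "flow t _"] backflow_flow f0_mass)
  \<comment> \<open>One criterion serves both the Eulerian integrand \<open>g\<close>, with F =
    \<open>sol\<close>, and the Lagrangian integrand \<open>h\<close>, with F = \<open>f0\<close> at
    all times: a probability density in space times a bounded factor supported in times from 0 to
    T.\<close>
  have integrable: "integrable (lborel \<Otimes>\<^sub>M lborel) k"
    if mk: "k \<in> borel_measurable borel" and bk: "\<And>q. \<bar>k q\<bar> \<le> F (fst q) (snd q) * (C * indicator {0..T} (fst q))"
      and F: "\<And>t z. 0 \<le> F t z" "\<And>t. 0 \<le> t \<Longrightarrow> (\<integral>\<^sup>+ z. ennreal (F t z) \<partial>lborel) = 1"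
      and mF: "\<And>t. F t \<in> borel_measurable borel"
    for k :: "real \<times> R4 \<Rightarrow> real" and F
  proof (rule integrableI_bounded)
    have mk': "k \<in> borel_measurable (lborel \<Otimes>\<^sub>M lborel)" using mk by (simp add: lborel_prod)
    then show "k \<in> borel_measurable (lborel \<Otimes>\<^sub>M lborel)" .
    have "(\<integral>\<^sup>+ q. ennreal (norm (k q)) \<partial>(lborel \<Otimes>\<^sub>M lborel)) = (\<integral>\<^sup>+ t. \<integral>\<^sup>+ z. ennreal (norm (k (t, z))) \<partial>lborel \<partial>lborel)"
      by (rule lborel.nn_integral_fst[symmetric]) (use mk' in measurable)
    also have "\<dots> \<le> (\<integral>\<^sup>+ t. ennreal C * indicator {0..T} t \<partial>lborel)"
    proof (intro nn_integral_mono)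
      fix t
      have "(\<integral>\<^sup>+ z. ennreal (norm (k (t, z))) \<partial>lborel) \<le> (\<integral>\<^sup>+ z. ennreal (F t z) * (ennreal C * indicator {0..T} t) \<partial>lborel)"
      proof (intro nn_integral_mono)
        fix z
        have "ennreal (norm (k (t, z))) \<le> ennreal (F t z * (C * indicator {0..T} t))"
          using bk[of "(t, z)"] by (intro ennreal_leI) simp
        then show "ennreal (norm (k (t, z))) \<le> ennreal (F t z) * (ennreal C * indicator {0..T} t)"
          using C(1) F(1)[of t z] by (auto simp: ennreal_mult split: split_indicator)
      qed
      also have "\<dots> = (\<integral>\<^sup>+ z. ennreal (F t z) \<partial>lborel) * (ennreal C * indicator {0..T} t)"
        by (rule nn_integral_multc) (use mF in measurable)
      also have "\<dots> \<le> ennreal C * indicator {0..T} t"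
        using F(2)[of t] by (auto split: split_indicator)
      finally show "(\<integral>\<^sup>+ z. ennreal (norm (k (t, z))) \<partial>lborel) \<le> ennreal C * indicator {0..T} t" .
    qed
    also have "\<dots> = ennreal C * ennreal T" using T(1) by (subst nn_integral_cmult_indicator) auto
    also have "\<dots> < \<infinity>" by (simp add: ennreal_mult_less_top)
    finally show "(\<integral>\<^sup>+ q. ennreal (norm (k q)) \<partial>(lborel \<Otimes>\<^sub>M lborel)) < \<infinity>" .
  qed
  have ig: "integrable (lborel \<Otimes>\<^sub>M lborel) g"
  proof (rule integrable[OF mg, of sol])
    fix q
    have "\<bar>g q\<bar> = sol (fst q) (snd q) * \<bar>indicator spacetime q * transport (fst q, snd q)\<bar>"
      by (simp add: g_def abs_mult sol_nonneg)
    also have "\<dots> \<le> sol (fst q) (snd q) * (C * indicator {0..T} (fst q))"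
      by (intro mult_left_mono bd sol_nonneg)
    finally show "\<bar>g q\<bar> \<le> sol (fst q) (snd q) * (C * indicator {0..T} (fst q))" .
  qed (use sol_nonneg nn_sol in auto)
  have ih: "integrable (lborel \<Otimes>\<^sub>M lborel) h"
  proof (rule integrable[OF mh, of "\<lambda>_. f0"])
    fix q
    have "\<bar>h q\<bar> = f0 (snd q) * \<bar>indicator spacetime q * transport (fst q, flow (fst q) (snd q))\<bar>"
      by (simp add: h_def abs_mult f0_nonneg)
    also have "\<dots> \<le> f0 (snd q) * (C * indicator {0..T} (fst q))"
      by (intro mult_left_mono bd f0_nonneg)
    finally show "\<bar>h q\<bar> \<le> f0 (snd q) * (C * indicator {0..T} (fst q))" .
  qed (use f0_nonneg f0_mass in auto)
  show "integrable lborel (\<lambda>q. indicator spacetime q *\<^sub>R (sol (fst q) (snd q) * transport q))"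
    using ig unfolding g_def[abs_def] lborel_prod .
  have inner: "(\<integral>z. g (t, z) \<partial>lborel) = (\<integral>w. h (t, w) \<partial>lborel)" for t
  proof (cases "0 \<le> t")
    case True
    have "(\<lambda>z. g (t, z)) \<in> borel_measurable borel" by measurable
    from integral_flow[OF True this] show ?thesis
      by (simp add: g_def h_def sol_def backflow_flow[OF True] spacetime_def indicator_def)
  next
    case False
    then have "g (t, z) = 0" "h (t, z) = 0" for z by (auto simp: g_def h_def spacetime_def)
    then show ?thesis by simp
  qed
  have "(\<integral>q. g q \<partial>lborel) = (\<integral>q. g q \<partial>(lborel \<Otimes>\<^sub>M lborel))" by (simp only: lborel_prod)
  also have "\<dots> = (\<integral>t. \<integral>z. g (t, z) \<partial>lborel \<partial>lborel)"
    by (rule lborel_pair.integral_fst'[OF ig, symmetric])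
  also have "\<dots> = (\<integral>t. \<integral>w. h (t, w) \<partial>lborel \<partial>lborel)" by (simp only: inner)
  also have "\<dots> = (\<integral>w. \<integral>t. h (t, w) \<partial>lborel \<partial>lborel)"
    by (rule lborel_pair.Fubini_integral[symmetric]) (use ih in simp)
  also have "\<dots> = (\<integral>w. - (f0 w * \<psi> (0, w)) \<partial>lborel)"
  proof (rule Bochner_Integration.integral_cong[OF refl])
    fix w :: R4
    have "(\<integral>t. h (t, w) \<partial>lborel) = (\<integral>t. f0 w * (indicator {0..} t * transport (t, flow t w)) \<partial>lborel)"
      by (rule Bochner_Integration.integral_cong) (auto simp: h_def spacetime_def indicator_def)
    also have "\<dots> = f0 w * - \<psi> (0, w)" by (simp add: integral_transport_along_flow)
    finally show "(\<integral>t. h (t, w) \<partial>lborel) = - (f0 w * \<psi> (0, w))" by simp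
  qed
  also have "\<dots> = - (\<integral>w. f0 w * \<psi> (0, w) \<partial>lborel)" by simp
  finally show "(\<integral>q. indicator spacetime q *\<^sub>R (sol (fst q) (snd q) * transport q) \<partial>lborel) = - (\<integral>w. f0 w * \<psi> (0, w) \<partial>lborel)"
    by (simp add: g_def[abs_def])
qed

end

section \<open>Norms of the solution\<close>

lemma Lp_norm_sol: "0 \<le> t \<Longrightarrow> Lp_norm p (sol t) = Lp_norm p f0"
  unfolding sol_def[abs_def]
  by (rule Lp_norm_measure_preserving[OF borel_measurable_backflow_t distr_backflow f0_measurable])

lemma L1loc_sol: "L1loc_L1_Linf sol"
  unfolding L1loc_L1_Linf_def
proof (intro conjI allI impI)
  have "(\<lambda>q. indicator spacetime q *\<^sub>R sol (fst q) (snd q)) \<in> borel_measurable borel"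
    using closed_spacetime by (intro borel_measurable_scaleR borel_measurable_sol borel_measurable_indicator) auto
  then show "set_borel_measurable lborel spacetime (\<lambda>(t, z). sol t z)"
    by (simp add: set_borel_measurable_def case_prod_beta')
  fix T :: real assume "0 \<le> T"
  have "Lp_norm 1 f0 = 1"
    using f0_nonneg f0_mass by (simp add: Lp_norm_def)
  moreover have "Lp_norm \<infinity> f0 \<le> ennreal M"
    unfolding Lp_norm_def using f0_nonneg f0_le_M by (auto intro!: esssup_I ennreal_leI)
  ultimately have fin: "Lp_norm 1 f0 + Lp_norm \<infinity> f0 < \<infinity>"
    by (simp add: order_le_less_trans)
  have "(\<integral>\<^sup>+ t\<in>{0..T}. (Lp_norm 1 (sol t) + Lp_norm \<infinity> (sol t)) \<partial>lborel)
     = (\<integral>\<^sup>+ t. (Lp_norm 1 f0 + Lp_norm \<infinity> f0) * indicator {0..T} t \<partial>lborel)"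
    by (intro nn_integral_cong) (auto simp: Lp_norm_sol split: split_indicator)
  also have "\<dots> = (Lp_norm 1 f0 + Lp_norm \<infinity> f0) * ennreal T"
    using \<open>0 \<le> T\<close> by (subst nn_integral_cmult_indicator) auto
  also have "\<dots> < \<infinity>" using fin by (simp add: ennreal_mult_less_top)
  finally show "(\<integral>\<^sup>+ t\<in>{0..T}. (Lp_norm 1 (sol t) + Lp_norm \<infinity> (sol t)) \<partial>lborel) < \<infinity>" .
qed

lemma weak_solution_sol: "weak_solution f0 sol"
  unfolding weak_solution_def
proof (intro conjI allI impI L1loc_sol)
  fix \<psi> \<psi>t \<psi>x \<psi>v assume \<psi>: "C1c_test \<psi> \<psi>t \<psi>x \<psi>v"
  let ?I = "\<lambda>(t, x, v). sol t (x, v) * (\<psi>t (t, x, v) + V_field (sol t) x v \<bullet> \<psi>x (t, x, v) + A_field (sol t) x v \<bullet> \<psi>v (t, x, v))"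
  have I: "(\<lambda>q. indicator spacetime q *\<^sub>R ?I q)
     = (\<lambda>q. indicator spacetime q *\<^sub>R (sol (fst q) (snd q) * transport \<psi>t \<psi>x \<psi>v q))"
  proof
    fix q :: "real \<times> R2 \<times> R2"
    show "indicator spacetime q *\<^sub>R ?I q = indicator spacetime q *\<^sub>R (sol (fst q) (snd q) * transport \<psi>t \<psi>x \<psi>v q)"
      by (cases q) (auto simp: transport_def[OF \<psi>] fields_sol spacetime_def split: split_indicator)
  qed
  show "let I = ?I in set_integrable lborel spacetime I \<and>
      (LINT q:spacetime|lborel. I q) = - (LINT (x, v)|lborel. f0 (x, v) * \<psi> (0, x, v))"
    unfolding Let_def set_integrable_def set_lebesgue_integral_def I
    using weak_formulation[OF \<psi>] by (simp add: case_prod_beta')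
qed

text \<open>The value at (x, v) is the datum at the foot of the trajectory, at most
  \<open>t * max_speed\<close> away in each component. Shifting the two weights costs the factor
  \<open>(1 + t * max_speed) powr \<gamma>\<close> twice.\<close>

lemma weighted_norm_sol_le:
  assumes t: "0 \<le> t"
  shows "weighted_norm \<gamma> (sol t) \<le> ennreal ((1 + max_speed * t) powr (2 * \<gamma>)) * ennreal N"
  unfolding weighted_norm_def
proof (rule esssup_I)
  show "(\<lambda>(x, v). ennreal ((1 + norm x) powr \<gamma> * (1 + norm v) powr \<gamma> * \<bar>sol t (x, v)\<bar>)) \<in> borel_measurable lborel"
    unfolding case_prod_beta' prod.collapse by measurable
  let ?c = "(1 + t * max_speed) powr \<gamma>"
  show "AE q in lborel. (case q of (x, v) \<Rightarrow> ennreal ((1 + norm x) powr \<gamma> * (1 + norm v) powr \<gamma> * \<bar>sol t (x, v)\<bar>))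
    \<le> ennreal ((1 + max_speed * t) powr (2 * \<gamma>)) * ennreal N"
  proof (rule AE_I2, clarify)
    fix x v :: R2
    define w where "w = backflow t (x, v)"
    have w: "flow t w = (x, v)" by (simp add: w_def backflow_flow[OF t])
    have d: "norm (fst w - x) \<le> t * max_speed" "norm (snd w - v) \<le> t * max_speed"
      using flow_displacement_max_speed[OF t, of w] by (simp_all add: w norm_minus_commute)
    note ws = weight_shift[OF d(1), of \<gamma>] weight_shift[OF d(2), of \<gamma>]
    have one: "(1 + norm y) powr \<gamma> * weight \<gamma> y = 1" for y :: R2
      using norm_ge_zero[of y] by (simp add: weight_def powr_add[symmetric] add_nonneg_eq_0_iff)
    have "sol t (x, v) \<le> N * (weight \<gamma> (fst w) * weight \<gamma> (snd w))"
      unfolding sol_def w_def[symmetric] by (rule f0_le_N)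
    also have "\<dots> \<le> N * ((?c * weight \<gamma> x) * (?c * weight \<gamma> v))"
      using N_nonneg ws gamma weight_pos[of \<gamma>, THEN less_imp_le] by (intro mult_left_mono mult_mono) auto
    finally have "(1 + norm x) powr \<gamma> * (1 + norm v) powr \<gamma> * sol t (x, v)
      \<le> (1 + norm x) powr \<gamma> * (1 + norm v) powr \<gamma> * (N * ((?c * weight \<gamma> x) * (?c * weight \<gamma> v)))"
      by (intro mult_left_mono) auto
    also have "\<dots> = ((1 + norm x) powr \<gamma> * weight \<gamma> x) * ((1 + norm v) powr \<gamma> * weight \<gamma> v) * (?c * ?c * N)"
      by (simp only: ac_simps)
    also have "\<dots> = (1 + max_speed * t) powr (2 * \<gamma>) * N"
      unfolding one by (simp add: powr_add[symmetric] mult.commute)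
    finally show "ennreal ((1 + norm x) powr \<gamma> * (1 + norm v) powr \<gamma> * \<bar>sol t (x, v)\<bar>)
      \<le> ennreal ((1 + max_speed * t) powr (2 * \<gamma>)) * ennreal N"
      using N_nonneg by (simp add: sol_nonneg ennreal_mult[symmetric] ennreal_leI)
  qed
qed

end

theorem theorem2:
  fixes \<gamma> :: real and f0 :: "R4 \<Rightarrow> real"
  assumes "\<gamma> > 2"
    and "is_P1_density f0"
    and "f0 \<in> Linf_weighted \<gamma>"
  shows "\<exists>f :: real \<Rightarrow> R4 \<Rightarrow> real.
    weak_solution f0 f \<and>
    (\<forall>p::ennreal. \<forall>t\<ge>0. 1 \<le> p \<longrightarrow> Lp_norm p (f t) = Lp_norm p f0) \<and>
    (\<forall>t\<ge>0. weighted_norm \<gamma> (f t) \<le>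
       ennreal ((1 + 2 powr (5 / 4) / (3 * sqrt pi)
                     * enn2real (Lp_norm \<infinity> f0) powr (1 / 4) * t) powr (2 * \<gamma>))
       * weighted_norm \<gamma> f0)"
proof -
  have f0 [measurable]: "f0 \<in> borel_measurable borel"
    and fin: "Lp_norm \<infinity> f0 < \<infinity>" "weighted_norm \<gamma> f0 < \<infinity>"
    using assms(3) by (auto simp: Linf_weighted_def)
  have nonneg: "AE z in lborel. 0 \<le> f0 z" using assms(2) by (simp add: is_P1_density_def)
  have mass: "(\<integral>\<^sup>+ z. ennreal (f0 z) \<partial>lborel) = 1"
  proof -
    interpret prob_space "density lborel (\<lambda>z. ennreal (f0 z))"
      using assms(2) by (simp add: is_P1_density_def P1_def)
    show ?thesis using emeasure_space_1 by (simp add: emeasure_density)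
  qed
  \<comment> \<open>Both norms are finite, so passing to reals loses nothing. With M equal to the
    supremum norm itself, \<open>max_speed\<close> becomes exactly the coefficient of t in the
    claim.\<close>
  define M where "M = enn2real (Lp_norm \<infinity> f0)"
  define N where "N = enn2real (weighted_norm \<gamma> f0)"
  have MN: "ennreal M = Lp_norm \<infinity> f0" "ennreal N = weighted_norm \<gamma> f0" "0 \<le> M" "0 \<le> N"
    using fin by (simp_all add: M_def N_def)
  have le_M: "AE z in lborel. f0 z \<le> M"
    using esssup_AE[where M = lborel and f = "\<lambda>z. ennreal \<bar>f0 z\<bar>"]
  proof eventually_elim
    case (elim z)
    then have "ennreal \<bar>f0 z\<bar> \<le> ennreal M" by (simp add: MN(1) Lp_norm_def)
    then show ?case using MN(3) by (simp add: ennreal_le_iff)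
  qed
  let ?w = "\<lambda>z::R4. weight \<gamma> (fst z) * weight \<gamma> (snd z)"
  have le_N: "AE z in lborel. f0 z \<le> N * ?w z"
    using esssup_AE[where M = lborel and f = "\<lambda>(x, v). ennreal ((1 + norm x) powr \<gamma> * (1 + norm v) powr \<gamma> * \<bar>f0 (x, v)\<bar>)"]
  proof eventually_elim
    case (elim z)
    let ?b = "(1 + norm (fst z)) powr \<gamma> * (1 + norm (snd z)) powr \<gamma>"
    have "ennreal (?b * \<bar>f0 z\<bar>) \<le> ennreal N"
      using elim by (simp add: MN(2) weighted_norm_def case_prod_beta')
    then have "?b * \<bar>f0 z\<bar> \<le> N" using MN(4) by (simp add: ennreal_le_iff)
    then have "?w z * (?b * \<bar>f0 z\<bar>) \<le> ?w z * N"
      using weight_pos[of \<gamma>, THEN less_imp_le] by (intro mult_left_mono) auto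
    moreover have "?w z * ?b = 1"
    proof -
      have "weight \<gamma> y * (1 + norm y) powr \<gamma> = 1" for y :: R2
        using norm_ge_zero[of y] by (simp add: weight_def powr_add[symmetric] add_nonneg_eq_0_iff)
      moreover have "?w z * ?b = (weight \<gamma> (fst z) * (1 + norm (fst z)) powr \<gamma>) * (weight \<gamma> (snd z) * (1 + norm (snd z)) powr \<gamma>)"
        by (simp only: ac_simps)
      ultimately show ?thesis by simp
    qed
    ultimately have "\<bar>f0 z\<bar> \<le> ?w z * N" by (simp only: mult.assoc[symmetric] mult_1)
    then show ?case by (simp add: mult.commute)
  qed
  text \<open>Modify \<open>f0\<close> on a null set so that all bounds hold everywhere.\<close>
  define g0 where "g0 z = (if 0 \<le> f0 z \<and> f0 z \<le> M \<and> f0 z \<le> N * ?w z then f0 z else 0)" for z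
  have ae: "AE z in lborel. g0 z = f0 z"
    using nonneg le_M le_N by eventually_elim (simp add: g0_def)
  have g0 [measurable]: "g0 \<in> borel_measurable borel" unfolding g0_def[abs_def] by measurable
  interpret initial_density \<gamma> M N g0
  proof
    show "\<gamma> > 2" by (rule assms(1))
    show "g0 \<in> borel_measurable borel" by (rule g0)
    show "0 \<le> g0 z" "g0 z \<le> M" "g0 z \<le> N * (weight \<gamma> (fst z) * weight \<gamma> (snd z))" for z
      using MN(3,4) weight_pos[of \<gamma>, THEN less_imp_le] by (auto simp: g0_def)
    have "(\<integral>\<^sup>+ z. ennreal (g0 z) \<partial>lborel) = (\<integral>\<^sup>+ z. ennreal (f0 z) \<partial>lborel)"
      by (rule nn_integral_cong_AE) (use ae in auto)
    then show "(\<integral>\<^sup>+ z. ennreal (g0 z) \<partial>lborel) = 1" using mass by simp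
  qed
  have "weak_solution f0 sol"
  proof -
    \<comment> \<open>\<open>sol\<close> is built from the representative \<open>g0\<close>. The
      weak formulation sees the datum only through this integral at time 0, which is the same for
      \<open>f0\<close>.\<close>
    have eq: "(LINT (x, v)|lborel. g0 (x, v) * \<psi> (0, x, v)) = (LINT (x, v)|lborel. f0 (x, v) * \<psi> (0, x, v))"
      if "C1c_test \<psi> \<psi>t \<psi>x \<psi>v" for \<psi> \<psi>t \<psi>x \<psi>v
    proof -
      have "continuous (at q within spacetime) \<psi>" if "q \<in> spacetime" for q
      proof -
        have "(\<psi> has_derivative (\<lambda>(s, \<xi>, \<eta>). \<psi>t q * s + \<psi>x q \<bullet> \<xi> + \<psi>v q \<bullet> \<eta>)) (at q within spacetime)"
          using \<open>C1c_test \<psi> \<psi>t \<psi>x \<psi>v\<close> that unfolding C1c_test_def by blast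
        then show ?thesis by (rule has_derivative_continuous)
      qed
      then have "continuous_on spacetime \<psi>" by (simp add: continuous_on_eq_continuous_within)
      then have "continuous_on UNIV (\<lambda>z. \<psi> (0, z))"
        by (rule continuous_on_compose2) (auto simp: spacetime_def intro!: continuous_intros)
      then have [measurable]: "(\<lambda>z. \<psi> (0, z)) \<in> borel_measurable borel"
        by (rule borel_measurable_continuous_onI)
      show ?thesis
        unfolding case_prod_beta' prod.collapse
        by (rule integral_cong_AE) (use ae in auto)
    qed
    show ?thesis
      unfolding weak_solution_def
    proof (intro conjI allI impI L1loc_sol)
      fix \<psi> \<psi>t \<psi>x \<psi>v assume \<psi>: "C1c_test \<psi> \<psi>t \<psi>x \<psi>v"
      then show "let I = (\<lambda>(t, x, v). sol t (x, v) *
            (\<psi>t (t, x, v) + V_field (sol t) x v \<bullet> \<psi>x (t, x, v) + A_field (sol t) x v \<bullet> \<psi>v (t, x, v)))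
          in set_integrable lborel spacetime I \<and>
             (LINT q:spacetime|lborel. I q) = - (LINT (x, v)|lborel. f0 (x, v) * \<psi> (0, x, v))"
        using weak_solution_sol unfolding weak_solution_def eq[OF \<psi>, symmetric] by blast
    qed
  qed
  moreover have "Lp_norm p (sol t) = Lp_norm p f0" if "0 \<le> t" for p t
    using Lp_norm_sol[OF that] Lp_norm_AE_cong[OF g0 f0 ae] by simp
  moreover have "weighted_norm \<gamma> (sol t) \<le>
       ennreal ((1 + 2 powr (5 / 4) / (3 * sqrt pi) * enn2real (Lp_norm \<infinity> f0) powr (1 / 4) * t) powr (2 * \<gamma>))
       * weighted_norm \<gamma> f0" if "0 \<le> t" for t
    using weighted_norm_sol_le[OF that] unfolding max_speed_def MN(2) unfolding M_def .
  ultimately show ?thesis by blast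
qed

end
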